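(* Let $n\ge1$, let $(w(t))_{t\ge0}$ be a Brownian motion on $\mathbb{CH}^n$ started at $0$ and let $(\theta(t))_{t\ge0}$ be its generalized stochastic area process. When $t\to+\infty$, the following convergence in distribution takes place: $$\frac{\theta(t)}{\sqrt{t}}\to\mathcal{N}(0,1),$$ where $\mathcal{N}(0,1)$ is a normal distribution with mean $0$ and variance $1$.
   Context: As a set, $\mathbb{CH}^n$ is the open unit ball of $\mathbb{C}^n$, with coordinates $w=(w_1,\dots,w_n)$, $|w|^2=\sum_{j=1}^n|w_j|^2<1$; the point $0$ is $w=0$. It carries the Riemannian (Bergman) metric for which $(z_1,\dots,z_{n+1})\mapsto(z_1/z_{n+1},\dots,z_n/z_{n+1})$ from the anti-de Sitter space $\mathbb{H}^{2n+1}=\{z\in\mathbb{C}^{n+1}:|z_1|^2+\dots+|z_n|^2-|z_{n+1}|^2=-1\}$ (standard Lorentz metric of signature $(2n,1)$) is an indefinite Riemannian submersion. Its Laplace--Beltrami operator is $\Delta_{\mathbb{CH}^n}=4(1-|w|^2)\sum_{k=1}^n\frac{\partial^2}{\partial w_k\partial\overline{w_k}}-4(1-|w|^2)\mathcal{R}\overline{\mathcal{R}}$ with $\mathcal{R}=\sum_{j=1}^nw_j\frac{\partial}{\partial w_j}$, and Brownian motion on $\mathbb{CH}^n$ is the diffusion with generator $\frac12\Delta_{\mathbb{CH}^n}$. Its generalized stochastic area process is $$\theta(t)=\frac i2\sum_{j=1}^n\int_0^t\frac{w_j(s)\,d\overline{w_j}(s)-\overline{w_j}(s)\,dw_j(s)}{1-|w(s)|^2}$$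 (Stratonovich, equivalently It\^o, integrals). *)

theory Defs
  imports "HOL-Probability.Probability"
begin

text \<open>
  The complex hyperbolic space is the set \<open>ball 0 1\<close> of the Euclidean space \<open>complex ^ 'n\<close>,
  whose norm satisfies \<open>(norm w)\<^sup>2 = (\<Sum>j\<in>UNIV. (cmod (w $ j))\<^sup>2)\<close>.
\<close>

text \<open>
  Wirtinger operators \<open>\<partial>/\<partial>w\<^sub>k = (\<partial>/\<partial>x\<^sub>k - \<i> \<partial>/\<partial>y\<^sub>k) / 2\<close> and
  \<open>\<partial>/\<partial>(cnj w\<^sub>k) = (\<partial>/\<partial>x\<^sub>k + \<i> \<partial>/\<partial>y\<^sub>k) / 2\<close>, where \<open>w\<^sub>k = x\<^sub>k + \<i> y\<^sub>k\<close>; the derivative of \<open>f\<close>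
  is the real one.
\<close>

definition wirtinger :: "'n \<Rightarrow> (complex ^ 'n \<Rightarrow> complex) \<Rightarrow> complex ^ 'n \<Rightarrow> complex" where
  "wirtinger k f w =
     (frechet_derivative f (at w) (axis k 1) - \<i> * frechet_derivative f (at w) (axis k \<i>)) / 2"

definition wirtinger_bar :: "'n \<Rightarrow> (complex ^ 'n \<Rightarrow> complex) \<Rightarrow> complex ^ 'n \<Rightarrow> complex" where
  "wirtinger_bar k f w =
     (frechet_derivative f (at w) (axis k 1) + \<i> * frechet_derivative f (at w) (axis k \<i>)) / 2"

definition radial_op :: "(complex ^ 'n \<Rightarrow> complex) \<Rightarrow> complex ^ 'n \<Rightarrow> complex" where
  "radial_op f w = (\<Sum>j\<in>UNIV. w $ j * wirtinger j f w)"

definition radial_op_bar :: "(complex ^ 'n \<Rightarrow> complex) \<Rightarrow> complex ^ 'n \<Rightarrow> complex" where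
  "radial_op_bar f w = (\<Sum>j\<in>UNIV. cnj (w $ j) * wirtinger_bar j f w)"

definition CH_laplacian :: "(complex ^ 'n \<Rightarrow> complex) \<Rightarrow> complex ^ 'n \<Rightarrow> complex" where
  "CH_laplacian f w =
     4 * of_real (1 - (norm w)\<^sup>2) * (\<Sum>k\<in>UNIV. wirtinger k (wirtinger_bar k f) w)
     - 4 * of_real (1 - (norm w)\<^sup>2) * radial_op (radial_op_bar f) w"

text \<open>
  On real-valued functions the Laplacian is real-valued, so taking the real part only
  changes the type.
\<close>

definition CH_generator :: "(complex ^ 'n \<Rightarrow> real) \<Rightarrow> complex ^ 'n \<Rightarrow> real" where
  "CH_generator f w = (1 / 2) * Re (CH_laplacian (\<lambda>z. complex_of_real (f z)) w)"

definition C2_compact_support :: "(complex ^ 'n \<Rightarrow> real) \<Rightarrow> bool" where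
  "C2_compact_support f \<longleftrightarrow>
     (\<exists>f' :: complex ^ 'n \<Rightarrow> ((complex ^ 'n) \<Rightarrow>\<^sub>L real).
      \<exists>f'' :: complex ^ 'n \<Rightarrow> ((complex ^ 'n) \<Rightarrow>\<^sub>L ((complex ^ 'n) \<Rightarrow>\<^sub>L real)).
        (\<forall>z. (f has_derivative blinfun_apply (f' z)) (at z)) \<and>
        (\<forall>z. (f' has_derivative blinfun_apply (f'' z)) (at z)) \<and>
        continuous_on UNIV f'') \<and>
     (\<exists>K. compact K \<and> K \<subseteq> ball 0 1 \<and> (\<forall>z. z \<notin> K \<longrightarrow> f z = 0))"

text \<open>
  Processes are functions of a real time and an outcome; only times \<open>t \<ge> 0\<close> matter.
\<close>

definition natural_filtration ::
  "'a measure \<Rightarrow> (real \<Rightarrow> 'a \<Rightarrow> 'b::topological_space) \<Rightarrow> real \<Rightarrow> 'a measure" where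
  "natural_filtration M X t =
     sigma (space M) {X s -` A \<inter> space M | s A. 0 \<le> s \<and> s \<le> t \<and> A \<in> sets borel}"

definition martingale ::
  "'a measure \<Rightarrow> (real \<Rightarrow> 'a measure) \<Rightarrow> (real \<Rightarrow> 'a \<Rightarrow> real) \<Rightarrow> bool" where
  "martingale M F X \<longleftrightarrow>
     filtration (space M) F \<and>
     (\<forall>t\<ge>0. subalgebra M (F t) \<and> X t \<in> borel_measurable (F t) \<and> integrable M (X t)) \<and>
     (\<forall>s t. 0 \<le> s \<longrightarrow> s \<le> t \<longrightarrow> (AE \<omega> in M. real_cond_exp M (F s) (X t) \<omega> = X s \<omega>))"

text \<open>
  The diffusion with generator \<open>CH_generator\<close> started at the origin: a continuous process in the
  unit ball solving the martingale problem of the generator.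
\<close>

definition CH_brownian_motion ::
  "'a measure \<Rightarrow> (real \<Rightarrow> 'a \<Rightarrow> complex ^ 'n) \<Rightarrow> bool" where
  "CH_brownian_motion M w \<longleftrightarrow>
     (\<forall>t\<ge>0. w t \<in> borel_measurable M) \<and>
     (\<forall>\<omega>\<in>space M. continuous_on {0..} (\<lambda>t. w t \<omega>)) \<and>
     (\<forall>\<omega>\<in>space M. \<forall>t\<ge>0. w t \<omega> \<in> ball 0 1) \<and>
     (AE \<omega> in M. w 0 \<omega> = 0) \<and>
     (\<forall>f. C2_compact_support f \<longrightarrow>
        martingale M (natural_filtration M w)
          (\<lambda>t \<omega>. f (w t \<omega>) - f (w 0 \<omega>) - integral {0..t} (\<lambda>s. CH_generator f (w s \<omega>))))"

definition time_partition :: "real \<Rightarrow> nat \<Rightarrow> (nat \<Rightarrow> real) \<Rightarrow> bool" where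
  "time_partition t N p \<longleftrightarrow> p 0 = 0 \<and> p N = t \<and> (\<forall>k<N. p k \<le> p (Suc k))"

definition left_sum ::
  "(real \<Rightarrow> 'a \<Rightarrow> complex) \<Rightarrow> (real \<Rightarrow> 'a \<Rightarrow> complex) \<Rightarrow> nat \<Rightarrow> (nat \<Rightarrow> real) \<Rightarrow> 'a \<Rightarrow> complex" where
  "left_sum H X N p \<omega> = (\<Sum>k<N. H (p k) \<omega> * (X (p (Suc k)) \<omega> - X (p k) \<omega>))"

text \<open>
  \<open>I\<close> is the Ito integral process \<open>I t = \<integral>\<^sub>0\<^sup>t H dX\<close>, for a continuous adapted integrand \<open>H\<close> and a
  continuous semimartingale \<open>X\<close>: it has continuous paths, and for each \<open>t\<close> the non-anticipating
  Riemann sums converge in probability to \<open>I t\<close> as the mesh of the partition of \<open>{0..t}\<close> tends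
  to 0.  The definition is not meant for discontinuous integrands.
\<close>

definition ito_integral ::
  "'a measure \<Rightarrow> (real \<Rightarrow> 'a \<Rightarrow> complex) \<Rightarrow> (real \<Rightarrow> 'a \<Rightarrow> complex) \<Rightarrow> (real \<Rightarrow> 'a \<Rightarrow> complex) \<Rightarrow> bool"
where
  "ito_integral M H X I \<longleftrightarrow>
     (\<forall>t\<ge>0. I t \<in> borel_measurable M) \<and>
     (AE \<omega> in M. continuous_on {0..} (\<lambda>t. I t \<omega>)) \<and>
     (\<forall>t\<ge>0. \<forall>\<epsilon>>0. \<exists>\<delta>>0. \<forall>N p.
        time_partition t N p \<and> (\<forall>k<N. p (Suc k) - p k < \<delta>) \<longrightarrow>
        measure M {\<omega> \<in> space M. dist (left_sum H X N p \<omega>) (I t \<omega>) > \<epsilon>} < \<epsilon>)"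

text \<open>
  Stochastic integrals are determined up to indistinguishability, hence so is the area process.
\<close>

definition stochastic_area ::
  "'a measure \<Rightarrow> (real \<Rightarrow> 'a \<Rightarrow> complex ^ 'n) \<Rightarrow> (real \<Rightarrow> 'a \<Rightarrow> real) \<Rightarrow> bool" where
  "stochastic_area M w \<theta> \<longleftrightarrow>
     (\<forall>t\<ge>0. \<theta> t \<in> borel_measurable M) \<and>
     (\<exists>I J.
        (\<forall>j. ito_integral M
               (\<lambda>t \<omega>. w t \<omega> $ j / of_real (1 - (norm (w t \<omega>))\<^sup>2)) (\<lambda>t \<omega>. cnj (w t \<omega> $ j)) (I j)) \<and>
        (\<forall>j. ito_integral M
               (\<lambda>t \<omega>. cnj (w t \<omega> $ j) / of_real (1 - (norm (w t \<omega>))\<^sup>2)) (\<lambda>t \<omega>. w t \<omega> $ j) (J j)) \<and>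
        (AE \<omega> in M. \<forall>t\<ge>0.
           complex_of_real (\<theta> t \<omega>) = \<i> / 2 * (\<Sum>j\<in>UNIV. I j t \<omega> - J j t \<omega>)))"

end

theory Submission
  imports Defs "HOL-Real_Asymp.Real_Asymp"
begin

text \<open>
  Write \<open>\<rho> = |w|\<^sup>2\<close> and \<open>u = 1 - \<rho>\<close>.  The area process is a martingale with quadratic variation
  \<open>\<integral>\<^sub>0\<^sup>t \<rho>(s) ds\<close>, so that \<open>exp (\<i> \<xi> \<theta>(t) + \<xi>\<^sup>2/2 \<integral>\<^sub>0\<^sup>t \<rho>)\<close> has expectation 1.  Take \<open>\<xi> = x / sqrt t\<close>.
  Since \<open>\<rho> \<le> 1\<close>, the real factor stays below \<open>exp (x\<^sup>2/2)\<close>, and since the process escapes to the boundary,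
  it tends to \<open>exp (x\<^sup>2/2)\<close>.  Hence the characteristic function of \<open>\<theta>(t) / sqrt t\<close> tends to \<open>exp (-x\<^sup>2/2)\<close>,
  and Levy's continuity theorem applies.

  The escape to the boundary comes from the generator of \<open>u\<close>, which is \<open>-2 u (n - \<rho>) \<le> -2 u\<^sup>2\<close>: the
  expectation of \<open>\<integral>\<^sub>0\<^sup>t u\<^sup>2\<close> is at most \<open>1/2\<close> for every \<open>t\<close>, and that of \<open>\<integral>\<^sub>0\<^sup>t u\<close> is at most \<open>sqrt t\<close>
  (\<open>expected_mean_defect\<close>).

  The exponential identity (\<open>exponential_identity\<close>) is derived from the martingale problem and the
  Riemann sums that define \<open>\<theta>\<close>.  It is used in the real form \<open>E [exp (\<xi>\<^sup>2/2 \<integral>\<rho>) cos (\<phi> + \<xi> \<theta>)] = cos \<phi>\<close>; the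
  phases \<open>\<phi> = 0\<close> and \<open>\<phi> = -\<pi>/2\<close> give the real and the imaginary part.  Over one cell of a partition with
  left end point \<open>a\<close>, the Riemann sum of \<open>\<xi> \<theta>\<close> grows by \<open>c \<bullet> w\<close>, where \<open>c = \<xi> \<i> a / (1 - |a|\<^sup>2)\<close> is
  orthogonal to \<open>a\<close> and \<open>\<bullet>\<close> is the real inner product.  Thus the cosine of the updated phase is a plane wave
  \<open>b \<mapsto> cos (\<phi> + c \<bullet> b)\<close> evaluated along the process, with \<open>\<phi>\<close> and \<open>c\<close> known at the beginning of the cell;
  its generator at \<open>b = a\<close> is exactly \<open>-\<xi>\<^sup>2/2 |a|\<^sup>2 cos \<phi>\<close>, which the exponential factor compensates
  (\<open>plane_gen_turn\<close>, \<open>discrete_step\<close>).  The errors of the cells add up to a multiple of the mesh plus the mean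
  oscillation of the path, and vanish in the limit (\<open>discrete_exponential_tendsto\<close>).  The frequency \<open>c\<close> is
  unbounded near the boundary, so increments that start at \<open>1 - |a|\<^sup>2 < \<delta>\<close> are dropped first; as a path
  stays in a compact part of the ball up to time \<open>t\<close>, the truncation disappears when \<open>\<delta>\<close> tends to 0.

  Two points remain.  The martingale problem only speaks of compactly supported functions, whereas plane waves
  and \<open>u\<close> are not compactly supported in the ball.  On functions of \<open>u\<close> the generator only involves \<open>u q'\<close> and
  \<open>u\<^sup>2 q''\<close>, which remain bounded for the cutoffs \<open>bump (m u)\<close> as \<open>m\<close> grows; this expresses the completeness of
  the metric, and dominated convergence removes the cutoff (\<open>dynkin_wave\<close>).  Secondly, \<open>\<phi>\<close> and \<open>c\<close> are
  random; they are approximated by simple functions (\<open>expectation_wave_defect\<close>).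
\<close>

section \<open>Riemann sums along equidistant partitions\<close>

definition equipart :: "real \<Rightarrow> real \<Rightarrow> nat \<Rightarrow> nat \<Rightarrow> real" where
  "equipart a b N k = a + real k * ((b - a) / real N)"

lemma equipart_0 [simp]: "equipart a b N 0 = a"
  by (simp add: equipart_def)

lemma equipart_end [simp]: "0 < N \<Longrightarrow> equipart a b N N = b"
  by (simp add: equipart_def)

lemma equipart_step: "equipart a b N (Suc k) = equipart a b N k + (b - a) / real N"
  by (simp add: equipart_def distrib_right add_divide_distrib)

lemma equipart_mono: "a \<le> b \<Longrightarrow> j \<le> k \<Longrightarrow> equipart a b N j \<le> equipart a b N k"
  unfolding equipart_def by (intro add_left_mono mult_right_mono) auto

lemma equipart_in: "a \<le> b \<Longrightarrow> 0 < N \<Longrightarrow> k \<le> N \<Longrightarrow> equipart a b N k \<in> {a..b}"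
  using equipart_mono[of a b 0 k N] equipart_mono[of a b k N N] by simp

lemma equipart_nonneg: "0 \<le> t \<Longrightarrow> 0 \<le> equipart 0 t N k"
  by (simp add: equipart_def)

lemma equipart_cell_subset:
  "a \<le> b \<Longrightarrow> k < N \<Longrightarrow> {equipart a b N k..equipart a b N (Suc k)} \<subseteq> {a..b}"
  using equipart_in[of a b N k] equipart_in[of a b N "Suc k"] by auto

lemma integral_equipart:
  fixes f :: "real \<Rightarrow> real"
  assumes ab: "a \<le> b" and f: "f integrable_on {a..b}" and "k \<le> N" "0 < N"
  shows "integral {a..equipart a b N k} f
       = (\<Sum>j<k. integral {equipart a b N j..equipart a b N (Suc j)} f)"
  using \<open>k \<le> N\<close>
proof (induction k)
  case 0
  then show ?case by simp
next
  case (Suc k)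
  have "f integrable_on {a..equipart a b N (Suc k)}"
    using f by (rule integrable_subinterval_real)
      (use equipart_in[OF ab \<open>0 < N\<close>, of "Suc k"] Suc in auto)
  then have "integral {a..equipart a b N k} f
      + integral {equipart a b N k..equipart a b N (Suc k)} f = integral {a..equipart a b N (Suc k)} f"
    using equipart_in[OF ab \<open>0 < N\<close>, of k] Suc.prems equipart_mono[OF ab, of k "Suc k" N]
    by (intro Henstock_Kurzweil_Integration.integral_combine) auto
  with Suc show ?case by simp
qed

lemma integral_equipart_full:
  fixes f :: "real \<Rightarrow> real"
  assumes "a \<le> b" "f integrable_on {a..b}" "0 < N"
  shows "integral {a..b} f = (\<Sum>j<N. integral {equipart a b N j..equipart a b N (Suc j)} f)"
  using integral_equipart[OF assms(1,2) le_refl assms(3)] assms(3) by simp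

text \<open>
  Both the error of Riemann sums and the error of freezing the generator on each cell are bounded by a multiple of
  this total oscillation, which is small by uniform continuity of the path.
\<close>

lemma path_oscillation_tendsto_0:
  fixes f :: "real \<Rightarrow> 'b::real_normed_vector"
  assumes ab: "a \<le> b" and f: "continuous_on {a..b} f"
  shows "(\<lambda>N. \<Sum>k<N. integral {equipart a b N k..equipart a b N (Suc k)}
            (\<lambda>r. norm (f r - f (equipart a b N k)))) \<longlonglongrightarrow> 0"
proof (rule LIMSEQ_I)
  fix e :: real assume e: "0 < e"
  define e' where "e' = e / (2 * (b - a + 1))"
  have e': "0 < e'" using e ab by (simp add: e'_def)
  have "uniformly_continuous_on {a..b} f"
    using f by (intro compact_uniformly_continuous) auto
  then obtain d where d: "0 < d"
    "\<And>x y. x \<in> {a..b} \<Longrightarrow> y \<in> {a..b} \<Longrightarrow> dist y x < d \<Longrightarrow> dist (f y) (f x) < e'"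
    using e' unfolding uniformly_continuous_on_def by metis
  obtain n0 where n0: "(b - a) / d < real n0" using reals_Archimedean2 by blast
  show "\<exists>no. \<forall>N\<ge>no. norm ((\<Sum>k<N. integral {equipart a b N k..equipart a b N (Suc k)}
            (\<lambda>r. norm (f r - f (equipart a b N k)))) - 0) < e"
  proof (intro exI[of _ "Suc n0"] allI impI)
    fix N assume N: "Suc n0 \<le> N"
    then have N0: "0 < N" and "(b - a) / d < real N" using n0 by auto
    then have h: "(b - a) / real N < d" using d(1) by (simp add: field_simps)
    let ?I = "\<lambda>k. integral {equipart a b N k..equipart a b N (Suc k)}
            (\<lambda>r. norm (f r - f (equipart a b N k)))"
    have I: "0 \<le> ?I k \<and> ?I k \<le> e' * ((b - a) / real N)" if k: "k < N" for k
    proof -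
      have sub: "{equipart a b N k..equipart a b N (Suc k)} \<subseteq> {a..b}"
        by (rule equipart_cell_subset[OF ab k])
      have le: "equipart a b N k \<le> equipart a b N (Suc k)" by (simp add: equipart_mono ab)
      have int: "(\<lambda>r. norm (f r - f (equipart a b N k)))
          integrable_on {equipart a b N k..equipart a b N (Suc k)}"
        by (intro integrable_continuous_real continuous_intros continuous_on_subset[OF f sub])
      have "?I k \<le> integral {equipart a b N k..equipart a b N (Suc k)} (\<lambda>r. e')"
      proof (rule integral_le[OF int])
        fix r assume r: "r \<in> {equipart a b N k..equipart a b N (Suc k)}"
        have "dist r (equipart a b N k) < d"
          using r h by (auto simp: dist_real_def equipart_step)
        then show "norm (f r - f (equipart a b N k)) \<le> e'"
          using d(2)[of "equipart a b N k" r] r sub le by (auto simp: dist_norm subset_iff intro: less_imp_le)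
      qed auto
      also have "\<dots> = e' * ((b - a) / real N)" using ab by (simp add: equipart_step)
      finally show ?thesis using integral_nonneg[OF int] by auto
    qed
    have "(\<Sum>k<N. ?I k) \<le> (\<Sum>k<N. e' * ((b - a) / real N))"
      by (rule sum_mono) (use I in auto)
    also have "\<dots> = e' * (b - a)" using N0 by simp
    also have "\<dots> < e"
    proof -
      have "e' * (b - a) \<le> e' * (b - a + 1)" using e' by simp
      also have "\<dots> = e / 2" using ab by (simp add: e'_def divide_simps)
      finally show ?thesis using e by simp
    qed
    finally have "(\<Sum>k<N. ?I k) < e" .
    moreover have "0 \<le> (\<Sum>k<N. ?I k)" by (rule sum_nonneg) (use I in auto)
    ultimately show "norm ((\<Sum>k<N. ?I k) - 0) < e" by simp
  qed
qed

lemma riemann_sum_tendsto_integral: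
  fixes f :: "real \<Rightarrow> real"
  assumes ab: "a \<le> b" and f: "continuous_on {a..b} f"
  shows "(\<lambda>N. \<Sum>k<N. f (equipart a b N k) * ((b - a) / real N)) \<longlonglongrightarrow> integral {a..b} f"
proof -
  let ?O = "\<lambda>N. \<Sum>k<N. integral {equipart a b N k..equipart a b N (Suc k)}
            (\<lambda>r. norm (f r - f (equipart a b N k)))"
  have "norm ((\<Sum>k<N. f (equipart a b N k) * ((b - a) / real N)) - integral {a..b} f) \<le> ?O N"
    if N: "0 < N" for N
  proof -
    have "norm (f (equipart a b N k) * ((b - a) / real N)
        - integral {equipart a b N k..equipart a b N (Suc k)} f)
      \<le> integral {equipart a b N k..equipart a b N (Suc k)} (\<lambda>r. norm (f r - f (equipart a b N k)))"
      if k: "k < N" for k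
    proof -
      let ?J = "{equipart a b N k..equipart a b N (Suc k)}"
      have cont: "continuous_on ?J f"
        by (rule continuous_on_subset[OF f equipart_cell_subset[OF ab k]])
      have "integral ?J f - f (equipart a b N k) * ((b - a) / real N)
          = integral ?J (\<lambda>r. f r - f (equipart a b N k))"
        using cont ab by (subst integral_diff) (auto intro!: integrable_continuous_real simp: equipart_step)
      moreover have "norm (integral ?J (\<lambda>r. f r - f (equipart a b N k)))
          \<le> integral ?J (\<lambda>r. norm (f r - f (equipart a b N k)))"
        by (intro integral_norm_bound_integral integrable_continuous_real continuous_intros cont) auto
      ultimately show ?thesis by (simp add: norm_minus_commute)
    qed
    then have "norm (\<Sum>k<N. f (equipart a b N k) * ((b - a) / real N)
        - integral {equipart a b N k..equipart a b N (Suc k)} f) \<le> ?O N"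
      by (intro order_trans[OF norm_sum] sum_mono) auto
    then show ?thesis
      using integral_equipart_full[OF ab integrable_continuous_real[OF f] N]
      by (simp add: sum_subtractf)
  qed
  then have "\<forall>\<^sub>F N in sequentially.
      norm ((\<Sum>k<N. f (equipart a b N k) * ((b - a) / real N)) - integral {a..b} f) \<le> ?O N"
    using eventually_gt_at_top[of 0] by (rule eventually_mono[rotated]) auto
  from Lim_null_comparison[OF this path_oscillation_tendsto_0[OF ab f]]
  show ?thesis by (rule LIM_zero_cancel)
qed

text \<open>
  A pathwise integral is a limit of Riemann sums, which are finite sums of measurable functions.
\<close>

lemma borel_measurable_path_integral:
  fixes h :: "real \<Rightarrow> 'a \<Rightarrow> real"
  assumes ab: "a \<le> b"
    and cont: "\<And>\<omega>. \<omega> \<in> space N \<Longrightarrow> continuous_on {a..b} (\<lambda>r. h r \<omega>)"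
    and meas: "\<And>r. r \<in> {a..b} \<Longrightarrow> h r \<in> borel_measurable N"
  shows "(\<lambda>\<omega>. integral {a..b} (\<lambda>r. h r \<omega>)) \<in> borel_measurable N"
proof (rule borel_measurable_LIMSEQ_real)
  fix \<omega> assume "\<omega> \<in> space N"
  from riemann_sum_tendsto_integral[OF ab cont[OF this]]
  show "(\<lambda>n. \<Sum>k<n. h (equipart a b n k) \<omega> * ((b - a) / real n)) \<longlonglongrightarrow> integral {a..b} (\<lambda>r. h r \<omega>)" .
next
  fix n
  show "(\<lambda>\<omega>. \<Sum>k<n. h (equipart a b n k) \<omega> * ((b - a) / real n)) \<in> borel_measurable N"
    by (intro borel_measurable_sum borel_measurable_times borel_measurable_const meas)
      (use equipart_in[OF ab] in auto)
qed

section \<open>A cutoff with scale-invariant derivative bounds\<close>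

text \<open>
  The cube of the positive part makes this cutoff function twice continuously differentiable.
\<close>

definition bump :: "real \<Rightarrow> real" where
  "bump x = max 0 (x - 1) ^ 3 / (1 + max 0 (x - 1) ^ 3)"

definition bump' :: "real \<Rightarrow> real" where
  "bump' x = 3 * max 0 (x - 1) ^ 2 / (1 + max 0 (x - 1) ^ 3) ^ 2"

definition bump'' :: "real \<Rightarrow> real" where
  "bump'' x = 6 * max 0 (x - 1) / (1 + max 0 (x - 1) ^ 3) ^ 2
            - 18 * max 0 (x - 1) ^ 4 / (1 + max 0 (x - 1) ^ 3) ^ 3"

lemma pos_part_power_derivative:
  "((\<lambda>x::real. max 0 x ^ Suc (Suc n)) has_real_derivative real (Suc (Suc n)) * max 0 x ^ Suc n) (at x)"
proof -
  consider "x < 0" | "x = 0" | "x > 0" by linarith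
  then show ?thesis
  proof cases
    case 1
    have d: "((\<lambda>x::real. 0) has_real_derivative 0) (at x)" by simp
    have "\<forall>\<^sub>F y in nhds x. max 0 y ^ Suc (Suc n) = 0"
      using eventually_nhds_in_open[of "{..<0}" x] 1 by (auto elim!: eventually_mono)
    from DERIV_cong_ev[OF refl this refl, THEN iffD2, OF d] show ?thesis using 1 by simp
  next
    case 3
    have d: "((\<lambda>x::real. x ^ Suc (Suc n)) has_real_derivative real (Suc (Suc n)) * x ^ Suc n) (at x)"
      by (rule derivative_eq_intros refl | simp)+
    have "\<forall>\<^sub>F y in nhds x. max 0 y ^ Suc (Suc n) = y ^ Suc (Suc n)"
      using eventually_nhds_in_open[of "{0<..}" x] 3 by (auto elim!: eventually_mono)
    from DERIV_cong_ev[OF refl this refl, THEN iffD2, OF d] show ?thesis using 3 by simp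
  next
    case 2
    have "((\<lambda>y::real. max 0 y ^ Suc (Suc n) / y) \<longlongrightarrow> 0) (at 0)"
    proof (rule Lim_null_comparison)
      show "\<forall>\<^sub>F y::real in at 0. norm (max 0 y ^ Suc (Suc n) / y) \<le> \<bar>y\<bar> ^ Suc n"
        by (auto simp: eventually_at_filter max_def power_abs intro!: always_eventually mult_nonpos_nonneg)
      show "((\<lambda>y::real. \<bar>y\<bar> ^ Suc n) \<longlongrightarrow> 0) (at 0)"
        by (auto intro!: tendsto_eq_intros)
    qed
    then show ?thesis unfolding 2 has_field_derivative_iff by simp
  qed
qed

lemma bump_derivatives:
  "(bump has_real_derivative bump' x) (at x)" "(bump' has_real_derivative bump'' x) (at x)"
proof -
  let ?r = "max 0 (x - 1)"
  have pos: "0 < 1 + ?r ^ 3" by (simp add: add_pos_nonneg)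
  then have nz: "1 + ?r ^ 3 \<noteq> 0" by simp
  have shift: "((\<lambda>x. x - 1) has_real_derivative 1) (at x)"
    by (auto intro!: derivative_eq_intros)
  have d3: "((\<lambda>x. max 0 (x - 1) ^ 3) has_real_derivative 3 * ?r ^ 2) (at x)"
    using DERIV_chain2[where f = "\<lambda>x. max 0 x ^ Suc (Suc 1)" and g = "\<lambda>x. x - 1" and Db = 1 and x = x
        and s = UNIV, OF pos_part_power_derivative shift]
    by (simp add: numeral_eq_Suc)
  have d2: "((\<lambda>x. max 0 (x - 1) ^ 2) has_real_derivative 2 * ?r) (at x)"
    using DERIV_chain2[where f = "\<lambda>x. max 0 x ^ Suc (Suc 0)" and g = "\<lambda>x. x - 1" and Db = 1 and x = x
        and s = UNIV, OF pos_part_power_derivative shift]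
    by (simp add: numeral_eq_Suc)
  show "(bump has_real_derivative bump' x) (at x)"
    unfolding bump_def bump'_def
    by (rule derivative_eq_intros d3 refl nz)+ (use nz in \<open>simp add: power2_eq_square field_simps\<close>)
  show "(bump' has_real_derivative bump'' x) (at x)"
    unfolding bump'_def
  proof (rule DERIV_cong)
    have "((\<lambda>x. 1 + max 0 (x - 1) ^ 3) has_real_derivative 3 * ?r ^ 2) (at x)"
      using DERIV_add[OF DERIV_const d3] by simp
    from DERIV_power[OF this, of 2]
    have "((\<lambda>x. (1 + max 0 (x - 1) ^ 3) ^ 2) has_real_derivative
        2 * (1 + ?r ^ 3) * (3 * ?r ^ 2)) (at x)"
      by (rule DERIV_cong) (simp add: algebra_simps)
    then show "((\<lambda>x. 3 * max 0 (x - 1) ^ 2 / (1 + max 0 (x - 1) ^ 3) ^ 2) has_real_derivative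
        (3 * (2 * ?r) * (1 + ?r ^ 3) ^ 2 - 3 * ?r ^ 2 * (2 * (1 + ?r ^ 3) * (3 * ?r ^ 2)))
          / ((1 + ?r ^ 3) ^ 2 * (1 + ?r ^ 3) ^ 2)) (at x)"
      using nz by (intro DERIV_divide DERIV_cmult d2) auto
    have "(3 * (2 * r) * y ^ 2 - 3 * r ^ 2 * (2 * y * (3 * r ^ 2))) / (y ^ 2 * y ^ 2)
        = 6 * r / y ^ 2 - 18 * r ^ 4 / y ^ 3" if "y \<noteq> 0" for r y :: real
      using that by (simp add: field_simps eval_nat_numeral)
    from this[OF nz, of ?r]
    show "(3 * (2 * ?r) * (1 + ?r ^ 3) ^ 2 - 3 * ?r ^ 2 * (2 * (1 + ?r ^ 3) * (3 * ?r ^ 2)))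
          / ((1 + ?r ^ 3) ^ 2 * (1 + ?r ^ 3) ^ 2) = bump'' x"
      unfolding bump''_def .
  qed
qed

lemma continuous_on_bump'': "continuous_on A bump''"
proof -
  have "1 + max 0 (x - 1) ^ 3 \<noteq> 0" for x :: real
    by (rule less_imp_neq[symmetric]) (simp add: add_pos_nonneg)
  then show ?thesis unfolding bump''_def by (intro continuous_intros) auto
qed

lemma bump_eq_0: "x \<le> 1 \<Longrightarrow> bump x = 0"
  by (simp add: bump_def)

text \<open>
  The quantities \<open>x bump' x\<close> and \<open>x\<^sup>2 bump'' x\<close> are invariant under rescaling of the argument, so these bounds hold
  with the same constants for every \<open>bump (m x)\<close>.  With \<open>r\<close> the positive part of \<open>x - 1\<close> and
  \<open>y = 1 + r\<^sup>3\<close>, everything follows from \<open>r \<le> y\<close>, \<open>r\<^sup>2 \<le> y\<close> and \<open>x \<le> 2 y\<close>.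
\<close>

lemma bump_bounds:
  assumes "0 \<le> x"
  shows "\<bar>bump x\<bar> \<le> 1" "\<bar>x * bump' x\<bar> \<le> 6" "\<bar>x\<^sup>2 * bump'' x\<bar> \<le> 96"
proof -
  define r where "r = max 0 (x - 1)"
  define y where "y = 1 + r ^ 3"
  have r: "0 \<le> r" "x \<le> r + 1" by (auto simp: r_def)
  have y: "1 \<le> y" using r by (simp add: y_def)
  have ry: "r \<le> y" "r ^ 2 \<le> y"
  proof -
    have "r \<le> 1 + r ^ 3 \<and> r ^ 2 \<le> 1 + r ^ 3"
    proof (cases "r \<le> 1")
      case True
      then show ?thesis using r power_le_one[of r 2] by (auto intro: order_trans[of _ 1])
    next
      case False
      then have "r ^ 1 \<le> r ^ 3" "r ^ 2 \<le> r ^ 3" by (intro power_increasing; simp)+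
      then show ?thesis by simp
    qed
    then show "r \<le> y" "r ^ 2 \<le> y" by (auto simp: y_def)
  qed
  have xy: "x \<le> 2 * y" "x\<^sup>2 \<le> 4 * y"
  proof -
    show "x \<le> 2 * y" using r ry y by linarith
    have "x\<^sup>2 \<le> (r + 1)\<^sup>2" using r assms by (intro power_mono) auto
    also have "\<dots> = r\<^sup>2 + 2 * r + 1" by (simp add: power2_eq_square algebra_simps)
    also have "\<dots> \<le> 4 * y" using ry y by linarith
    finally show "x\<^sup>2 \<le> 4 * y" .
  qed
  show "\<bar>bump x\<bar> \<le> 1"
    unfolding bump_def r_def[symmetric] using r by (auto simp: divide_simps add_pos_nonneg)
  have "x * (3 * r ^ 2) \<le> (2 * y) * (3 * y)"
    using ry xy assms r y by (intro mult_mono) auto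
  then have "x * (3 * r ^ 2) \<le> 6 * y\<^sup>2" by (simp add: power2_eq_square)
  then show "\<bar>x * bump' x\<bar> \<le> 6"
    unfolding bump'_def r_def[symmetric] y_def[symmetric] using r y assms
    by (simp add: abs_mult divide_simps)
  have 1: "x\<^sup>2 * (6 * r) \<le> 24 * y\<^sup>2"
  proof -
    have "x\<^sup>2 * (6 * r) \<le> (4 * y) * (6 * y)" using ry xy r y by (intro mult_mono) auto
    then show ?thesis by (simp add: power2_eq_square)
  qed
  have 2: "x\<^sup>2 * (18 * r ^ 4) \<le> 72 * y ^ 3"
  proof -
    have "r ^ 4 = r ^ 2 * r ^ 2" by (simp add: power4_eq_xxxx power2_eq_square)
    also have "\<dots> \<le> y * y" using ry y by (intro mult_mono) auto
    finally have "x\<^sup>2 * (18 * r ^ 4) \<le> (4 * y) * (18 * (y * y))"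
      using xy r y by (intro mult_mono) auto
    then show ?thesis by (simp add: power3_eq_cube)
  qed
  have "\<bar>x\<^sup>2 * bump'' x\<bar> \<le> x\<^sup>2 * (6 * r) / y\<^sup>2 + x\<^sup>2 * (18 * r ^ 4) / y ^ 3"
    unfolding bump''_def r_def[symmetric] y_def[symmetric] right_diff_distrib
    using r y by (intro order_trans[OF abs_triangle_ineq4]) (auto simp: abs_mult)
  also have "\<dots> \<le> 24 + 72"
    using 1 2 y by (intro add_mono) (auto simp: divide_simps)
  finally show "\<bar>x\<^sup>2 * bump'' x\<bar> \<le> 96" by simp
qed

lemma bump_limits:
  "(bump \<longlongrightarrow> 1) at_top" "((\<lambda>x. x * bump' x) \<longlongrightarrow> 0) at_top"
  "((\<lambda>x. x\<^sup>2 * bump'' x) \<longlongrightarrow> 0) at_top"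
proof -
  have ev: "\<forall>\<^sub>F x::real in at_top. max 0 (x - 1) = x - 1"
    using eventually_ge_at_top[of 1] by eventually_elim auto
  have "((\<lambda>x::real. (x - 1) ^ 3 / (1 + (x - 1) ^ 3)) \<longlongrightarrow> 1) at_top" by real_asymp
  then show "(bump \<longlongrightarrow> 1) at_top"
    by (rule Lim_transform_eventually) (use ev in \<open>eventually_elim, simp add: bump_def\<close>)
  have "((\<lambda>x::real. x * (3 * (x - 1) ^ 2 / (1 + (x - 1) ^ 3) ^ 2)) \<longlongrightarrow> 0) at_top" by real_asymp
  then show "((\<lambda>x. x * bump' x) \<longlongrightarrow> 0) at_top"
    by (rule Lim_transform_eventually) (use ev in \<open>eventually_elim, simp add: bump'_def\<close>)
  have "((\<lambda>x::real. x\<^sup>2 * (6 * (x - 1) / (1 + (x - 1) ^ 3) ^ 2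
            - 18 * (x - 1) ^ 4 / (1 + (x - 1) ^ 3) ^ 3)) \<longlongrightarrow> 0) at_top" by real_asymp
  then show "((\<lambda>x. x\<^sup>2 * bump'' x) \<longlongrightarrow> 0) at_top"
    by (rule Lim_transform_eventually) (use ev in \<open>eventually_elim, simp add: bump''_def\<close>)
qed

section \<open>The generator in terms of the Hessian\<close>

definition imult :: "complex ^ 'n \<Rightarrow> complex ^ 'n" where
  "imult b = (\<chi> j. \<i> * b $ j)"

lemma imult_nth [simp]: "imult b $ j = \<i> * b $ j"
  by (simp add: imult_def)

lemma inner_imult_self [simp]: "imult b \<bullet> b = 0" "b \<bullet> imult b = 0"
  by (simp_all add: inner_vec_def inner_complex_def)

lemma inner_imult_imult [simp]: "imult a \<bullet> imult b = a \<bullet> b"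
  by (simp add: inner_vec_def inner_complex_def add.commute)

lemma norm_imult [simp]: "norm (imult b) = norm b"
  by (simp add: norm_eq_sqrt_inner)

lemma imult_diff: "imult (a - b) = imult a - imult b"
  by (simp add: vec_eq_iff right_diff_distrib)

lemma linear_imult: "linear imult"
  by (intro linearI) (simp_all add: vec_eq_iff algebra_simps)

lemma continuous_on_imult [continuous_intros]:
  "continuous_on A f \<Longrightarrow> continuous_on A (\<lambda>x. imult (f x))"
  using linear_continuous_on[of imult UNIV] linear_imult
  by (intro continuous_on_compose2[of UNIV imult A f]) (auto simp: linear_linear)

text \<open>
  A vector is the real linear combination of the \<open>axis j 1\<close> and \<open>axis j \<i>\<close>; this turns the coordinate sums in
  the Wirtinger operators into directional derivatives.
\<close>

lemma sum_complex_coords: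
  fixes L :: "complex ^ 'n \<Rightarrow> 'b::real_vector"
  assumes "linear L"
  shows "(\<Sum>j\<in>UNIV. Re (v $ j) *\<^sub>R L (axis j 1) + Im (v $ j) *\<^sub>R L (axis j \<i>)) = L v"
proof -
  have "v = (\<Sum>j\<in>UNIV. Re (v $ j) *\<^sub>R axis j 1 + Im (v $ j) *\<^sub>R axis j \<i>)"
    by (simp add: vec_eq_iff axis_def if_distrib[of "scaleR _"] sum.distrib sum.If_cases complex_eq_iff
        cong: if_cong)
  then have "L v = L (\<Sum>j\<in>UNIV. Re (v $ j) *\<^sub>R axis j 1 + Im (v $ j) *\<^sub>R axis j \<i>)"
    by simp
  then show ?thesis
    by (simp add: linear_sum[OF assms] linear_add[OF assms] linear_cmul[OF assms])
qed

text \<open>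
  The operator \<open>\<Sum>\<^sub>j w\<^sub>j \<partial>/\<partial>w\<^sub>j\<close> is half of the derivative in direction \<open>w\<close> minus \<open>\<i>/2\<close> times the derivative
  in direction \<open>\<i> w\<close>, and its conjugate is treated likewise.  The conjugate coefficients are annihilated by
  \<open>\<partial>/\<partial>w\<^sub>j\<close>, so the composition is of pure second order, and its real part is a quarter of the Hessian in the
  directions \<open>w\<close> and \<open>\<i> w\<close>.  Here \<open>g\<close> is the gradient of \<open>f\<close> and \<open>dg\<close> its derivative.
\<close>

lemma CH_generator_eq_hessian:
  fixes f :: "complex ^ 'n \<Rightarrow> real"
  assumes f: "\<And>z. (f has_derivative (\<lambda>v. g z \<bullet> v)) (at z)"
    and g: "\<And>z. (g has_derivative dg z) (at z)"
  shows "CH_generator f w = (1 - (norm w)\<^sup>2) / 2 *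
    ((\<Sum>k\<in>UNIV. dg w (axis k 1) \<bullet> axis k 1 + dg w (axis k \<i>) \<bullet> axis k \<i>)
      - dg w w \<bullet> w - dg w (imult w) \<bullet> imult w)"
proof -
  let ?F = "\<lambda>z. complex_of_real (f z)"
  define H where "H u v = complex_of_real (dg w u \<bullet> v)" for u v
  have lin: "linear (dg w)" using g[of w] by (simp add: has_derivative_linear)
  have linH1: "linear (\<lambda>u. H u v)" for v
    by (intro linearI) (simp_all add: H_def linear_add[OF lin] linear_cmul[OF lin] inner_add_left complex_eq_iff)
  have linH2: "linear (\<lambda>v. H u v)" for u
    by (intro linearI) (simp_all add: H_def inner_add_right complex_eq_iff)
  have F: "frechet_derivative ?F (at z) v = of_real (g z \<bullet> v)" for z v
  proof -
    have "(?F has_derivative (\<lambda>v. of_real (g z \<bullet> v))) (at z)"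
      by (intro has_derivative_of_real f)
    from frechet_derivative_at[OF this, symmetric] show ?thesis by simp
  qed
  have bar: "wirtinger_bar k ?F = (\<lambda>z. (of_real (g z \<bullet> axis k 1) + \<i> * of_real (g z \<bullet> axis k \<i>)) / 2)" for k
    by (simp add: wirtinger_bar_def F fun_eq_iff)
  have dbar: "(wirtinger_bar k ?F has_derivative (\<lambda>u. (H u (axis k 1) + \<i> * H u (axis k \<i>)) / 2)) (at w)" for k
    unfolding bar H_def
    by (auto intro!: derivative_eq_intros g)
  have fbar: "frechet_derivative (wirtinger_bar k ?F) (at w) u = (H u (axis k 1) + \<i> * H u (axis k \<i>)) / 2" for k u
    using frechet_derivative_at[OF dbar, symmetric] by simp
  have ww: "wirtinger j (wirtinger_bar k ?F) w =
     (H (axis j 1) (axis k 1) + H (axis j \<i>) (axis k \<i>)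
        + \<i> * (H (axis j 1) (axis k \<i>) - H (axis j \<i>) (axis k 1))) / 4" for j k
    unfolding wirtinger_def fbar by (simp add: algebra_simps add_divide_distrib diff_divide_distrib)
  define RD where "RD u = (\<Sum>k\<in>UNIV. cnj (w $ k) * ((H u (axis k 1) + \<i> * H u (axis k \<i>)) / 2))" for u
  have cw: "((\<lambda>z. cnj (z $ k)) has_derivative (\<lambda>u. cnj (u $ k))) (at w)" for k
    by (intro has_derivative_cnj bounded_linear_imp_has_derivative) (auto intro: bounded_linear_vec_nth)
  have dR: "(radial_op_bar ?F has_derivative (\<lambda>u. \<Sum>k\<in>UNIV. cnj (w $ k) * ((H u (axis k 1) + \<i> * H u (axis k \<i>)) / 2)
       + cnj (u $ k) * wirtinger_bar k ?F w)) (at w)"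
    unfolding radial_op_bar_def[abs_def] by (intro has_derivative_sum has_derivative_mult cw dbar)
  have fR: "frechet_derivative (radial_op_bar ?F) (at w) u
     = RD u + (\<Sum>k\<in>UNIV. cnj (u $ k) * wirtinger_bar k ?F w)" for u
    using frechet_derivative_at[OF dR, symmetric] by (simp only: RD_def sum.distrib)
  have ax: "(\<Sum>k\<in>UNIV. cnj (axis j x $ k) * wirtinger_bar k ?F w) = cnj x * wirtinger_bar j ?F w" for j x
    by (simp add: axis_def if_distrib[of cnj] if_distrib[of "\<lambda>x. x * _"] cong: if_cong)
  have "wirtinger j (radial_op_bar ?F) w = (RD (axis j 1) - \<i> * RD (axis j \<i>)) / 2" for j
    unfolding wirtinger_def fR ax by (simp add: algebra_simps)
  then have RR: "radial_op (radial_op_bar ?F) w = (\<Sum>j\<in>UNIV. w $ j * ((RD (axis j 1) - \<i> * RD (axis j \<i>)) / 2))"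
    by (simp only: radial_op_def)
  have linRD: "linear RD"
    unfolding RD_def
    by (intro linearI) (simp_all add: linear_add[OF linH1] linear_cmul[OF linH1] scaleR_conv_of_real[where 'a = complex]
        sum.distrib sum_distrib_left algebra_simps add_divide_distrib)
  have hol: "(\<Sum>j\<in>UNIV. w $ j * (L (axis j 1) - \<i> * L (axis j \<i>))) = L w - \<i> * L (imult w)"
    if "linear L" for L :: "complex ^ 'n \<Rightarrow> complex"
    unfolding sum_complex_coords[OF that, of w, symmetric] sum_complex_coords[OF that, of "imult w", symmetric]
      sum_distrib_left sum_subtractf[symmetric]
    by (intro sum.cong refl) (simp add: complex_eq_iff algebra_simps)
  have ahol: "(\<Sum>j\<in>UNIV. cnj (w $ j) * (L (axis j 1) + \<i> * L (axis j \<i>))) = L w + \<i> * L (imult w)"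
    if "linear L" for L :: "complex ^ 'n \<Rightarrow> complex"
    unfolding sum_complex_coords[OF that, of w, symmetric] sum_complex_coords[OF that, of "imult w", symmetric]
      sum_distrib_left sum.distrib[symmetric]
    by (intro sum.cong refl) (simp add: complex_eq_iff algebra_simps)
  have RD: "RD u = (H u w + \<i> * H u (imult w)) / 2" for u
    using ahol[OF linH2[of u]] by (simp only: RD_def times_divide_eq_right sum_divide_distrib[symmetric])
  have "radial_op (radial_op_bar ?F) w = (RD w - \<i> * RD (imult w)) / 2"
    using hol[OF linRD] by (simp only: RR times_divide_eq_right sum_divide_distrib[symmetric])
  also have "\<dots> = (H w w + H (imult w) (imult w) + \<i> * (H w (imult w) - H (imult w) w)) / 4"
    unfolding RD by (simp add: algebra_simps add_divide_distrib diff_divide_distrib)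
  finally have RRw: "radial_op (radial_op_bar ?F) w
      = (H w w + H (imult w) (imult w) + \<i> * (H w (imult w) - H (imult w) w)) / 4" .
  have re_RR: "Re (radial_op (radial_op_bar ?F) w) = (dg w w \<bullet> w + dg w (imult w) \<bullet> imult w) / 4"
    unfolding RRw by (simp add: H_def)
  have re_tr: "Re (\<Sum>k\<in>UNIV. wirtinger k (wirtinger_bar k ?F) w)
      = (\<Sum>k\<in>UNIV. dg w (axis k 1) \<bullet> axis k 1 + dg w (axis k \<i>) \<bullet> axis k \<i>) / 4"
    unfolding ww by (simp add: H_def sum_divide_distrib)
  have re: "Re (4 * of_real a * x - 4 * of_real a * y) = 4 * a * (Re x - Re y)" for a x y
    by (simp add: algebra_simps)
  show ?thesis
    unfolding CH_generator_def CH_laplacian_def re re_RR re_tr by (simp add: field_simps)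
qed

section \<open>Waves with a radial profile\<close>

text \<open>
  One family contains the plane waves, the function \<open>1 - |b|\<^sup>2\<close> and the cutoffs of both, so that the generator
  has to be computed only once.
\<close>

definition wave :: "real \<Rightarrow> complex ^ 'n \<Rightarrow> (real \<Rightarrow> real) \<Rightarrow> complex ^ 'n \<Rightarrow> real" where
  "wave \<phi> c q b = cos (\<phi> + c \<bullet> b) * q (1 - b \<bullet> b)"

text \<open>
  The value at \<open>b\<close> of the generator on such a wave, where \<open>q0\<close>, \<open>q1\<close> and \<open>q2\<close> stand for \<open>q\<close>, \<open>u q'\<close> and
  \<open>u\<^sup>2 q''\<close> at \<open>u = 1 - |b|\<^sup>2\<close>.  That \<open>q'\<close> and \<open>q''\<close> only enter with these weights is what makes the cutoff
  argument work.
\<close>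

definition wave_gen ::
  "real \<Rightarrow> complex ^ 'n \<Rightarrow> real \<Rightarrow> real \<Rightarrow> real \<Rightarrow> complex ^ 'n \<Rightarrow> real" where
  "wave_gen \<phi> c q0 q1 q2 b =
     - (1 - b \<bullet> b) / 2 * q0 * (c \<bullet> c - (c \<bullet> b)\<^sup>2 - (c \<bullet> imult b)\<^sup>2) * cos (\<phi> + c \<bullet> b)
     + 2 * (1 - b \<bullet> b) * q1 * (c \<bullet> b) * sin (\<phi> + c \<bullet> b)
     + 2 * (q2 * (b \<bullet> b) - q1 * (real CARD('n) - b \<bullet> b)) * cos (\<phi> + c \<bullet> b)"

lemma wave_C2_and_generator:
  fixes c :: "complex ^ 'n"
  assumes q: "\<And>x. (q has_real_derivative q' x) (at x)"
    and q': "\<And>x. (q' has_real_derivative q'' x) (at x)"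
    and cont: "continuous_on UNIV q''"
    and supp: "0 < \<epsilon>" "\<And>x. x \<le> \<epsilon> \<Longrightarrow> q x = 0"
  shows "C2_compact_support (wave \<phi> c q)"
    and "CH_generator (wave \<phi> c q) w =
      wave_gen \<phi> c (q (1 - w \<bullet> w)) ((1 - w \<bullet> w) * q' (1 - w \<bullet> w)) ((1 - w \<bullet> w)\<^sup>2 * q'' (1 - w \<bullet> w)) w"
proof -
  define \<alpha> where "\<alpha> z = - sin (\<phi> + c \<bullet> z) * q (1 - z \<bullet> z)" for z
  define \<beta> where "\<beta> z = - 2 * cos (\<phi> + c \<bullet> z) * q' (1 - z \<bullet> z)" for z
  define A where "A z = (- cos (\<phi> + c \<bullet> z) * q (1 - z \<bullet> z)) *\<^sub>R c + (2 * sin (\<phi> + c \<bullet> z) * q' (1 - z \<bullet> z)) *\<^sub>R z" for z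
  define B where "B z = (2 * sin (\<phi> + c \<bullet> z) * q' (1 - z \<bullet> z)) *\<^sub>R c + (4 * cos (\<phi> + c \<bullet> z) * q'' (1 - z \<bullet> z)) *\<^sub>R z" for z
  define g where "g z = \<alpha> z *\<^sub>R c + \<beta> z *\<^sub>R z" for z
  define dg where "dg z u = (A z \<bullet> u) *\<^sub>R c + ((B z \<bullet> u) *\<^sub>R z + \<beta> z *\<^sub>R u)" for z u
  have radial: "((\<lambda>z. p (1 - z \<bullet> z)) has_derivative (\<lambda>u. - 2 * p' (1 - z \<bullet> z) * (z \<bullet> u))) (at z)"
    if p: "\<And>x. (p has_real_derivative p' x) (at x)" for p p' and z :: "complex ^ 'n"
  proof -
    have "((\<lambda>z. 1 - z \<bullet> z) has_derivative (\<lambda>u. - 2 * (z \<bullet> u))) (at z)"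
      by (auto intro!: derivative_eq_intros simp: inner_commute)
    from has_derivative_compose[OF this p[THEN has_field_derivative_imp_has_derivative]]
    show ?thesis by (simp add: mult_ac)
  qed
  have dcos: "((\<lambda>z. cos (\<phi> + c \<bullet> z)) has_derivative (\<lambda>u. - sin (\<phi> + c \<bullet> z) * (c \<bullet> u))) (at z)" for z
    by (auto intro!: derivative_eq_intros)
  have dsin: "((\<lambda>z. sin (\<phi> + c \<bullet> z)) has_derivative (\<lambda>u. cos (\<phi> + c \<bullet> z) * (c \<bullet> u))) (at z)" for z
    by (auto intro!: derivative_eq_intros)
  note dq = radial[OF q] and dq' = radial[OF q']
  have f: "(wave \<phi> c q has_derivative (\<lambda>v. g z \<bullet> v)) (at z)" for z
    unfolding wave_def[abs_def]
    by (rule has_derivative_eq_rhs[OF has_derivative_mult[OF dcos dq]])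
      (simp add: fun_eq_iff g_def \<alpha>_def \<beta>_def inner_add_left inner_diff_left)
  have \<alpha>: "(\<alpha> has_derivative (\<lambda>v. A z \<bullet> v)) (at z)" for z
    unfolding \<alpha>_def[abs_def]
    by (rule has_derivative_eq_rhs[OF has_derivative_mult[OF has_derivative_minus[OF dsin] dq]])
      (simp add: fun_eq_iff A_def inner_add_left inner_diff_left)
  have \<beta>: "(\<beta> has_derivative (\<lambda>v. B z \<bullet> v)) (at z)" for z
    unfolding \<beta>_def[abs_def]
    by (rule has_derivative_eq_rhs[OF has_derivative_mult[OF has_derivative_mult_right[OF dcos] dq']])
      (simp add: fun_eq_iff B_def inner_add_left inner_diff_left)
  have g: "(g has_derivative dg z) (at z)" for z
    unfolding g_def[abs_def]
    by (rule has_derivative_eq_rhs[OF has_derivative_add[OF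
          has_derivative_scaleR[OF \<alpha> has_derivative_const] has_derivative_scaleR[OF \<beta> has_derivative_ident]]])
      (simp add: fun_eq_iff dg_def add_ac)
  have contq: "continuous_on UNIV q" "continuous_on UNIV q'"
    by (rule DERIV_continuous_on, rule q, rule DERIV_continuous_on, rule q')
  have contc: "continuous_on UNIV (\<lambda>z::complex ^ 'n. p (1 - z \<bullet> z))" if "continuous_on UNIV p" for p :: "real \<Rightarrow> real"
    by (rule continuous_on_compose2[OF that]) (auto intro!: continuous_intros)
  define f'' where "f'' z = Blinfun (\<lambda>u. blinfun_inner_right (dg z u))" for z
  have f''_app: "blinfun_apply (f'' z) = (\<lambda>u. blinfun_inner_right (dg z u))" for z
    unfolding f''_def
    by (rule bounded_linear_Blinfun_apply[OF bounded_linear_compose[OF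
          bounded_linear_blinfun_inner_right has_derivative_bounded_linear[OF g]]])
  have cont_dg: "continuous_on UNIV (\<lambda>z. dg z i)" for i
    unfolding dg_def A_def B_def \<beta>_def
    by (intro continuous_intros contc contq cont)
  show "C2_compact_support (wave \<phi> c q)"
    unfolding C2_compact_support_def
  proof (intro conjI exI[of _ "\<lambda>z. blinfun_inner_right (g z)"] exI[of _ f''] allI)
    fix z
    show "(wave \<phi> c q has_derivative blinfun_apply (blinfun_inner_right (g z))) (at z)"
      using f by (simp add: blinfun_inner_right.rep_eq)
    show "((\<lambda>z. blinfun_inner_right (g z)) has_derivative blinfun_apply (f'' z)) (at z)"
      unfolding f''_app
      by (rule bounded_linear.has_derivative[OF bounded_linear_blinfun_inner_right g])
  next
    show "continuous_on UNIV f''"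
      by (rule continuous_on_blinfun_componentwise)
        (simp add: f''_app bounded_linear.continuous_on[OF bounded_linear_blinfun_inner_right cont_dg])
  next
    let ?K = "{z :: complex ^ 'n. z \<bullet> z \<le> 1 - \<epsilon>}"
    show "\<exists>K. compact K \<and> K \<subseteq> ball 0 1 \<and> (\<forall>z. z \<notin> K \<longrightarrow> wave \<phi> c q z = 0)"
    proof (intro exI[of _ ?K] conjI allI impI)
      show K: "?K \<subseteq> ball 0 1"
      proof
        fix z :: "complex ^ 'n" assume "z \<in> ?K"
        then have "(norm z)\<^sup>2 < 1\<^sup>2" using supp(1) by (simp add: power2_norm_eq_inner)
        then show "z \<in> ball 0 1" using power2_less_imp_less[of "norm z" 1] by simp
      qed
      have "closed ?K" by (intro closed_Collect_le continuous_intros)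
      moreover have "bounded ?K" using K bounded_ball bounded_subset by blast
      ultimately show "compact ?K" by (simp add: compact_eq_bounded_closed)
      show "wave \<phi> c q z = 0" if "z \<notin> ?K" for z
        using that supp(2)[of "1 - z \<bullet> z"] by (simp add: wave_def)
    qed
  qed
  have ax: "(\<Sum>k\<in>UNIV. (a \<bullet> axis k 1) * (b \<bullet> axis k 1) + (a \<bullet> axis k \<i>) * (b \<bullet> axis k \<i>)) = a \<bullet> b"
    for a b :: "complex ^ 'n"
    by (simp add: inner_axis inner_vec_def[of a b] inner_complex_def)
  have ax1: "axis k x \<bullet> axis k y = x \<bullet> y" for k :: 'n and x y :: complex
    by (simp add: inner_axis)
  have tr: "(\<Sum>k\<in>UNIV. dg w (axis k 1) \<bullet> axis k 1 + dg w (axis k \<i>) \<bullet> axis k \<i>)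
      = A w \<bullet> c + (B w \<bullet> w + 2 * real CARD('n) * \<beta> w)"
  proof -
    define P where "P a b k = (a \<bullet> axis k 1) * (b \<bullet> axis k 1) + (a \<bullet> axis k \<i>) * (b \<bullet> axis k \<i>)"
      for a b :: "complex ^ 'n" and k
    have "dg w (axis k 1) \<bullet> axis k 1 + dg w (axis k \<i>) \<bullet> axis k \<i> = P (A w) c k + (P (B w) w k + 2 * \<beta> w)" for k
      by (simp add: P_def dg_def inner_add_left ax1)
    moreover have "(\<Sum>k\<in>UNIV. P a b k) = a \<bullet> b" for a b by (simp add: P_def ax)
    ultimately show ?thesis by (simp add: sum.distrib)
  qed
  have "CH_generator (wave \<phi> c q) w = (1 - w \<bullet> w) / 2 *
    (A w \<bullet> c + (B w \<bullet> w + 2 * real CARD('n) * \<beta> w) - dg w w \<bullet> w - dg w (imult w) \<bullet> imult w)"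
    unfolding CH_generator_eq_hessian[OF f g] tr by (simp add: power2_norm_eq_inner)
  also have "\<dots> = wave_gen \<phi> c (q (1 - w \<bullet> w)) ((1 - w \<bullet> w) * q' (1 - w \<bullet> w))
      ((1 - w \<bullet> w)\<^sup>2 * q'' (1 - w \<bullet> w)) w"
    unfolding wave_gen_def dg_def A_def B_def \<beta>_def inner_add_left inner_scaleR_left inner_imult_self
      inner_imult_imult inner_commute[of w c]
    by (simp add: power2_eq_square) algebra
  finally show "CH_generator (wave \<phi> c q) w =
      wave_gen \<phi> c (q (1 - w \<bullet> w)) ((1 - w \<bullet> w) * q' (1 - w \<bullet> w)) ((1 - w \<bullet> w)\<^sup>2 * q'' (1 - w \<bullet> w)) w" .
qed

section \<open>Cutoff waves\<close>

text \<open>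
  The profiles \<open>\<alpha> + \<beta> u\<close> cover both uses: \<open>\<alpha> = 1\<close>, \<open>\<beta> = 0\<close> gives plane waves, and \<open>\<alpha> = 0\<close>, \<open>\<beta> = 1\<close> gives
  the distance \<open>1 - |b|\<^sup>2\<close> to the boundary.
\<close>

definition cutoff :: "real \<Rightarrow> real \<Rightarrow> real \<Rightarrow> real \<Rightarrow> real" where
  "cutoff \<alpha> \<beta> m u = (\<alpha> + \<beta> * u) * bump (m * u)"

definition cutoff' :: "real \<Rightarrow> real \<Rightarrow> real \<Rightarrow> real \<Rightarrow> real" where
  "cutoff' \<alpha> \<beta> m u = \<beta> * bump (m * u) + (\<alpha> + \<beta> * u) * (m * bump' (m * u))"

definition cutoff'' :: "real \<Rightarrow> real \<Rightarrow> real \<Rightarrow> real \<Rightarrow> real" where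
  "cutoff'' \<alpha> \<beta> m u = 2 * \<beta> * (m * bump' (m * u)) + (\<alpha> + \<beta> * u) * (m\<^sup>2 * bump'' (m * u))"

lemma cutoff_derivatives:
  "(cutoff \<alpha> \<beta> m has_real_derivative cutoff' \<alpha> \<beta> m u) (at u)"
  "(cutoff' \<alpha> \<beta> m has_real_derivative cutoff'' \<alpha> \<beta> m u) (at u)"
proof -
  have lin: "((\<lambda>u. m * u) has_real_derivative m) (at u)"
    by (auto intro!: derivative_eq_intros)
  note b = DERIV_chain2[OF bump_derivatives(1) lin] and b' = DERIV_chain2[OF bump_derivatives(2) lin]
  show "(cutoff \<alpha> \<beta> m has_real_derivative cutoff' \<alpha> \<beta> m u) (at u)"
    unfolding cutoff_def[abs_def] cutoff'_def
    by (rule derivative_eq_intros b refl)+ (simp add: algebra_simps)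
  show "(cutoff' \<alpha> \<beta> m has_real_derivative cutoff'' \<alpha> \<beta> m u) (at u)"
    unfolding cutoff'_def[abs_def] cutoff''_def
    by (rule derivative_eq_intros b b' refl)+ (simp add: algebra_simps power2_eq_square)
qed

lemma continuous_on_cutoff:
  "continuous_on A (cutoff \<alpha> \<beta> m)" "continuous_on A (cutoff' \<alpha> \<beta> m)" "continuous_on A (cutoff'' \<alpha> \<beta> m)"
proof -
  show "continuous_on A (cutoff \<alpha> \<beta> m)" "continuous_on A (cutoff' \<alpha> \<beta> m)"
    by (rule DERIV_continuous_on, rule has_field_derivative_at_within, rule cutoff_derivatives)+
  have "continuous_on UNIV bump'" by (rule DERIV_continuous_on, rule bump_derivatives)
  then show "continuous_on A (cutoff'' \<alpha> \<beta> m)"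
    unfolding cutoff''_def[abs_def]
    by (intro continuous_intros continuous_on_compose2[of UNIV bump' A] continuous_on_compose2[OF continuous_on_bump''[of UNIV]]) auto
qed

lemma cutoff_eq_0: "0 < m \<Longrightarrow> u \<le> 1 / m \<Longrightarrow> cutoff \<alpha> \<beta> m u = 0"
  by (simp add: cutoff_def bump_eq_0 field_simps)

text \<open>
  Each quantity is a combination of those in \<open>bump_bounds\<close> at the argument \<open>m u\<close>, whence the uniformity in \<open>m\<close>.
\<close>

lemma cutoff_bounds:
  assumes u: "0 \<le> u" "u \<le> 1" and m: "0 \<le> m"
  shows "\<bar>cutoff \<alpha> \<beta> m u\<bar> \<le> 108 * (\<bar>\<alpha>\<bar> + \<bar>\<beta>\<bar>)"
    "\<bar>u * cutoff' \<alpha> \<beta> m u\<bar> \<le> 108 * (\<bar>\<alpha>\<bar> + \<bar>\<beta>\<bar>)"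
    "\<bar>u\<^sup>2 * cutoff'' \<alpha> \<beta> m u\<bar> \<le> 108 * (\<bar>\<alpha>\<bar> + \<bar>\<beta>\<bar>)"
proof -
  let ?x = "m * u" and ?a = "\<bar>\<alpha>\<bar> + \<bar>\<beta>\<bar>"
  have "0 \<le> ?x" using u m by simp
  note b = bump_bounds[OF this]
  have \<beta>u: "\<bar>\<beta> * u\<bar> \<le> \<bar>\<beta>\<bar>" using u by (simp add: abs_mult mult_left_le)
  have a: "\<bar>\<alpha> + \<beta> * u\<bar> \<le> ?a" using \<beta>u by linarith
  have "\<bar>cutoff \<alpha> \<beta> m u\<bar> \<le> ?a * 1"
    unfolding cutoff_def abs_mult by (intro mult_mono a b) auto
  then show "\<bar>cutoff \<alpha> \<beta> m u\<bar> \<le> 108 * ?a" by simp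
  have "u * cutoff' \<alpha> \<beta> m u = (\<beta> * u) * bump ?x + (\<alpha> + \<beta> * u) * (?x * bump' ?x)"
    by (simp add: cutoff'_def algebra_simps)
  also have "\<bar>\<dots>\<bar> \<le> \<bar>\<beta>\<bar> * 1 + ?a * 6"
  proof (intro order_trans[OF abs_triangle_ineq] add_mono)
    show "\<bar>(\<beta> * u) * bump ?x\<bar> \<le> \<bar>\<beta>\<bar> * 1"
      unfolding abs_mult[of "\<beta> * u"] by (intro mult_mono b \<beta>u) auto
    show "\<bar>(\<alpha> + \<beta> * u) * (?x * bump' ?x)\<bar> \<le> ?a * 6"
      unfolding abs_mult[of "\<alpha> + _"] by (intro mult_mono b a) auto
  qed
  finally show "\<bar>u * cutoff' \<alpha> \<beta> m u\<bar> \<le> 108 * ?a" by simp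
  have "u\<^sup>2 * cutoff'' \<alpha> \<beta> m u = 2 * ((\<beta> * u) * (?x * bump' ?x)) + (\<alpha> + \<beta> * u) * (?x\<^sup>2 * bump'' ?x)"
    by (simp add: cutoff''_def algebra_simps power2_eq_square)
  also have "\<bar>\<dots>\<bar> \<le> 2 * (\<bar>\<beta>\<bar> * 6) + ?a * 96"
  proof (intro order_trans[OF abs_triangle_ineq] add_mono)
    have "\<bar>(\<beta> * u) * (?x * bump' ?x)\<bar> \<le> \<bar>\<beta>\<bar> * 6"
      unfolding abs_mult[of "\<beta> * u"] by (intro mult_mono b \<beta>u) auto
    then show "\<bar>2 * ((\<beta> * u) * (?x * bump' ?x))\<bar> \<le> 2 * (\<bar>\<beta>\<bar> * 6)" by simp
    show "\<bar>(\<alpha> + \<beta> * u) * (?x\<^sup>2 * bump'' ?x)\<bar> \<le> ?a * 96"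
      unfolding abs_mult[of "\<alpha> + _"] by (intro mult_mono b a) auto
  qed
  finally show "\<bar>u\<^sup>2 * cutoff'' \<alpha> \<beta> m u\<bar> \<le> 108 * ?a" by simp
qed

lemma cutoff_limits:
  assumes u: "0 < u"
  shows "(\<lambda>n. cutoff \<alpha> \<beta> (real (Suc n)) u) \<longlonglongrightarrow> \<alpha> + \<beta> * u"
    "(\<lambda>n. u * cutoff' \<alpha> \<beta> (real (Suc n)) u) \<longlonglongrightarrow> \<beta> * u"
    "(\<lambda>n. u\<^sup>2 * cutoff'' \<alpha> \<beta> (real (Suc n)) u) \<longlonglongrightarrow> 0"
proof -
  have "filterlim (\<lambda>n. real (Suc n) * u) at_top sequentially"
    using u by real_asymp
  note b = filterlim_compose[OF bump_limits(1) this] filterlim_compose[OF bump_limits(2) this]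
    filterlim_compose[OF bump_limits(3) this]
  show "(\<lambda>n. cutoff \<alpha> \<beta> (real (Suc n)) u) \<longlonglongrightarrow> \<alpha> + \<beta> * u"
    unfolding cutoff_def using tendsto_mult[OF tendsto_const b(1)] by simp
  have "(\<lambda>n. (\<beta> * u) * bump (real (Suc n) * u)
        + (\<alpha> + \<beta> * u) * ((real (Suc n) * u) * bump' (real (Suc n) * u))) \<longlonglongrightarrow> (\<beta> * u) * 1 + (\<alpha> + \<beta> * u) * 0"
    by (intro tendsto_intros b)
  then show "(\<lambda>n. u * cutoff' \<alpha> \<beta> (real (Suc n)) u) \<longlonglongrightarrow> \<beta> * u"
    by (simp add: cutoff'_def algebra_simps)
  have "(\<lambda>n. 2 * ((\<beta> * u) * ((real (Suc n) * u) * bump' (real (Suc n) * u)))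
        + (\<alpha> + \<beta> * u) * ((real (Suc n) * u)\<^sup>2 * bump'' (real (Suc n) * u)))
       \<longlonglongrightarrow> 2 * ((\<beta> * u) * 0) + (\<alpha> + \<beta> * u) * 0"
    by (intro tendsto_intros b)
  then show "(\<lambda>n. u\<^sup>2 * cutoff'' \<alpha> \<beta> (real (Suc n)) u) \<longlonglongrightarrow> 0"
    by (simp add: cutoff''_def algebra_simps power2_eq_square)
qed

text \<open>
  The expression on the left is the squared length of \<open>c\<close> minus the squared modulus of its Hermitian product
  with \<open>b\<close>; it controls the quadratic variation of \<open>c \<bullet> w\<close>.
\<close>

lemma abs_transverse_le:
  fixes b c :: "complex ^ 'n"
  assumes b: "norm b \<le> 1" and c: "norm c \<le> K"
  shows "\<bar>c \<bullet> c - (c \<bullet> b)\<^sup>2 - (c \<bullet> imult b)\<^sup>2\<bar> \<le> 2 * K\<^sup>2"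
proof -
  have K: "0 \<le> K" using c norm_ge_zero[of c] by linarith
  have sq: "0 \<le> (c \<bullet> b')\<^sup>2 \<and> (c \<bullet> b')\<^sup>2 \<le> K\<^sup>2" if "norm b' \<le> 1" for b'
  proof -
    have "\<bar>c \<bullet> b'\<bar> \<le> K"
      using Cauchy_Schwarz_ineq2[of c b'] mult_mono[OF c that K norm_ge_zero] by simp
    then show ?thesis using K by (auto simp: abs_le_square_iff[symmetric])
  qed
  have cc: "0 \<le> c \<bullet> c \<and> c \<bullet> c \<le> K\<^sup>2"
    using c by (auto simp: dot_square_norm intro!: power_mono)
  have "0 \<le> (c \<bullet> imult b)\<^sup>2 \<and> (c \<bullet> imult b)\<^sup>2 \<le> K\<^sup>2" by (rule sq) (simp add: b)
  then show ?thesis using sq[OF b] cc by linarith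
qed

lemma abs_wave_gen_le:
  fixes b c :: "complex ^ 'n"
  assumes b: "b \<bullet> b \<le> 1" and c: "norm c \<le> K"
    and q: "\<bar>q0\<bar> \<le> Q" "\<bar>q1\<bar> \<le> Q" "\<bar>q2\<bar> \<le> Q"
  shows "\<bar>wave_gen \<phi> c q0 q1 q2 b\<bar> \<le> Q * (2 * K\<^sup>2 + 2 * K + 2 * real CARD('n) + 2)"
proof -
  have K: "0 \<le> K" using c norm_ge_zero[of c] by linarith
  have Q: "0 \<le> Q" using q by linarith
  have nb: "norm b \<le> 1" using b by (simp add: norm_le_square power2_eq_square)
  have cb: "\<bar>c \<bullet> b\<bar> \<le> K"
    using Cauchy_Schwarz_ineq2[of c b] mult_mono[OF c nb K norm_ge_zero] by simp
  note T = abs_transverse_le[OF nb c]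
  have u: "\<bar>1 - b \<bullet> b\<bar> \<le> 1" "\<bar>b \<bullet> b\<bar> \<le> 1" using b by auto
  have n: "\<bar>real CARD('n) - b \<bullet> b\<bar> \<le> real CARD('n)"
  proof -
    have "1 \<le> real CARD('n)" by (simp add: Suc_le_eq)
    then show ?thesis using b inner_ge_zero[of b] by linarith
  qed
  have "\<bar>- (1 - b \<bullet> b) / 2 * q0 * (c \<bullet> c - (c \<bullet> b)\<^sup>2 - (c \<bullet> imult b)\<^sup>2) * cos (\<phi> + c \<bullet> b)\<bar>
      \<le> 1 / 2 * Q * (2 * K\<^sup>2) * 1"
    unfolding abs_mult using u by (intro mult_mono T q mult_nonneg_nonneg) (auto simp: Q)
  moreover have "\<bar>2 * (1 - b \<bullet> b) * q1 * (c \<bullet> b) * sin (\<phi> + c \<bullet> b)\<bar> \<le> (2 * 1) * Q * K * 1"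
    unfolding abs_mult using u by (intro mult_mono cb nb q mult_nonneg_nonneg) (auto simp: Q K)
  moreover have "\<bar>2 * (q2 * (b \<bullet> b) - q1 * (real CARD('n) - b \<bullet> b)) * cos (\<phi> + c \<bullet> b)\<bar>
      \<le> 2 * (Q * 1 + Q * real CARD('n)) * 1"
  proof -
    have "\<bar>q2 * (b \<bullet> b) - q1 * (real CARD('n) - b \<bullet> b)\<bar> \<le> Q * 1 + Q * real CARD('n)"
      by (rule order_trans[OF abs_triangle_ineq4], unfold abs_mult, intro add_mono mult_mono q u n) (auto simp: Q)
    then show ?thesis unfolding abs_mult by (intro mult_mono) (auto simp: Q)
  qed
  ultimately have "\<bar>wave_gen \<phi> c q0 q1 q2 b\<bar> \<le> 1 / 2 * Q * (2 * K\<^sup>2) * 1 + (2 * 1) * Q * K * 1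
      + 2 * (Q * 1 + Q * real CARD('n)) * 1"
    unfolding wave_gen_def by linarith
  also have "\<dots> \<le> Q * (2 * K\<^sup>2 + 2 * K + 2 * real CARD('n) + 2)"
    using Q by (simp add: algebra_simps)
  finally show ?thesis .
qed

lemma continuous_on_wave_gen:
  fixes A :: "'c::t2_space set"
  assumes "continuous_on A b" "continuous_on A q0" "continuous_on A q1" "continuous_on A q2"
  shows "continuous_on A (\<lambda>r. wave_gen \<phi> c (q0 r) (q1 r) (q2 r) (b r))"
proof -
  have ph: "continuous_on A (\<lambda>r. \<phi> + c \<bullet> b r)" by (intro continuous_intros assms)
  show ?thesis
    unfolding wave_gen_def
    by (intro continuous_on_add continuous_on_mult continuous_on_diff continuous_on_minus continuous_on_divide
        continuous_on_const continuous_on_power continuous_on_inner continuous_on_imult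
        continuous_on_cos[OF ph] continuous_on_sin[OF ph] assms) auto
qed

lemma tendsto_wave_gen:
  assumes "q0 \<longlonglongrightarrow> x" "q1 \<longlonglongrightarrow> y" "q2 \<longlonglongrightarrow> z"
  shows "(\<lambda>n. wave_gen \<phi> c (q0 n) (q1 n) (q2 n) b) \<longlonglongrightarrow> wave_gen \<phi> c x y z b"
  unfolding wave_gen_def by (intro tendsto_intros assms) auto

section \<open>Dynkin's formula\<close>

lemma (in prob_space) integrable_bounded:
  assumes "f \<in> borel_measurable M" "\<And>\<omega>. \<omega> \<in> space M \<Longrightarrow> \<bar>f \<omega>\<bar> \<le> (B::real)"
  shows "integrable M f"
  using assms by (intro integrable_const_bound[of _ B] AE_I2) auto

locale hyperbolic_brownian_motion = prob_space M for M :: "'a measure" +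
  fixes w :: "real \<Rightarrow> 'a \<Rightarrow> complex ^ 'n"
  assumes brownian: "CH_brownian_motion M w"
begin

abbreviation F :: "real \<Rightarrow> 'a measure" where "F \<equiv> natural_filtration M w"

lemma w_measurable: "0 \<le> t \<Longrightarrow> w t \<in> borel_measurable M"
  using brownian by (simp add: CH_brownian_motion_def)

lemma w_continuous:
  assumes "\<omega> \<in> space M" "0 \<le> a"
  shows "continuous_on {a..b} (\<lambda>t. w t \<omega>)"
proof -
  have "continuous_on {0..} (\<lambda>t. w t \<omega>)"
    using brownian assms by (simp add: CH_brownian_motion_def)
  then show ?thesis by (rule continuous_on_subset) (use assms in auto)
qed

lemma w_inner_less_1:
  assumes "\<omega> \<in> space M" "0 \<le> t" shows "w t \<omega> \<bullet> w t \<omega> < 1"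
proof -
  have "norm (w t \<omega>) < 1" using brownian assms by (simp add: CH_brownian_motion_def)
  then show ?thesis by (simp add: dot_square_norm power_less_one_iff)
qed

lemma dynkin_martingale:
  assumes "C2_compact_support f"
  shows "martingale M F
    (\<lambda>t \<omega>. f (w t \<omega>) - f (w 0 \<omega>) - integral {0..t} (\<lambda>s. CH_generator f (w s \<omega>)))"
  using brownian assms by (simp add: CH_brownian_motion_def)

lemma space_F [simp]: "space (F t) = space M"
  by (simp add: natural_filtration_def space_measure_of_conv)

lemma w_adapted:
  assumes "0 \<le> s" "s \<le> t" shows "w s \<in> borel_measurable (F t)"
proof (rule measurableI)
  fix A :: "(complex ^ 'n) set" assume A: "A \<in> sets borel"
  have "{X. \<exists>s A. X = w s -` A \<inter> space M \<and> 0 \<le> s \<and> s \<le> t \<and> A \<in> sets borel} \<subseteq> Pow (space M)"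
    by auto
  then show "w s -` A \<inter> space (F t) \<in> sets (F t)"
    using A assms unfolding natural_filtration_def by (auto simp: sets_measure_of)
qed auto

lemma subalgebra_F:
  assumes "0 \<le> t" shows "subalgebra M (F t)"
proof -
  \<comment> \<open>that \<open>F t\<close> is a sub-sigma-algebra is part of the martingale property, for whichever test function\<close>
  have "C2_compact_support (wave 0 (0 :: complex ^ 'n) (cutoff 0 0 1))"
    by (rule wave_C2_and_generator(1)[OF cutoff_derivatives continuous_on_cutoff(3), of 1])
      (auto intro: cutoff_eq_0)
  from dynkin_martingale[OF this] show ?thesis using assms by (auto simp: martingale_def)
qed

lemma F_measurable_imp: "0 \<le> t \<Longrightarrow> f \<in> borel_measurable (F t) \<Longrightarrow> f \<in> borel_measurable M"
  by (rule measurable_from_subalg[OF subalgebra_F])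

lemma path_integral_measurable:
  fixes h :: "complex ^ 'n \<Rightarrow> real"
  assumes "continuous_on UNIV h" "0 \<le> s" "s \<le> t"
  shows "(\<lambda>\<omega>. integral {s..t} (\<lambda>r. h (w r \<omega>))) \<in> borel_measurable M"
  using assms
  by (intro borel_measurable_path_integral continuous_on_compose2[OF assms(1)] w_continuous
      measurable_compose[OF w_measurable borel_measurable_continuous_onI[OF assms(1)]]) auto

lemma dynkin_compact_support:
  assumes f: "C2_compact_support f" and cont: "continuous_on UNIV (CH_generator f)"
    and st: "0 \<le> s" "s \<le> t" and Z: "Z \<in> borel_measurable (F s)"
    and K: "\<And>\<omega>. \<omega> \<in> space M \<Longrightarrow> \<bar>Z \<omega>\<bar> \<le> K"
  shows "expectation (\<lambda>\<omega>. Z \<omega> * (f (w t \<omega>) - f (w s \<omega>)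
      - integral {s..t} (\<lambda>r. CH_generator f (w r \<omega>)))) = 0"
proof -
  define X where "X t \<omega> = f (w t \<omega>) - f (w 0 \<omega>) - integral {0..t} (\<lambda>s. CH_generator f (w s \<omega>))" for t \<omega>
  have mart: "martingale M F X" using dynkin_martingale[OF f] by (simp add: X_def[abs_def])
  interpret finite_measure_subalgebra M "F s"
    by (unfold_locales) (rule subalgebra_F[OF st(1)])
  have ZM: "Z \<in> borel_measurable M" by (rule F_measurable_imp[OF st(1) Z])
  have int: "integrable M (\<lambda>\<omega>. Z \<omega> * X r \<omega>)" if "0 \<le> r" for r
  proof (rule Bochner_Integration.integrable_bound)
    have X: "integrable M (X r)" using mart that by (simp add: martingale_def)
    then show "integrable M (\<lambda>\<omega>. K * \<bar>X r \<omega>\<bar>)" by simp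
    show "(\<lambda>\<omega>. Z \<omega> * X r \<omega>) \<in> borel_measurable M" using X ZM by measurable
    show "AE \<omega> in M. norm (Z \<omega> * X r \<omega>) \<le> norm (K * \<bar>X r \<omega>\<bar>)"
    proof (rule AE_I2)
      fix \<omega> assume \<omega>: "\<omega> \<in> space M"
      then have "\<bar>Z \<omega>\<bar> * \<bar>X r \<omega>\<bar> \<le> K * \<bar>X r \<omega>\<bar>" by (intro mult_right_mono K) auto
      then show "norm (Z \<omega> * X r \<omega>) \<le> norm (K * \<bar>X r \<omega>\<bar>)"
        using K[OF \<omega>] by (auto simp: abs_mult)
    qed
  qed
  have Xt: "X t \<in> borel_measurable M" 
  proof (rule borel_measurable_integrable)
    show "integrable M (X t)" using mart st by (simp add: martingale_def)
  qed
  have "expectation (\<lambda>\<omega>. Z \<omega> * X t \<omega>) = expectation (\<lambda>\<omega>. Z \<omega> * real_cond_exp M (F s) (X t) \<omega>)"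
    using real_cond_exp_intg(2)[OF int[of t] Z Xt] st by simp
  also have "\<dots> = expectation (\<lambda>\<omega>. Z \<omega> * X s \<omega>)"
  proof (rule integral_cong_AE)
    have "AE \<omega> in M. real_cond_exp M (F s) (X t) \<omega> = X s \<omega>"
      using mart st by (simp add: martingale_def)
    then show "AE \<omega> in M. Z \<omega> * real_cond_exp M (F s) (X t) \<omega> = Z \<omega> * X s \<omega>" by eventually_elim simp
    show "(\<lambda>\<omega>. Z \<omega> * X s \<omega>) \<in> borel_measurable M"
      using int[OF st(1)] by (rule borel_measurable_integrable)
    show "(\<lambda>\<omega>. Z \<omega> * real_cond_exp M (F s) (X t) \<omega>) \<in> borel_measurable M"
      using ZM by measurable
  qed
  finally have "expectation (\<lambda>\<omega>. Z \<omega> * X t \<omega> - Z \<omega> * X s \<omega>) = 0"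
    using int[of t] int[of s] st by simp
  also have "expectation (\<lambda>\<omega>. Z \<omega> * X t \<omega> - Z \<omega> * X s \<omega>) = expectation (\<lambda>\<omega>. Z \<omega> * (f (w t \<omega>) - f (w s \<omega>)
      - integral {s..t} (\<lambda>r. CH_generator f (w r \<omega>))))"
  proof (rule Bochner_Integration.integral_cong[OF refl])
    fix \<omega> assume "\<omega> \<in> space M"
    then have "(\<lambda>r. CH_generator f (w r \<omega>)) integrable_on {0..t}"
      by (intro integrable_continuous_real continuous_on_compose2[OF cont] w_continuous) auto
    from Henstock_Kurzweil_Integration.integral_combine[OF st this]
    have "integral {0..t} (\<lambda>r. CH_generator f (w r \<omega>))
        = integral {0..s} (\<lambda>r. CH_generator f (w r \<omega>)) + integral {s..t} (\<lambda>r. CH_generator f (w r \<omega>))" by simp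
    then show "Z \<omega> * X t \<omega> - Z \<omega> * X s \<omega> = Z \<omega> * (f (w t \<omega>) - f (w s \<omega>)
      - integral {s..t} (\<lambda>r. CH_generator f (w r \<omega>)))"
      by (simp add: X_def algebra_simps)
  qed
  finally show ?thesis .
qed

text \<open>
  The cutoff is removed by dominated convergence: the cutoff waves and their generators are bounded by
  \<open>cutoff_bounds\<close>, and for each outcome the process remains in the open ball, where they converge by
  \<open>cutoff_limits\<close>.
\<close>

lemma dynkin_wave:
  assumes st: "0 \<le> s" "s \<le> t" and Z: "Z \<in> borel_measurable (F s)"
    and K: "\<And>\<omega>. \<omega> \<in> space M \<Longrightarrow> \<bar>Z \<omega>\<bar> \<le> K"
  shows "expectation (\<lambda>\<omega>. Z \<omega> * (wave \<phi> c (\<lambda>u. \<alpha> + \<beta> * u) (w t \<omega>) - wave \<phi> c (\<lambda>u. \<alpha> + \<beta> * u) (w s \<omega>)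
      - integral {s..t} (\<lambda>r. wave_gen \<phi> c (\<alpha> + \<beta> * (1 - w r \<omega> \<bullet> w r \<omega>)) (\<beta> * (1 - w r \<omega> \<bullet> w r \<omega>)) 0 (w r \<omega>)))) = 0"
proof -
  define q where "q n = cutoff \<alpha> \<beta> (real (Suc n))" for n
  define q' where "q' n = cutoff' \<alpha> \<beta> (real (Suc n))" for n
  define q'' where "q'' n = cutoff'' \<alpha> \<beta> (real (Suc n))" for n
  define a where "a = 108 * (\<bar>\<alpha>\<bar> + \<bar>\<beta>\<bar>)"
  define B where "B = a * (2 * (norm c)\<^sup>2 + 2 * norm c + 2 * real CARD('n) + 2)"
  define G where "G n b = wave_gen \<phi> c (q n (1 - b \<bullet> b)) ((1 - b \<bullet> b) * q' n (1 - b \<bullet> b))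
      ((1 - b \<bullet> b)\<^sup>2 * q'' n (1 - b \<bullet> b)) b" for n and b :: "complex ^ 'n"
  define G0 where "G0 b = wave_gen \<phi> c (\<alpha> + \<beta> * (1 - b \<bullet> b)) (\<beta> * (1 - b \<bullet> b)) 0 b" for b :: "complex ^ 'n"
  let ?v = "wave \<phi> c (\<lambda>u. \<alpha> + \<beta> * u)"
  have contu: "continuous_on UNIV (\<lambda>b::complex ^ 'n. p (1 - b \<bullet> b))" if "continuous_on UNIV p" for p :: "real \<Rightarrow> real"
    by (rule continuous_on_compose2[OF that]) (auto intro!: continuous_intros)
  note cq = continuous_on_cutoff[of UNIV, THEN contu]
  have contG: "continuous_on UNIV (G n)" for n
    unfolding G_def q_def q'_def q''_def by (intro continuous_on_wave_gen continuous_intros cq)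
  have contG0: "continuous_on UNIV G0"
    unfolding G0_def by (intro continuous_on_wave_gen continuous_intros)
  have gen: "CH_generator (wave \<phi> c (q n)) = G n" and C2: "C2_compact_support (wave \<phi> c (q n))" for n
  proof -
    note * = wave_C2_and_generator[OF cutoff_derivatives continuous_on_cutoff(3), of "1 / real (Suc n)" \<alpha> \<beta> "real (Suc n)" \<phi> c]
    have z: "cutoff \<alpha> \<beta> (real (Suc n)) x = 0" if "x \<le> 1 / real (Suc n)" for x
      by (rule cutoff_eq_0[OF _ that]) simp
    show "C2_compact_support (wave \<phi> c (q n))" unfolding q_def by (rule *(1)[OF _ z]) auto
    show "CH_generator (wave \<phi> c (q n)) = G n"
      unfolding q_def G_def q'_def q''_def by (rule ext, rule *(2)[OF _ z]) auto
  qed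
  have zero: "expectation (\<lambda>\<omega>. Z \<omega> * (wave \<phi> c (q n) (w t \<omega>) - wave \<phi> c (q n) (w s \<omega>)
      - integral {s..t} (\<lambda>r. G n (w r \<omega>)))) = 0" for n
    using dynkin_compact_support[OF C2 _ st Z K, unfolded gen, OF contG] by simp
  have u: "0 < 1 - w r \<omega> \<bullet> w r \<omega>" "1 - w r \<omega> \<bullet> w r \<omega> \<le> 1" if "\<omega> \<in> space M" "0 \<le> r" for \<omega> r
    using w_inner_less_1[OF that] by auto
  have bq: "\<bar>q n (1 - w r \<omega> \<bullet> w r \<omega>)\<bar> \<le> a" if "\<omega> \<in> space M" "0 \<le> r" for \<omega> r n
    unfolding q_def a_def by (rule cutoff_bounds) (use u[OF that] in auto)
  have bG: "\<bar>G n (w r \<omega>)\<bar> \<le> B" if "\<omega> \<in> space M" "0 \<le> r" for \<omega> r n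
    unfolding G_def B_def q_def q'_def q''_def a_def
    using u[OF that] by (intro abs_wave_gen_le cutoff_bounds) auto
  have limq: "(\<lambda>n. wave \<phi> c (q n) (w r \<omega>)) \<longlonglongrightarrow> ?v (w r \<omega>)" if "\<omega> \<in> space M" "0 \<le> r" for \<omega> r
    unfolding wave_def q_def by (intro tendsto_intros cutoff_limits u[OF that])
  have limG: "(\<lambda>n. integral {s..t} (\<lambda>r. G n (w r \<omega>))) \<longlonglongrightarrow> integral {s..t} (\<lambda>r. G0 (w r \<omega>))" if \<omega>: "\<omega> \<in> space M" for \<omega>
  proof (rule dominated_convergence(2)[where h = "\<lambda>_. B"])
    show "(\<lambda>r. G n (w r \<omega>)) integrable_on {s..t}" for n
      by (intro integrable_continuous_real continuous_on_compose2[OF contG] w_continuous \<omega> st) auto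
    show "norm (G n (w r \<omega>)) \<le> B" if "r \<in> {s..t}" for n r
      using bG[OF \<omega>, of r] that st by simp
    show "(\<lambda>n. G n (w r \<omega>)) \<longlonglongrightarrow> G0 (w r \<omega>)" if "r \<in> {s..t}" for r
    proof -
      have "0 \<le> r" using that st by auto
      then show ?thesis
        unfolding G_def G0_def q_def q'_def q''_def by (intro tendsto_wave_gen cutoff_limits u \<omega>)
    qed
  qed auto
  have ZM[measurable]: "Z \<in> borel_measurable M" by (rule F_measurable_imp[OF st(1) Z])
  have t0: "0 \<le> t" using st by simp
  have mw: "(\<lambda>\<omega>. wave \<phi> c p (w r \<omega>)) \<in> borel_measurable M" if "0 \<le> r" "continuous_on UNIV p" for p r
    unfolding wave_def
    by (intro measurable_compose[OF w_measurable[OF that(1)] borel_measurable_continuous_onI] continuous_intros contu that)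
  have "(\<lambda>n. expectation (\<lambda>\<omega>. Z \<omega> * (wave \<phi> c (q n) (w t \<omega>) - wave \<phi> c (q n) (w s \<omega>)
      - integral {s..t} (\<lambda>r. G n (w r \<omega>)))))
    \<longlonglongrightarrow> expectation (\<lambda>\<omega>. Z \<omega> * (?v (w t \<omega>) - ?v (w s \<omega>) - integral {s..t} (\<lambda>r. G0 (w r \<omega>))))"
  proof (rule integral_dominated_convergence[where w = "\<lambda>_. K * (a + a + B * (t - s))"])
    show "(\<lambda>\<omega>. Z \<omega> * (?v (w t \<omega>) - ?v (w s \<omega>) - integral {s..t} (\<lambda>r. G0 (w r \<omega>)))) \<in> borel_measurable M"
      by (intro borel_measurable_times borel_measurable_diff ZM mw path_integral_measurable contG0 st t0 continuous_intros)
    show "(\<lambda>\<omega>. Z \<omega> * (wave \<phi> c (q n) (w t \<omega>) - wave \<phi> c (q n) (w s \<omega>)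
      - integral {s..t} (\<lambda>r. G n (w r \<omega>)))) \<in> borel_measurable M" for n
      unfolding q_def
      by (intro borel_measurable_times borel_measurable_diff ZM mw path_integral_measurable contG st t0 continuous_on_cutoff)
    show "AE \<omega> in M. (\<lambda>n. Z \<omega> * (wave \<phi> c (q n) (w t \<omega>) - wave \<phi> c (q n) (w s \<omega>)
        - integral {s..t} (\<lambda>r. G n (w r \<omega>))))
      \<longlonglongrightarrow> Z \<omega> * (?v (w t \<omega>) - ?v (w s \<omega>) - integral {s..t} (\<lambda>r. G0 (w r \<omega>)))"
      by (intro AE_I2 tendsto_intros limq limG st t0)
    show "AE \<omega> in M. norm (Z \<omega> * (wave \<phi> c (q n) (w t \<omega>) - wave \<phi> c (q n) (w s \<omega>)
      - integral {s..t} (\<lambda>r. G n (w r \<omega>)))) \<le> K * (a + a + B * (t - s))" for n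
    proof (rule AE_I2)
      fix \<omega> assume \<omega>: "\<omega> \<in> space M"
      have wv: "\<bar>wave \<phi> c (q n) (w r \<omega>)\<bar> \<le> a" if "0 \<le> r" for r
        using mult_mono[OF abs_cos_le_one bq[OF \<omega> that]] by (simp add: wave_def abs_mult)
      have "norm (integral {s..t} (\<lambda>r. G n (w r \<omega>))) \<le> B * (t - s)"
        by (rule integral_bound) (use st bG[OF \<omega>] in \<open>auto intro!: continuous_on_compose2[OF contG] w_continuous \<omega>\<close>)
      with wv[OF st(1)] wv[OF t0]
      have "\<bar>wave \<phi> c (q n) (w t \<omega>) - wave \<phi> c (q n) (w s \<omega>) - integral {s..t} (\<lambda>r. G n (w r \<omega>))\<bar>
         \<le> a + a + B * (t - s)" by simp
      then show "norm (Z \<omega> * (wave \<phi> c (q n) (w t \<omega>) - wave \<phi> c (q n) (w s \<omega>)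
         - integral {s..t} (\<lambda>r. G n (w r \<omega>)))) \<le> K * (a + a + B * (t - s))"
        unfolding real_norm_def abs_mult using K[OF \<omega>] by (intro mult_mono) auto
    qed
  qed auto
  then show ?thesis unfolding zero G0_def by (simp add: LIMSEQ_const_iff)
qed

section \<open>The process spends little time away from the boundary\<close>

text \<open>
  The function \<open>h\<close> is minus the generator of \<open>u = 1 - |b|\<^sup>2\<close>, and it dominates \<open>2 u\<^sup>2\<close> since \<open>n \<ge> 1\<close>.  By
  Dynkin's formula the expected integral of \<open>h\<close> is \<open>E u(0) - E u(t)\<close>, which is at most 1 because \<open>u\<close> takes
  values in \<open>{0..1}\<close>.
\<close>

lemma expected_defect_square:
  assumes t: "0 \<le> t"
  shows "expectation (\<lambda>\<omega>. integral {0..t} (\<lambda>r. (1 - w r \<omega> \<bullet> w r \<omega>)\<^sup>2)) \<le> 1 / 2"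
proof -
  define u where "u r \<omega> = 1 - w r \<omega> \<bullet> w r \<omega>" for r \<omega>
  define h where "h b = 2 * (1 - b \<bullet> b) * (real CARD('n) - b \<bullet> b)" for b :: "complex ^ 'n"
  have u01: "0 \<le> u r \<omega>" "u r \<omega> \<le> 1" if "\<omega> \<in> space M" "0 \<le> r" for r \<omega>
    using w_inner_less_1[OF that] by (auto simp: u_def)
  have conth: "continuous_on UNIV h" unfolding h_def by (intro continuous_intros)
  have n: "1 \<le> real CARD('n)" by (simp add: Suc_le_eq)
  have h_le: "(1 - b \<bullet> b)\<^sup>2 * 2 \<le> h b" if "b \<bullet> b < 1" for b
  proof -
    have "x * x * 2 \<le> 2 * x * y" if "0 \<le> x" "x \<le> y" for x y :: real
      using mult_left_mono[OF that(2,1)] by linarith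
    from this[of "1 - b \<bullet> b" "real CARD('n) - b \<bullet> b"] show ?thesis
      using n that by (simp add: h_def power2_eq_square)
  qed
  have h_bd: "\<bar>h b\<bar> \<le> 2 * real CARD('n)" if "b \<bullet> b < 1" for b
  proof -
    have "\<bar>2 * (1 - b \<bullet> b)\<bar> \<le> 2"
      using that by (simp add: abs_le_iff)
    moreover have "\<bar>real CARD('n) - b \<bullet> b\<bar> \<le> real CARD('n)"
      using order_trans[OF less_imp_le[OF that] n] by simp
    ultimately have "\<bar>h b\<bar> \<le> 2 * real CARD('n)"
      unfolding h_def abs_mult[of "_ * _" "_ - _"] by (intro mult_mono) auto
    then show ?thesis by simp
  qed
  have ci: "(\<lambda>r. g (w r \<omega>)) integrable_on {0..t}" if "continuous_on UNIV g" "\<omega> \<in> space M" for g :: "complex ^ 'n \<Rightarrow> real" and \<omega>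
    by (intro integrable_continuous_real continuous_on_compose2[OF that(1)] w_continuous that) auto
  have wg: "wave_gen 0 0 (1 - b \<bullet> b) (1 - b \<bullet> b) 0 b = - h b" for b :: "complex ^ 'n"
    by (simp add: wave_gen_def h_def)
  have uM: "u r \<in> borel_measurable M" if "0 \<le> r" for r
    unfolding u_def
    by (rule measurable_compose[OF w_measurable[OF that] borel_measurable_continuous_onI]) (intro continuous_intros)
  have int_u: "integrable M (u r)" if "0 \<le> r" for r
    by (rule integrable_bounded[OF uM[OF that], of 1]) (use u01 that in auto)
  have ih_bd: "\<bar>integral {0..t} (\<lambda>r. h (w r \<omega>))\<bar> \<le> 2 * real CARD('n) * t" if "\<omega> \<in> space M" for \<omega>
    using integral_bound[of 0 t "\<lambda>r. h (w r \<omega>)" "2 * real CARD('n)"] t h_bd w_inner_less_1[OF that]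
      continuous_on_compose2[OF conth w_continuous[OF that, of 0 t]] by auto
  have int_h: "integrable M (\<lambda>\<omega>. integral {0..t} (\<lambda>r. h (w r \<omega>)))"
    by (rule integrable_bounded[OF path_integral_measurable[OF conth] ih_bd]) (use t in auto)
  have "expectation (\<lambda>\<omega>. u t \<omega> - u 0 \<omega> + integral {0..t} (\<lambda>r. h (w r \<omega>))) = 0"
    using dynkin_wave[of 0 t "\<lambda>_. 1" 1 0 0 0 1] t by (simp add: wave_def u_def wg)
  then have "expectation (\<lambda>\<omega>. integral {0..t} (\<lambda>r. h (w r \<omega>))) = expectation (u 0) - expectation (u t)"
    using int_u[of 0] int_u[OF t] int_h by simp
  also have "\<dots> \<le> 1 - 0"
    using u01 t by (intro diff_mono integral_le_const integral_nonneg_AE int_u AE_I2) auto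
  finally have le1: "expectation (\<lambda>\<omega>. integral {0..t} (\<lambda>r. h (w r \<omega>))) \<le> 1" by simp
  have contsq: "continuous_on UNIV (\<lambda>b::complex ^ 'n. (1 - b \<bullet> b)\<^sup>2)" by (intro continuous_intros)
  have sq_le: "2 * integral {0..t} (\<lambda>r. (1 - w r \<omega> \<bullet> w r \<omega>)\<^sup>2) \<le> integral {0..t} (\<lambda>r. h (w r \<omega>))"
    if \<omega>: "\<omega> \<in> space M" for \<omega>
  proof -
    have "integral {0..t} (\<lambda>r. (1 - w r \<omega> \<bullet> w r \<omega>)\<^sup>2 * 2) \<le> integral {0..t} (\<lambda>r. h (w r \<omega>))"
      by (rule integral_le[OF integrable_on_mult_left[OF ci[OF contsq \<omega>]] ci[OF conth \<omega>]])
        (use h_le w_inner_less_1[OF \<omega>] in auto)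
    then show ?thesis by (simp add: mult.commute)
  qed
  have sq_ge: "0 \<le> integral {0..t} (\<lambda>r. (1 - w r \<omega> \<bullet> w r \<omega>)\<^sup>2)" if "\<omega> \<in> space M" for \<omega>
    by (rule integral_nonneg[OF ci[OF contsq that]]) simp
  have "integrable M (\<lambda>\<omega>. integral {0..t} (\<lambda>r. (1 - w r \<omega> \<bullet> w r \<omega>)\<^sup>2))"
  proof (rule integrable_bounded[OF path_integral_measurable[OF contsq]])
    show "\<bar>integral {0..t} (\<lambda>r. (1 - w r \<omega> \<bullet> w r \<omega>)\<^sup>2)\<bar> \<le> 2 * real CARD('n) * t" if "\<omega> \<in> space M" for \<omega>
      using sq_le[OF that] sq_ge[OF that] ih_bd[OF that] by linarith
  qed (use t in auto)
  then have "2 * expectation (\<lambda>\<omega>. integral {0..t} (\<lambda>r. (1 - w r \<omega> \<bullet> w r \<omega>)\<^sup>2))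
      \<le> expectation (\<lambda>\<omega>. integral {0..t} (\<lambda>r. h (w r \<omega>)))"
    unfolding integral_mult_right_zero[symmetric]
    by (intro integral_mono int_h) (use sq_le in auto)
  with le1 show ?thesis by simp
qed

text \<open>
  Passing from \<open>u\<^sup>2\<close> to \<open>u\<close> costs a square root in time, which is harmless because only \<open>o(t)\<close> is wanted.
\<close>

lemma expected_mean_defect:
  assumes t: "0 < t"
  shows "expectation (\<lambda>\<omega>. integral {0..t} (\<lambda>r. 1 - w r \<omega> \<bullet> w r \<omega>)) \<le> sqrt t"
proof -
  define d where "d = 1 / (2 * sqrt t)"
  have d: "0 < d" using t by (simp add: d_def)
  have contu: "continuous_on UNIV (\<lambda>b::complex ^ 'n. 1 - b \<bullet> b)"
    and contsq: "continuous_on UNIV (\<lambda>b::complex ^ 'n. (1 - b \<bullet> b)\<^sup>2)" by (intro continuous_intros)+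
  have ci: "(\<lambda>r. g (w r \<omega>)) integrable_on {0..t}" if "continuous_on UNIV g" "\<omega> \<in> space M" for g :: "complex ^ 'n \<Rightarrow> real" and \<omega>
    by (intro integrable_continuous_real continuous_on_compose2[OF that(1)] w_continuous that) auto
  \<comment> \<open>a pointwise substitute for the Cauchy-Schwarz inequality; the value of \<open>d\<close> balances the two terms up to a constant\<close>
  have pt: "x \<le> d + (1 / (4 * d)) * x\<^sup>2" for x :: real
  proof -
    have "0 \<le> (x - 2 * d)\<^sup>2" by simp
    then show ?thesis using d by (simp add: field_simps power2_eq_square)
  qed
  have le: "integral {0..t} (\<lambda>r. 1 - w r \<omega> \<bullet> w r \<omega>)
      \<le> d * t + (1 / (4 * d)) * integral {0..t} (\<lambda>r. (1 - w r \<omega> \<bullet> w r \<omega>)\<^sup>2)" if \<omega>: "\<omega> \<in> space M" for \<omega>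
  proof -
    have "integral {0..t} (\<lambda>r. 1 - w r \<omega> \<bullet> w r \<omega>)
       \<le> integral {0..t} (\<lambda>r. d + (1 / (4 * d)) * (1 - w r \<omega> \<bullet> w r \<omega>)\<^sup>2)"
      by (rule integral_le[OF ci[OF contu \<omega>] integrable_add[OF integrable_const_ivl
              integrable_on_mult_right[OF ci[OF contsq \<omega>]]] pt])
    also have "\<dots> = d * t + (1 / (4 * d)) * integral {0..t} (\<lambda>r. (1 - w r \<omega> \<bullet> w r \<omega>)\<^sup>2)"
      by (subst Henstock_Kurzweil_Integration.integral_add[OF integrable_const_ivl integrable_on_mult_right[OF ci[OF contsq \<omega>]]])
        (use t in simp)
    finally show ?thesis .
  qed
  have bd: "\<bar>integral {0..t} (\<lambda>r. g (w r \<omega>))\<bar> \<le> 1 * t"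
    if g: "continuous_on UNIV g" "\<And>b. b \<bullet> b < 1 \<Longrightarrow> \<bar>g b\<bar> \<le> 1" and \<omega>: "\<omega> \<in> space M" for g :: "complex ^ 'n \<Rightarrow> real" and \<omega>
    using integral_bound[of 0 t "\<lambda>r. g (w r \<omega>)" 1] t g(2) w_inner_less_1[OF \<omega>]
      continuous_on_compose2[OF g(1) w_continuous[OF \<omega>, of 0 t]] by auto
  have int: "integrable M (\<lambda>\<omega>. integral {0..t} (\<lambda>r. g (w r \<omega>)))"
    if g: "continuous_on UNIV g" "\<And>b. b \<bullet> b < 1 \<Longrightarrow> \<bar>g b\<bar> \<le> 1" for g :: "complex ^ 'n \<Rightarrow> real"
    by (rule integrable_bounded[OF path_integral_measurable[OF g(1)] bd[OF g]]) (use t in auto)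
  have i1: "integrable M (\<lambda>\<omega>. integral {0..t} (\<lambda>r. 1 - w r \<omega> \<bullet> w r \<omega>))"
    by (rule int[OF contu]) auto
  have i2: "integrable M (\<lambda>\<omega>. integral {0..t} (\<lambda>r. (1 - w r \<omega> \<bullet> w r \<omega>)\<^sup>2))"
    by (rule int[OF contsq]) (auto intro!: power_le_one)
  have "expectation (\<lambda>\<omega>. integral {0..t} (\<lambda>r. 1 - w r \<omega> \<bullet> w r \<omega>))
      \<le> expectation (\<lambda>\<omega>. d * t + (1 / (4 * d)) * integral {0..t} (\<lambda>r. (1 - w r \<omega> \<bullet> w r \<omega>)\<^sup>2))"
    using i1 i2 by (intro integral_mono le) auto
  also have "\<dots> = d * t + (1 / (4 * d)) * expectation (\<lambda>\<omega>. integral {0..t} (\<lambda>r. (1 - w r \<omega> \<bullet> w r \<omega>)\<^sup>2))"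
    using i2 by (simp add: prob_space)
  also have "\<dots> \<le> d * t + (1 / (4 * d)) * (1 / 2)"
    using expected_defect_square[of t] t d by (intro add_left_mono mult_left_mono) auto
  also have "\<dots> = sqrt t / 2 + sqrt t / 4"
    using t by (simp add: d_def field_simps)
  also have "\<dots> \<le> sqrt t" using t by simp
  finally show ?thesis .
qed

end

section \<open>Plane waves with random frequency\<close>

definition plane_gen :: "real \<Rightarrow> complex ^ 'n \<Rightarrow> complex ^ 'n \<Rightarrow> real" where
  "plane_gen \<phi> c b = wave_gen \<phi> c 1 0 0 b"

lemma abs_plane_gen_le:
  assumes b: "b \<bullet> b \<le> 1" and c: "norm c \<le> K"
  shows "\<bar>plane_gen \<phi> c b\<bar> \<le> K\<^sup>2"
proof -
  have nb: "norm b \<le> 1" using b by (simp add: norm_le_square power2_eq_square)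
  have "\<bar>plane_gen \<phi> c b\<bar>
      = \<bar>1 - b \<bullet> b\<bar> / 2 * \<bar>c \<bullet> c - (c \<bullet> b)\<^sup>2 - (c \<bullet> imult b)\<^sup>2\<bar> * \<bar>cos (\<phi> + c \<bullet> b)\<bar>"
    by (simp add: plane_gen_def wave_gen_def abs_mult abs_minus_commute)
  also have "\<dots> \<le> 1 / 2 * (2 * K\<^sup>2) * 1"
    using b by (intro mult_mono abs_transverse_le[OF nb c] divide_right_mono) auto
  finally show ?thesis by simp
qed

lemma continuous_on_plane_gen: "continuous_on UNIV (plane_gen \<phi> c)"
  unfolding plane_gen_def by (intro continuous_on_wave_gen continuous_intros)

lemma abs_cos_diff_le: "\<bar>cos x - cos y\<bar> \<le> \<bar>x - y\<bar>" for x y :: real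
proof -
  have "\<bar>cos x - cos y\<bar> = 2 * (\<bar>sin ((x + y) / 2)\<bar> * \<bar>sin ((y - x) / 2)\<bar>)"
    by (simp add: cos_diff_cos abs_mult)
  also have "\<dots> \<le> 2 * (1 * \<bar>(y - x) / 2\<bar>)"
    by (intro mult_left_mono mult_mono abs_sin_x_le_abs_x) auto
  finally show ?thesis by simp
qed

lemma plane_gen_lipschitz:
  fixes a b c :: "complex ^ 'n"
  assumes a: "a \<bullet> a \<le> 1" and b: "b \<bullet> b \<le> 1" and c: "norm c \<le> K"
  shows "\<bar>plane_gen \<phi> c b - plane_gen \<phi> c a\<bar> \<le> (4 * K\<^sup>2 + K ^ 3) * norm (b - a)"
proof -
  have K: "0 \<le> K" using c norm_ge_zero[of c] by linarith
  have na: "norm a \<le> 1" and nb: "norm b \<le> 1" using a b by (auto simp: norm_le_square power2_eq_square)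
  define d where "d = norm (b - a)"
  have d: "0 \<le> d" by (simp add: d_def)
  have ip: "\<bar>x \<bullet> y\<bar> \<le> X * Y" if "norm x \<le> X" "norm y \<le> Y" for x y :: "complex ^ 'n" and X Y
    by (rule order_trans[OF Cauchy_Schwarz_ineq2]) (intro mult_mono that order_trans[OF norm_ge_zero that(1)] norm_ge_zero)
  define U where "U x = 1 - x \<bullet> x" for x :: "complex ^ 'n"
  define T where "T x = c \<bullet> c - (c \<bullet> x)\<^sup>2 - (c \<bullet> imult x)\<^sup>2" for x
  define C where "C x = cos (\<phi> + c \<bullet> x)" for x
  have U: "\<bar>U b - U a\<bar> \<le> 2 * d" "\<bar>U b\<bar> \<le> 1" "\<bar>U a\<bar> \<le> 1"
  proof -
    have "U b - U a = (a - b) \<bullet> (a + b)" by (simp add: U_def inner_add_right inner_diff_left inner_diff_right inner_commute)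
    moreover have "\<bar>(a - b) \<bullet> (a + b)\<bar> \<le> d * 2"
      using norm_triangle_ineq[of a b] na nb by (intro ip) (auto simp: d_def norm_minus_commute)
    ultimately show "\<bar>U b - U a\<bar> \<le> 2 * d" by simp
  qed (use a b in \<open>auto simp: U_def\<close>)
  have sqd: "\<bar>(c \<bullet> y)\<^sup>2 - (c \<bullet> x)\<^sup>2\<bar> \<le> 2 * K\<^sup>2 * norm (y - x)" if "norm x \<le> 1" "norm y \<le> 1" for x y
  proof -
    have "(c \<bullet> y)\<^sup>2 - (c \<bullet> x)\<^sup>2 = (c \<bullet> (y - x)) * (c \<bullet> (y + x))"
      by (simp add: power2_eq_square inner_diff_right inner_add_right algebra_simps)
    also have "\<bar>\<dots>\<bar> \<le> (K * norm (y - x)) * (K * 2)"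
      unfolding abs_mult using norm_triangle_ineq[of y x] that K
      by (intro mult_mono ip c) auto
    finally show ?thesis by (simp add: power2_eq_square mult_ac)
  qed
  have Td: "\<bar>T b - T a\<bar> \<le> 4 * K\<^sup>2 * d"
    using sqd[OF na nb] sqd[of "imult a" "imult b"] na nb
    unfolding T_def d_def imult_diff[symmetric] norm_imult by linarith
  have Tb: "\<bar>T x\<bar> \<le> 2 * K\<^sup>2" if "norm x \<le> 1" for x
    unfolding T_def by (rule abs_transverse_le[OF that c])
  have Cd: "\<bar>C b - C a\<bar> \<le> K * d"
  proof -
    from abs_cos_diff_le[of "\<phi> + c \<bullet> b" "\<phi> + c \<bullet> a"] have "\<bar>C b - C a\<bar> \<le> \<bar>c \<bullet> (b - a)\<bar>"
      by (simp add: C_def inner_diff_right)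
    also have "\<dots> \<le> K * d" unfolding d_def by (intro ip c order_refl)
    finally show ?thesis .
  qed
  have pg: "plane_gen \<phi> c x = - (U x * T x * C x) / 2" for x
    by (simp add: plane_gen_def wave_gen_def U_def T_def C_def) algebra
  have "U b * T b * C b - U a * T a * C a
      = (U b - U a) * T b * C b + U a * (T b - T a) * C b + U a * T a * (C b - C a)"
    by (simp add: algebra_simps)
  also have "\<bar>\<dots>\<bar> \<le> (2 * d) * (2 * K\<^sup>2) * 1 + 1 * (4 * K\<^sup>2 * d) * 1 + 1 * (2 * K\<^sup>2) * (K * d)"
    by (intro order_trans[OF abs_triangle_ineq] add_mono; unfold abs_mult; intro mult_mono U Tb Td Cd na nb)
      (use d K in \<open>auto simp: C_def\<close>)
  also have "\<dots> = 2 * ((4 * K\<^sup>2 + K ^ 3) * d)" by (simp add: algebra_simps power2_eq_square power3_eq_cube)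
  finally show ?thesis unfolding pg d_def by (simp add: field_simps)
qed

context hyperbolic_brownian_motion
begin

text \<open>
  The increment over \<open>{s..t}\<close> of the martingale that belongs to a plane wave.
\<close>

definition wave_defect :: "real \<Rightarrow> real \<Rightarrow> real \<Rightarrow> complex ^ 'n \<Rightarrow> 'a \<Rightarrow> real" where
  "wave_defect s t \<phi> c \<omega> = cos (\<phi> + c \<bullet> w t \<omega>) - cos (\<phi> + c \<bullet> w s \<omega>)
     - integral {s..t} (\<lambda>r. plane_gen \<phi> c (w r \<omega>))"

lemma plane_gen_integrable:
  "\<omega> \<in> space M \<Longrightarrow> 0 \<le> s \<Longrightarrow> (\<lambda>r. plane_gen \<phi> c (w r \<omega>)) integrable_on {s..t}"
  by (intro integrable_continuous_real continuous_on_compose2[OF continuous_on_plane_gen] w_continuous) auto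

lemma wave_defect_measurable:
  assumes "0 \<le> s" "s \<le> t" shows "wave_defect s t \<phi> c \<in> borel_measurable M"
proof -
  have "(\<lambda>\<omega>. cos (\<phi> + c \<bullet> w r \<omega>)) \<in> borel_measurable M" if "0 \<le> r" for r
    using w_measurable[OF that] by measurable
  then show ?thesis
    unfolding wave_defect_def using assms
    by (intro borel_measurable_diff path_integral_measurable continuous_on_plane_gen) auto
qed

lemma abs_wave_defect_le:
  assumes "\<omega> \<in> space M" "0 \<le> s" "s \<le> t" "norm c \<le> K"
  shows "\<bar>wave_defect s t \<phi> c \<omega>\<bar> \<le> 2 + K\<^sup>2 * (t - s)"
proof -
  have "norm (integral {s..t} (\<lambda>r. plane_gen \<phi> c (w r \<omega>))) \<le> K\<^sup>2 * (t - s)"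
    using assms w_inner_less_1[OF assms(1)]
    by (intro integral_bound continuous_on_compose2[OF continuous_on_plane_gen] w_continuous)
      (auto intro!: abs_plane_gen_le intro: less_imp_le)
  then show ?thesis
    unfolding wave_defect_def using abs_cos_le_one[of "\<phi> + c \<bullet> w t \<omega>"] abs_cos_le_one[of "\<phi> + c \<bullet> w s \<omega>"]
    unfolding real_norm_def by linarith
qed

lemma wave_defect_tendsto:
  assumes \<omega>: "\<omega> \<in> space M" and st: "0 \<le> s" "s \<le> t"
    and \<phi>: "\<phi> \<longlonglongrightarrow> \<phi>0" and c: "c \<longlonglongrightarrow> c0" and K: "\<And>i. norm (c i) \<le> K"
  shows "(\<lambda>i. wave_defect s t (\<phi> i) (c i) \<omega>) \<longlonglongrightarrow> wave_defect s t \<phi>0 c0 \<omega>"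
proof -
  have "(\<lambda>i. integral {s..t} (\<lambda>r. plane_gen (\<phi> i) (c i) (w r \<omega>))) \<longlonglongrightarrow> integral {s..t} (\<lambda>r. plane_gen \<phi>0 c0 (w r \<omega>))"
  proof (rule dominated_convergence(2)[where h = "\<lambda>_. K\<^sup>2"])
    show "(\<lambda>r. plane_gen (\<phi> i) (c i) (w r \<omega>)) integrable_on {s..t}" for i
      by (rule plane_gen_integrable[OF \<omega> st(1)])
    show "norm (plane_gen (\<phi> i) (c i) (w r \<omega>)) \<le> K\<^sup>2" if "r \<in> {s..t}" for i r
      using w_inner_less_1[OF \<omega>, of r] that st K by (auto intro!: abs_plane_gen_le)
    show "(\<lambda>i. plane_gen (\<phi> i) (c i) (w r \<omega>)) \<longlonglongrightarrow> plane_gen \<phi>0 c0 (w r \<omega>)" for r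
      unfolding plane_gen_def wave_gen_def by (intro tendsto_intros \<phi> c) auto
  qed auto
  then show ?thesis
    unfolding wave_defect_def by (intro tendsto_intros \<phi> c)
qed

lemma expectation_wave_defect_const:
  assumes st: "0 \<le> s" "s \<le> t" and Z: "Z \<in> borel_measurable (F s)"
    and K: "\<And>\<omega>. \<omega> \<in> space M \<Longrightarrow> \<bar>Z \<omega>\<bar> \<le> K"
  shows "expectation (\<lambda>\<omega>. Z \<omega> * wave_defect s t \<phi> c \<omega>) = 0"
  using dynkin_wave[OF st Z K, of \<phi> c 1 0] by (simp add: wave_def wave_defect_def plane_gen_def)

text \<open>
  If the phase and the frequency take finitely many values, the expectation splits into finitely many terms with
  constant phase and frequency, in which the indicator of the value joins the factor \<open>Z\<close>.
\<close>

lemma expectation_wave_defect_simple: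
  assumes st: "0 \<le> s" "s \<le> t" and Z: "Z \<in> borel_measurable (F s)"
    and K: "\<And>\<omega>. \<omega> \<in> space M \<Longrightarrow> \<bar>Z \<omega>\<bar> \<le> K"
    and \<Phi>: "simple_function (F s) \<Phi>" and C: "simple_function (F s) C"
  shows "(\<lambda>\<omega>. wave_defect s t (\<Phi> \<omega>) (C \<omega>) \<omega>) \<in> borel_measurable M" (is ?m)
    and "expectation (\<lambda>\<omega>. Z \<omega> * wave_defect s t (\<Phi> \<omega>) (C \<omega>) \<omega>) = 0" (is ?e)
proof -
  define S where "S \<omega> = (\<Phi> \<omega>, C \<omega>)" for \<omega>
  have S: "simple_function (F s) S" unfolding S_def by (rule simple_function_Pair[OF \<Phi> C])
  define Y where "Y = S ` space M"
  have fin: "finite Y" using simple_functionD(1)[OF S] by (simp add: Y_def)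
  define I where "I y = (indicator (S -` {y} \<inter> space M) :: 'a \<Rightarrow> real)" for y
  have setF: "S -` {y} \<inter> space M \<in> sets (F s)" for y using simple_functionD(2)[OF S, of "{y}"] by simp
  have IF: "I y \<in> borel_measurable (F s)" for y
    unfolding I_def by (rule borel_measurable_indicator[OF setF])
  have IM: "I y \<in> borel_measurable M" for y by (rule F_measurable_imp[OF st(1) IF])
  have ZM: "Z \<in> borel_measurable M" by (rule F_measurable_imp[OF st(1) Z])
  have eq: "wave_defect s t (\<Phi> \<omega>) (C \<omega>) \<omega> = (\<Sum>y\<in>Y. I y \<omega> * wave_defect s t (fst y) (snd y) \<omega>)"
    if \<omega>: "\<omega> \<in> space M" for \<omega>
  proof -
    have "(\<Sum>y\<in>Y. I y \<omega> * wave_defect s t (fst y) (snd y) \<omega>)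
        = (\<Sum>y\<in>Y. if y = S \<omega> then wave_defect s t (fst y) (snd y) \<omega> else 0)"
      using \<omega> by (intro sum.cong) (auto simp: I_def indicator_def)
    also have "\<dots> = wave_defect s t (fst (S \<omega>)) (snd (S \<omega>)) \<omega>"
      using fin \<omega> by (simp add: Y_def)
    finally show ?thesis by (simp add: S_def)
  qed
  have "(\<lambda>\<omega>. \<Sum>y\<in>Y. I y \<omega> * wave_defect s t (fst y) (snd y) \<omega>) \<in> borel_measurable M"
    by (intro borel_measurable_sum borel_measurable_times IM wave_defect_measurable st)
  then show ?m by (rule measurable_cong[THEN iffD2, rotated]) (rule eq)
  have ZI: "\<bar>Z \<omega> * I y \<omega>\<bar> \<le> K" if "\<omega> \<in> space M" for \<omega> y
    using K[OF that] by (auto simp: I_def indicator_def)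
  have "expectation (\<lambda>\<omega>. Z \<omega> * wave_defect s t (\<Phi> \<omega>) (C \<omega>) \<omega>)
      = expectation (\<lambda>\<omega>. \<Sum>y\<in>Y. (Z \<omega> * I y \<omega>) * wave_defect s t (fst y) (snd y) \<omega>)"
    by (intro Bochner_Integration.integral_cong refl) (simp add: eq sum_distrib_left mult_ac)
  also have "\<dots> = (\<Sum>y\<in>Y. expectation (\<lambda>\<omega>. (Z \<omega> * I y \<omega>) * wave_defect s t (fst y) (snd y) \<omega>))"
  proof (rule Bochner_Integration.integral_sum)
    fix y
    show "integrable M (\<lambda>\<omega>. (Z \<omega> * I y \<omega>) * wave_defect s t (fst y) (snd y) \<omega>)"
    proof (rule integrable_bounded[of _ "K * (2 + (norm (snd y))\<^sup>2 * (t - s))"])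
      show "(\<lambda>\<omega>. (Z \<omega> * I y \<omega>) * wave_defect s t (fst y) (snd y) \<omega>) \<in> borel_measurable M"
        by (intro borel_measurable_times ZM IM wave_defect_measurable st)
      show "\<bar>(Z \<omega> * I y \<omega>) * wave_defect s t (fst y) (snd y) \<omega>\<bar> \<le> K * (2 + (norm (snd y))\<^sup>2 * (t - s))"
        if "\<omega> \<in> space M" for \<omega>
        unfolding abs_mult[of "_ * _" "wave_defect _ _ _ _ _"] using ZI[OF that, of y]
        by (intro mult_mono abs_wave_defect_le that st order_refl) auto
    qed
  qed
  also have "\<dots> = 0"
    by (intro sum.neutral ballI expectation_wave_defect_const[OF st _ ZI] borel_measurable_times Z IF)
  finally show ?e .
qed

text \<open>
  This replaces conditioning on \<open>F s\<close> with frozen parameters.  The defect is continuous in phase and frequency,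
  so simple functions approximate the general case.
\<close>

lemma expectation_wave_defect:
  assumes st: "0 \<le> s" "s \<le> t" and Z: "Z \<in> borel_measurable (F s)"
    and K: "\<And>\<omega>. \<omega> \<in> space M \<Longrightarrow> \<bar>Z \<omega>\<bar> \<le> K"
    and \<Phi>: "\<Phi> \<in> borel_measurable (F s)" and C: "C \<in> borel_measurable (F s)"
    and L: "\<And>\<omega>. \<omega> \<in> space M \<Longrightarrow> norm (C \<omega>) \<le> L"
  shows "(\<lambda>\<omega>. wave_defect s t (\<Phi> \<omega>) (C \<omega>) \<omega>) \<in> borel_measurable M" (is ?m)
    and "expectation (\<lambda>\<omega>. Z \<omega> * wave_defect s t (\<Phi> \<omega>) (C \<omega>) \<omega>) = 0" (is ?e)
proof -
  obtain \<Phi>' where \<Phi>': "\<And>i. simple_function (F s) (\<Phi>' i)"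
    "\<And>\<omega>. \<omega> \<in> space M \<Longrightarrow> (\<lambda>i. \<Phi>' i \<omega>) \<longlonglongrightarrow> \<Phi> \<omega>"
    using borel_measurable_implies_sequence_metric[OF \<Phi>, of 0] by auto
  obtain C' where "(\<forall>i. simple_function (F s) (C' i)) \<and> (\<forall>\<omega>\<in>space M. (\<lambda>i. C' i \<omega>) \<longlonglongrightarrow> C \<omega>)
      \<and> (\<forall>i. \<forall>\<omega>\<in>space M. dist (C' i \<omega>) 0 \<le> 2 * dist (C \<omega>) 0)"
    using borel_measurable_implies_sequence_metric[OF C, of 0] unfolding space_F by blast
  then have C': "\<And>i. simple_function (F s) (C' i)"
    "\<And>\<omega>. \<omega> \<in> space M \<Longrightarrow> (\<lambda>i. C' i \<omega>) \<longlonglongrightarrow> C \<omega>"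
    "\<And>i \<omega>. \<omega> \<in> space M \<Longrightarrow> norm (C' i \<omega>) \<le> 2 * norm (C \<omega>)"
    by auto
  \<comment> \<open>the simple functions may exceed the bound for \<open>C\<close>, but only by a factor 2\<close>
  have L': "norm (C' i \<omega>) \<le> 2 * L" if "\<omega> \<in> space M" for i \<omega>
    using C'(3)[OF that, of i] L[OF that] by linarith
  note simple = expectation_wave_defect_simple[OF st Z K \<Phi>'(1) C'(1)]
  have lim: "(\<lambda>i. wave_defect s t (\<Phi>' i \<omega>) (C' i \<omega>) \<omega>) \<longlonglongrightarrow> wave_defect s t (\<Phi> \<omega>) (C \<omega>) \<omega>"
    if "\<omega> \<in> space M" for \<omega>
    by (rule wave_defect_tendsto[OF that st \<Phi>'(2)[OF that] C'(2)[OF that] L'[OF that]])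
  show m: ?m
    by (rule borel_measurable_LIMSEQ_real[OF lim simple(1)])
  have ZM: "Z \<in> borel_measurable M" by (rule F_measurable_imp[OF st(1) Z])
  have "(\<lambda>i. expectation (\<lambda>\<omega>. Z \<omega> * wave_defect s t (\<Phi>' i \<omega>) (C' i \<omega>) \<omega>))
      \<longlonglongrightarrow> expectation (\<lambda>\<omega>. Z \<omega> * wave_defect s t (\<Phi> \<omega>) (C \<omega>) \<omega>)"
  proof (rule integral_dominated_convergence[where w = "\<lambda>_. K * (2 + (2 * L)\<^sup>2 * (t - s))"])
    show "(\<lambda>\<omega>. Z \<omega> * wave_defect s t (\<Phi> \<omega>) (C \<omega>) \<omega>) \<in> borel_measurable M"
      by (intro borel_measurable_times ZM m)
    show "(\<lambda>\<omega>. Z \<omega> * wave_defect s t (\<Phi>' i \<omega>) (C' i \<omega>) \<omega>) \<in> borel_measurable M" for i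
      by (intro borel_measurable_times ZM simple)
    show "AE \<omega> in M. (\<lambda>i. Z \<omega> * wave_defect s t (\<Phi>' i \<omega>) (C' i \<omega>) \<omega>) \<longlonglongrightarrow> Z \<omega> * wave_defect s t (\<Phi> \<omega>) (C \<omega>) \<omega>"
      by (intro AE_I2 tendsto_intros lim)
    show "AE \<omega> in M. norm (Z \<omega> * wave_defect s t (\<Phi>' i \<omega>) (C' i \<omega>) \<omega>) \<le> K * (2 + (2 * L)\<^sup>2 * (t - s))" for i
    proof (rule AE_I2)
      fix \<omega> assume \<omega>: "\<omega> \<in> space M"
      show "norm (Z \<omega> * wave_defect s t (\<Phi>' i \<omega>) (C' i \<omega>) \<omega>) \<le> K * (2 + (2 * L)\<^sup>2 * (t - s))"
        unfolding real_norm_def abs_mult using K[OF \<omega>]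
        by (intro mult_mono abs_wave_defect_le st \<omega> L'[OF \<omega>]) auto
    qed
  qed auto
  moreover have "expectation (\<lambda>\<omega>. Z \<omega> * wave_defect s t (\<Phi>' i \<omega>) (C' i \<omega>) \<omega>) = 0" for i
    by (rule simple(2))
  ultimately show ?e by (simp add: LIMSEQ_const_iff)
qed

end

section \<open>The discrete area, truncated near the boundary\<close>

text \<open>
  The frequency of the plane wave on a cell that starts at \<open>a\<close>: the increment of the left Riemann sum of
  \<open>\<xi> \<theta>\<close> over a cell from \<open>a\<close> to \<open>b\<close> is \<open>turn \<delta> \<xi> a \<bullet> b\<close>, unless \<open>a\<close> is within \<open>\<delta>\<close> of the boundary.
\<close>

definition turn :: "real \<Rightarrow> real \<Rightarrow> complex ^ 'n \<Rightarrow> complex ^ 'n" where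
  "turn \<delta> \<xi> a = (if \<delta> \<le> 1 - a \<bullet> a then (\<xi> / (1 - a \<bullet> a)) *\<^sub>R imult a else 0)"

text \<open>
  The rate at which the plane wave with frequency \<open>turn \<delta> \<xi> a\<close> decays in the mean when the process leaves
  \<open>a\<close>; away from the boundary and for \<open>\<xi> = 1\<close> it is half of the derivative of the quadratic variation of the area.
\<close>

definition rate :: "real \<Rightarrow> real \<Rightarrow> complex ^ 'n \<Rightarrow> real" where
  "rate \<delta> \<xi> a = (if \<delta> \<le> 1 - a \<bullet> a then \<xi>\<^sup>2 / 2 * (a \<bullet> a) else 0)"

lemma turn_inner [simp]: "turn \<delta> \<xi> a \<bullet> a = 0"
  by (simp add: turn_def)

lemma norm_turn_le:
  assumes "0 < \<delta>" "a \<bullet> a \<le> 1" shows "norm (turn \<delta> \<xi> a) \<le> \<bar>\<xi>\<bar> / \<delta>"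
proof (cases "\<delta> \<le> 1 - a \<bullet> a")
  case True
  have "norm a \<le> 1" using assms(2) by (simp add: norm_le_square power2_eq_square)
  then have "\<bar>\<xi>\<bar> / (1 - a \<bullet> a) * norm a \<le> \<bar>\<xi>\<bar> / \<delta> * 1"
    using True assms by (intro mult_mono divide_left_mono) auto
  then show ?thesis using True assms by (simp add: turn_def)
next
  case False
  then show ?thesis using assms by (simp add: turn_def)
qed

lemma rate_bounds:
  assumes "a \<bullet> a \<le> 1" shows "0 \<le> rate \<delta> \<xi> a" "rate \<delta> \<xi> a \<le> \<xi>\<^sup>2 / 2"
  using assms mult_left_mono[of "a \<bullet> a" 1 "\<xi>\<^sup>2 / 2"] by (auto simp: rate_def)

text \<open>
  With \<open>u = 1 - |a|\<^sup>2\<close> and \<open>c = (\<xi>/u) \<i> a\<close>, one has \<open>c \<bullet> a = 0\<close> and \<open>|c|\<^sup>2 - (c \<bullet> \<i> a)\<^sup>2 = (\<xi>/u)\<^sup>2 |a|\<^sup>2 u\<close>, so the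
  factor \<open>u/2\<close> of the generator cancels the singularity at the boundary.
\<close>

lemma plane_gen_turn:
  assumes "0 < \<delta>" shows "plane_gen \<phi> (turn \<delta> \<xi> a) a = - rate \<delta> \<xi> a * cos \<phi>"
proof (cases "\<delta> \<le> 1 - a \<bullet> a")
  case True
  define u where "u = 1 - a \<bullet> a"
  have u: "u \<noteq> 0" "a \<bullet> a = 1 - u" using True assms by (auto simp: u_def)
  have "plane_gen \<phi> (turn \<delta> \<xi> a) a
     = - u / 2 * ((\<xi> / u) * ((\<xi> / u) * (1 - u)) - ((\<xi> / u) * (1 - u))\<^sup>2) * cos \<phi>"
    using True u by (simp add: turn_def plane_gen_def wave_gen_def u_def[symmetric])
  also have "\<dots> = - (\<xi>\<^sup>2 / 2 * (1 - u)) * cos \<phi>"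
    using u(1) by (simp add: field_simps power2_eq_square)
  finally show ?thesis using True u by (simp add: rate_def)
qed (simp add: turn_def rate_def plane_gen_def wave_gen_def)

lemma turn_measurable [measurable]: "turn \<delta> \<xi> \<in> borel_measurable borel"
proof -
  have [measurable]: "(imult :: complex ^ 'n \<Rightarrow> _) \<in> borel_measurable borel"
    by (rule borel_measurable_continuous_onI) (intro continuous_intros)
  show ?thesis unfolding turn_def[abs_def] by measurable
qed

lemma rate_measurable [measurable]: "rate \<delta> \<xi> \<in> borel_measurable borel"
  unfolding rate_def[abs_def] by measurable

text \<open>
  In one cell, \<open>c\<close> is the increase of the exponent and \<open>J\<close> the error of freezing the generator at the left end
  point.  The factor \<open>exp c\<close> compensates the mean decay \<open>1 - c\<close> up to second order in \<open>c\<close>.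
\<close>

lemma one_step_pointwise:
  fixes \<phi> B c D J :: real
  assumes "0 \<le> c" and "0 \<le> B" and "B + c \<le> E" and J: "\<bar>J\<bar> \<le> j"
  shows "\<bar>exp (B + c) * (cos \<phi> + (J - c * cos \<phi>)) - exp B * cos \<phi>\<bar> \<le> exp E * (c\<^sup>2 + j)"
proof -
  have e: "\<bar>1 - c - exp (- c)\<bar> \<le> c\<^sup>2"
  proof -
    have "1 - c \<le> exp (- c)" using exp_ge_add_one_self[of "- c"] by simp
    moreover have "exp (- c) \<le> 1 - c + c\<^sup>2"
    proof -
      have "exp (- c) \<le> 1 / (1 + c)"
        using exp_ge_add_one_self[of c] \<open>0 \<le> c\<close> by (simp add: exp_minus inverse_eq_divide divide_simps)
      also have "1 \<le> (1 - c + c\<^sup>2) * (1 + c)"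
        using \<open>0 \<le> c\<close> by (simp add: algebra_simps power2_eq_square)
      then have "1 / (1 + c) \<le> 1 - c + c\<^sup>2" using \<open>0 \<le> c\<close> by (simp add: divide_le_eq)
      finally show ?thesis .
    qed
    ultimately show ?thesis by (simp add: abs_le_iff)
  qed
  have "exp (B + c) * (cos \<phi> + (J - c * cos \<phi>)) - exp B * cos \<phi>
      = exp (B + c) * ((1 - c - exp (- c)) * cos \<phi> + J)"
    by (simp add: exp_add exp_minus field_simps)
  also have "\<bar>\<dots>\<bar> \<le> exp E * (c\<^sup>2 * 1 + j)"
    unfolding abs_mult[of "exp _"]
  proof (intro mult_mono)
    show "\<bar>exp (B + c)\<bar> \<le> exp E" using assms by simp
    show "\<bar>(1 - c - exp (- c)) * cos \<phi> + J\<bar> \<le> c\<^sup>2 * 1 + j"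
      by (intro order_trans[OF abs_triangle_ineq] add_mono J, unfold abs_mult, intro mult_mono e) auto
  qed auto
  finally show ?thesis by simp
qed

context hyperbolic_brownian_motion
begin

text \<open>
  The variables \<open>phase\<close> and \<open>clock\<close> are the phase \<open>\<phi> + \<xi> \<theta>\<close> and the exponent \<open>\<xi>\<^sup>2/2 \<integral>\<rho>\<close> after \<open>k\<close> of the
  \<open>N\<close> cells of \<open>{0..t}\<close>, both as truncated left Riemann sums.
\<close>

definition phase :: "real \<Rightarrow> real \<Rightarrow> real \<Rightarrow> real \<Rightarrow> nat \<Rightarrow> nat \<Rightarrow> 'a \<Rightarrow> real" where
  "phase \<delta> \<xi> \<phi> t N k \<omega> =
     \<phi> + (\<Sum>j<k. turn \<delta> \<xi> (w (equipart 0 t N j) \<omega>) \<bullet> w (equipart 0 t N (Suc j)) \<omega>)"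

definition clock :: "real \<Rightarrow> real \<Rightarrow> real \<Rightarrow> nat \<Rightarrow> nat \<Rightarrow> 'a \<Rightarrow> real" where
  "clock \<delta> \<xi> t N k \<omega> = (\<Sum>j<k. rate \<delta> \<xi> (w (equipart 0 t N j) \<omega>) * (t / real N))"

definition oscillation :: "real \<Rightarrow> nat \<Rightarrow> nat \<Rightarrow> 'a \<Rightarrow> real" where
  "oscillation t N k \<omega> = integral {equipart 0 t N k..equipart 0 t N (Suc k)}
     (\<lambda>r. norm (w r \<omega> - w (equipart 0 t N k) \<omega>))"

lemma phase_adapted:
  assumes "0 \<le> t" shows "phase \<delta> \<xi> \<phi> t N k \<in> borel_measurable (F (equipart 0 t N k))"
proof -
  have "w (equipart 0 t N j) \<in> borel_measurable (F (equipart 0 t N k))" if "j \<le> k" for j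
    by (intro w_adapted equipart_nonneg equipart_mono assms that)
  then show ?thesis
    unfolding phase_def
    by (intro borel_measurable_add borel_measurable_const borel_measurable_sum borel_measurable_inner
        measurable_compose[OF _ turn_measurable]) auto
qed

text \<open>
  The increase of the clock over a cell is determined by the left end point, so the clock after \<open>k + 1\<close> cells is
  already known at the beginning of the last of them.
\<close>

lemma clock_Suc_adapted:
  assumes "0 \<le> t" shows "clock \<delta> \<xi> t N (Suc k) \<in> borel_measurable (F (equipart 0 t N k))"
proof -
  have "w (equipart 0 t N j) \<in> borel_measurable (F (equipart 0 t N k))" if "j \<le> k" for j
    by (intro w_adapted equipart_nonneg equipart_mono assms that)
  then show ?thesis
    unfolding clock_def
    by (intro borel_measurable_times borel_measurable_const borel_measurable_sum
        measurable_compose[OF _ rate_measurable]) auto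
qed

lemma phase_measurable: "0 \<le> t \<Longrightarrow> phase \<delta> \<xi> \<phi> t N k \<in> borel_measurable M"
  by (rule F_measurable_imp[OF equipart_nonneg phase_adapted])

lemma clock_measurable: "0 \<le> t \<Longrightarrow> clock \<delta> \<xi> t N k \<in> borel_measurable M"
  unfolding clock_def
  by (intro borel_measurable_times borel_measurable_const borel_measurable_sum
      measurable_compose[OF _ rate_measurable] w_measurable equipart_nonneg)

lemma clock_bounds:
  assumes "\<omega> \<in> space M" "0 \<le> t" "k \<le> N"
  shows "0 \<le> clock \<delta> \<xi> t N k \<omega>" "clock \<delta> \<xi> t N k \<omega> \<le> \<xi>\<^sup>2 * t / 2"
proof -
  have le1: "w (equipart 0 t N j) \<omega> \<bullet> w (equipart 0 t N j) \<omega> \<le> 1" for j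
    using w_inner_less_1[OF assms(1) equipart_nonneg[OF assms(2)]] by (rule less_imp_le)
  show "0 \<le> clock \<delta> \<xi> t N k \<omega>"
    unfolding clock_def using assms by (intro sum_nonneg mult_nonneg_nonneg rate_bounds le1) auto
  have "clock \<delta> \<xi> t N k \<omega> \<le> (\<Sum>j<k. \<xi>\<^sup>2 / 2 * (t / real N))"
    unfolding clock_def using assms by (intro sum_mono mult_right_mono rate_bounds le1) auto
  also have "\<dots> = (real k / real N) * (\<xi>\<^sup>2 * t / 2)" by simp
  also have "\<dots> \<le> 1 * (\<xi>\<^sup>2 * t / 2)"
    using assms by (intro mult_right_mono) (auto simp: divide_le_eq)
  finally show "clock \<delta> \<xi> t N k \<omega> \<le> \<xi>\<^sup>2 * t / 2" by simp
qed

lemma oscillation_measurable: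
  assumes "0 \<le> t" shows "oscillation t N k \<in> borel_measurable M"
  unfolding oscillation_def
proof (rule borel_measurable_path_integral)
  let ?p = "equipart 0 t N k" and ?q = "equipart 0 t N (Suc k)"
  show "?p \<le> ?q" by (simp add: equipart_mono assms)
  show "continuous_on {?p..?q} (\<lambda>r. norm (w r \<omega> - w ?p \<omega>))" if "\<omega> \<in> space M" for \<omega>
    by (intro continuous_intros w_continuous that equipart_nonneg assms)
  show "(\<lambda>\<omega>. norm (w r \<omega> - w ?p \<omega>)) \<in> borel_measurable M" if "r \<in> {?p..?q}" for r
  proof -
    have "0 \<le> r" using that equipart_nonneg[OF assms, of N k] by auto
    then have [measurable]: "w r \<in> borel_measurable M" "w ?p \<in> borel_measurable M"
      by (auto intro!: w_measurable equipart_nonneg assms)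
    show ?thesis by measurable
  qed
qed

lemma oscillation_bounds:
  assumes \<omega>: "\<omega> \<in> space M" and t: "0 \<le> t"
  shows "0 \<le> oscillation t N k \<omega>" "oscillation t N k \<omega> \<le> 2 * (t / real N)"
proof -
  let ?p = "equipart 0 t N k" and ?q = "equipart 0 t N (Suc k)"
  have pq: "?p \<le> ?q" by (simp add: equipart_mono t)
  have nw: "norm (w r \<omega>) \<le> 1" if "0 \<le> r" for r
    using w_inner_less_1[OF \<omega> that] by (simp add: norm_le_square power2_eq_square)
  have cont: "continuous_on {?p..?q} (\<lambda>r. norm (w r \<omega> - w ?p \<omega>))"
    by (intro continuous_intros w_continuous \<omega> equipart_nonneg t)
  have "norm (oscillation t N k \<omega>) \<le> 2 * (?q - ?p)"
    unfolding oscillation_def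
  proof (rule integral_bound[OF pq cont])
    fix r assume "r \<in> {?p..?q}"
    then have "0 \<le> r" using equipart_nonneg[OF t, of N k] by auto
    then show "norm (norm (w r \<omega> - w ?p \<omega>)) \<le> 2"
      using norm_triangle_ineq4[of "w r \<omega>" "w ?p \<omega>"] nw[of r] nw[of ?p] equipart_nonneg[OF t, of N k] by simp
  qed
  then show "oscillation t N k \<omega> \<le> 2 * (t / real N)" by (simp add: equipart_step)
  show "0 \<le> oscillation t N k \<omega>"
    unfolding oscillation_def by (rule integral_nonneg[OF integrable_continuous_real[OF cont]]) simp
qed

lemma oscillation_integrable:
  assumes t: "0 \<le> t" shows "integrable M (oscillation t N k)"
proof (rule integrable_bounded[OF oscillation_measurable[OF t]])
  show "\<bar>oscillation t N k \<omega>\<bar> \<le> 2 * (t / real N)" if "\<omega> \<in> space M" for \<omega>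
    using oscillation_bounds[OF that t, of N k] by simp
qed

lemma expected_oscillation_tendsto_0:
  assumes t: "0 \<le> t"
  shows "(\<lambda>N. expectation (\<lambda>\<omega>. \<Sum>k<N. oscillation t N k \<omega>)) \<longlonglongrightarrow> 0"
proof -
  have "(\<lambda>N. expectation (\<lambda>\<omega>. \<Sum>k<N. oscillation t N k \<omega>)) \<longlonglongrightarrow> expectation (\<lambda>\<omega>. 0)"
  proof (rule integral_dominated_convergence[where w = "\<lambda>_. 2 * t"])
    show "(\<lambda>\<omega>. \<Sum>k<N. oscillation t N k \<omega>) \<in> borel_measurable M" for N
      by (intro borel_measurable_sum oscillation_measurable t)
    show "AE \<omega> in M. (\<lambda>N. \<Sum>k<N. oscillation t N k \<omega>) \<longlonglongrightarrow> 0"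
      unfolding oscillation_def by (intro AE_I2 path_oscillation_tendsto_0 t w_continuous) auto
    show "AE \<omega> in M. norm (\<Sum>k<N. oscillation t N k \<omega>) \<le> 2 * t" for N
    proof (rule AE_I2)
      fix \<omega> assume \<omega>: "\<omega> \<in> space M"
      have "(\<Sum>k<N. oscillation t N k \<omega>) \<le> (\<Sum>k<N. 2 * (t / real N))"
        by (intro sum_mono oscillation_bounds \<omega> t)
      also have "\<dots> \<le> 2 * t" using t by (cases "N = 0") auto
      finally show "norm (\<Sum>k<N. oscillation t N k \<omega>) \<le> 2 * t"
        using sum_nonneg[of "{..<N}" "\<lambda>k. oscillation t N k \<omega>"] oscillation_bounds(1)[OF \<omega> t] by simp
    qed
  qed auto
  then show ?thesis by simp
qed

text \<open>
  The updated phase is \<open>\<Phi> + C \<bullet> w\<close> with \<open>\<Phi>\<close> and \<open>C\<close> known at the left end point \<open>p\<close>, and \<open>C \<bullet> w p = 0\<close>.  Subtracting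
  \<open>Z D\<close>, whose expectation is 0 by \<open>expectation_wave_defect\<close>, replaces the cosine of the updated phase by
  \<open>cos \<Phi>\<close> plus the integral of the generator, and what is left is the expression of \<open>one_step_pointwise\<close>.
\<close>

lemma discrete_step:
  fixes \<delta> \<xi> \<phi> t :: real
  assumes \<delta>: "0 < \<delta>" and t: "0 \<le> t" and k: "k < N"
  defines "L \<equiv> 4 * (\<bar>\<xi>\<bar> / \<delta>)\<^sup>2 + (\<bar>\<xi>\<bar> / \<delta>) ^ 3"
  shows "\<bar>expectation (\<lambda>\<omega>. exp (clock \<delta> \<xi> t N (Suc k) \<omega>) * cos (phase \<delta> \<xi> \<phi> t N (Suc k) \<omega>))
      - expectation (\<lambda>\<omega>. exp (clock \<delta> \<xi> t N k \<omega>) * cos (phase \<delta> \<xi> \<phi> t N k \<omega>))\<bar>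
    \<le> exp (\<xi>\<^sup>2 * t / 2) * ((\<xi>\<^sup>2 / 2 * (t / real N))\<^sup>2 + L * expectation (oscillation t N k))"
proof -
  let ?p = "equipart 0 t N k" and ?q = "equipart 0 t N (Suc k)"
  let ?h = "t / real N" and ?E = "\<xi>\<^sup>2 * t / 2"
  define U where "U k \<omega> = exp (clock \<delta> \<xi> t N k \<omega>) * cos (phase \<delta> \<xi> \<phi> t N k \<omega>)" for k \<omega>
  define Z where "Z \<omega> = exp (clock \<delta> \<xi> t N (Suc k) \<omega>)" for \<omega>
  define D where "D \<omega> = wave_defect ?p ?q (phase \<delta> \<xi> \<phi> t N k \<omega>) (turn \<delta> \<xi> (w ?p \<omega>)) \<omega>" for \<omega>
  have L0: "0 \<le> L" using \<delta> by (simp add: L_def)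
  have p0: "0 \<le> ?p" and pq: "?p \<le> ?q" by (simp_all add: equipart_nonneg equipart_mono t)
  have inner1: "w r \<omega> \<bullet> w r \<omega> \<le> 1" if "\<omega> \<in> space M" "0 \<le> r" for \<omega> r
    using w_inner_less_1[OF that] by simp
  have ZF: "Z \<in> borel_measurable (F ?p)"
    unfolding Z_def using clock_Suc_adapted[OF t, of \<delta> \<xi> N k] by measurable
  have ZM: "Z \<in> borel_measurable M" by (rule F_measurable_imp[OF p0 ZF])
  have Zb: "\<bar>Z \<omega>\<bar> \<le> exp ?E" if "\<omega> \<in> space M" for \<omega>
    using clock_bounds(2)[OF that t, of "Suc k" N \<delta> \<xi>] k by (simp add: Z_def)
  have turnF: "(\<lambda>\<omega>. turn \<delta> \<xi> (w ?p \<omega>)) \<in> borel_measurable (F ?p)"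
    by (rule measurable_compose[OF w_adapted[OF p0 order_refl] turn_measurable])
  have turnb: "norm (turn \<delta> \<xi> (w ?p \<omega>)) \<le> \<bar>\<xi>\<bar> / \<delta>" if "\<omega> \<in> space M" for \<omega>
    by (rule norm_turn_le[OF \<delta> inner1[OF that p0]])
  have DM: "D \<in> borel_measurable M" and ZD: "expectation (\<lambda>\<omega>. Z \<omega> * D \<omega>) = 0"
    unfolding D_def[abs_def]
    by (rule expectation_wave_defect[OF p0 pq ZF Zb phase_adapted[OF t] turnF turnb]; assumption)+
  have UM: "U i \<in> borel_measurable M" for i
    unfolding U_def using clock_measurable[OF t, of \<delta> \<xi> N i] phase_measurable[OF t, of \<delta> \<xi> \<phi> N i] by measurable
  have Ub: "\<bar>U i \<omega>\<bar> \<le> exp ?E" if "\<omega> \<in> space M" "i \<le> N" for i \<omega>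
  proof -
    have "\<bar>U i \<omega>\<bar> \<le> exp ?E * 1"
      unfolding U_def abs_mult using clock_bounds(2)[OF that(1) t that(2)] by (intro mult_mono) auto
    then show ?thesis by simp
  qed
  have intU: "integrable M (U i)" if "i \<le> N" for i
    by (rule integrable_bounded[OF UM Ub[OF _ that]])
  have intZD: "integrable M (\<lambda>\<omega>. Z \<omega> * D \<omega>)"
  proof (rule integrable_bounded)
    show "\<bar>Z \<omega> * D \<omega>\<bar> \<le> exp ?E * (2 + (\<bar>\<xi>\<bar> / \<delta>)\<^sup>2 * (?q - ?p))" if "\<omega> \<in> space M" for \<omega>
      unfolding abs_mult D_def by (intro mult_mono Zb abs_wave_defect_le that p0 pq turnb) auto
    show "(\<lambda>\<omega>. Z \<omega> * D \<omega>) \<in> borel_measurable M" by (intro borel_measurable_times ZM DM)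
  qed
  note intO = oscillation_integrable[OF t, of N k]
  have R: "\<bar>U (Suc k) \<omega> - U k \<omega> - Z \<omega> * D \<omega>\<bar> \<le> exp ?E * ((\<xi>\<^sup>2 / 2 * ?h)\<^sup>2 + L * oscillation t N k \<omega>)"
    if \<omega>: "\<omega> \<in> space M" for \<omega>
  proof -
    define a where "a = w ?p \<omega>"
    define \<Phi> where "\<Phi> = phase \<delta> \<xi> \<phi> t N k \<omega>"
    define C where "C = turn \<delta> \<xi> a"
    define B where "B = clock \<delta> \<xi> t N k \<omega>"
    define c where "c = rate \<delta> \<xi> a * ?h"
    define J where "J = integral {?p..?q} (\<lambda>r. plane_gen \<Phi> C (w r \<omega>) - plane_gen \<Phi> C a)"
    have a1: "a \<bullet> a \<le> 1" unfolding a_def by (rule inner1[OF \<omega> p0])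
    have c: "0 \<le> c" "c \<le> \<xi>\<^sup>2 / 2 * ?h"
      unfolding c_def using t
      by (auto intro!: mult_nonneg_nonneg divide_nonneg_nonneg mult_right_mono rate_bounds a1
          simp del: times_divide_eq_right times_divide_eq_left)
    have Bc: "clock \<delta> \<xi> t N (Suc k) \<omega> = B + c" by (simp add: clock_def B_def c_def a_def)
    have pc: "plane_gen \<Phi> C a = - rate \<delta> \<xi> a * cos \<Phi>" unfolding C_def by (rule plane_gen_turn[OF \<delta>])
    have gi: "(\<lambda>r. plane_gen \<Phi> C (w r \<omega>)) integrable_on {?p..?q}"
      by (rule plane_gen_integrable[OF \<omega> p0])
    have "J = integral {?p..?q} (\<lambda>r. plane_gen \<Phi> C (w r \<omega>)) - integral {?p..?q} (\<lambda>r. plane_gen \<Phi> C a)"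
      unfolding J_def by (rule Henstock_Kurzweil_Integration.integral_diff[OF gi integrable_const_ivl])
    also have "integral {?p..?q} (\<lambda>r. plane_gen \<Phi> C a) = - c * cos \<Phi>"
      using pq by (simp add: pc c_def equipart_step)
    finally have gint: "integral {?p..?q} (\<lambda>r. plane_gen \<Phi> C (w r \<omega>)) = J - c * cos \<Phi>" by simp
    have Dw: "D \<omega> = cos (\<Phi> + C \<bullet> w ?q \<omega>) - cos \<Phi> - (J - c * cos \<Phi>)"
      unfolding D_def wave_defect_def \<Phi>_def[symmetric] a_def[symmetric] C_def[symmetric] gint
      by (simp add: C_def)
    have ph: "phase \<delta> \<xi> \<phi> t N (Suc k) \<omega> = \<Phi> + C \<bullet> w ?q \<omega>"
      by (simp add: phase_def \<Phi>_def C_def a_def)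
    have eq: "U (Suc k) \<omega> - U k \<omega> - Z \<omega> * D \<omega> = exp (B + c) * (cos \<Phi> + (J - c * cos \<Phi>)) - exp B * cos \<Phi>"
      unfolding U_def ph Dw Z_def Bc B_def[symmetric] \<Phi>_def[symmetric] by (simp add: algebra_simps)
    have Jb: "\<bar>J\<bar> \<le> L * oscillation t N k \<omega>"
    proof -
      have io: "(\<lambda>r. norm (w r \<omega> - a)) integrable_on {?p..?q}"
        by (intro integrable_continuous_real continuous_intros w_continuous \<omega> p0)
      have "norm J \<le> integral {?p..?q} (\<lambda>r. L * norm (w r \<omega> - a))"
        unfolding J_def
      proof (rule integral_norm_bound_integral)
        show "(\<lambda>r. plane_gen \<Phi> C (w r \<omega>) - plane_gen \<Phi> C a) integrable_on {?p..?q}"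
          by (rule integrable_diff[OF gi integrable_const_ivl])
        show "(\<lambda>r. L * norm (w r \<omega> - a)) integrable_on {?p..?q}"
          by (rule integrable_on_mult_right[OF io])
        fix r assume "r \<in> {?p..?q}"
        then have "0 \<le> r" using p0 by auto
        then show "norm (plane_gen \<Phi> C (w r \<omega>) - plane_gen \<Phi> C a) \<le> L * norm (w r \<omega> - a)"
          unfolding L_def real_norm_def C_def
          by (intro plane_gen_lipschitz a1 inner1 \<omega> norm_turn_le \<delta>)
      qed
      then show ?thesis by (simp add: oscillation_def a_def)
    qed
    have "\<bar>U (Suc k) \<omega> - U k \<omega> - Z \<omega> * D \<omega>\<bar> \<le> exp ?E * (c\<^sup>2 + L * oscillation t N k \<omega>)"
      unfolding eq
      by (rule one_step_pointwise[OF c(1) _ _ Jb])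
        (use clock_bounds[OF \<omega> t, of k N \<delta> \<xi>] clock_bounds[OF \<omega> t, of "Suc k" N \<delta> \<xi>] k in \<open>auto simp: B_def[symmetric] Bc\<close>)
    also have "\<dots> \<le> exp ?E * ((\<xi>\<^sup>2 / 2 * ?h)\<^sup>2 + L * oscillation t N k \<omega>)"
      using c by (intro mult_left_mono add_right_mono power_mono) auto
    finally show ?thesis .
  qed
  have "expectation (U (Suc k)) - expectation (U k) = expectation (\<lambda>\<omega>. U (Suc k) \<omega> - U k \<omega> - Z \<omega> * D \<omega>)"
    using intU[of "Suc k"] intU[of k] intZD ZD k by simp
  also have "\<bar>\<dots>\<bar> \<le> expectation (\<lambda>\<omega>. exp ?E * ((\<xi>\<^sup>2 / 2 * ?h)\<^sup>2 + L * oscillation t N k \<omega>))"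
  proof (rule order_trans[OF integral_abs_bound integral_mono])
    show "integrable M (\<lambda>\<omega>. \<bar>U (Suc k) \<omega> - U k \<omega> - Z \<omega> * D \<omega>\<bar>)"
      using k by (intro integrable_abs Bochner_Integration.integrable_diff intU intZD) auto
    show "integrable M (\<lambda>\<omega>. exp ?E * ((\<xi>\<^sup>2 / 2 * ?h)\<^sup>2 + L * oscillation t N k \<omega>))"
      by (intro integrable_mult_right Bochner_Integration.integrable_add intO integrable_const)
  qed (rule R)
  also have "\<dots> = exp ?E * ((\<xi>\<^sup>2 / 2 * ?h)\<^sup>2 + L * expectation (oscillation t N k))"
    using intO by (simp add: prob_space)
  finally show ?thesis unfolding U_def .
qed

text \<open>
  The step errors sum up to a multiple of \<open>1 / N\<close> plus a multiple of the expected total oscillation.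
\<close>

lemma discrete_exponential_tendsto:
  assumes \<delta>: "0 < \<delta>" and t: "0 \<le> t"
  shows "(\<lambda>N. expectation (\<lambda>\<omega>. exp (clock \<delta> \<xi> t N N \<omega>) * cos (phase \<delta> \<xi> \<phi> t N N \<omega>))) \<longlonglongrightarrow> cos \<phi>"
proof -
  define L where "L = 4 * (\<bar>\<xi>\<bar> / \<delta>)\<^sup>2 + (\<bar>\<xi>\<bar> / \<delta>) ^ 3"
  define u where "u N k = expectation (\<lambda>\<omega>. exp (clock \<delta> \<xi> t N k \<omega>) * cos (phase \<delta> \<xi> \<phi> t N k \<omega>))" for N k
  define g where "g N = exp (\<xi>\<^sup>2 * t / 2) * ((\<xi>\<^sup>2 / 2 * t)\<^sup>2 / real N
      + L * expectation (\<lambda>\<omega>. \<Sum>k<N. oscillation t N k \<omega>))" for N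
  have u0: "u N 0 = cos \<phi>" for N by (simp add: u_def clock_def phase_def prob_space)
  note intO = oscillation_integrable[OF t]
  have "norm (u N N - cos \<phi>) \<le> g N" if N: "0 < N" for N
  proof -
    have "u N N - cos \<phi> = (\<Sum>k<N. u N (Suc k) - u N k)"
      by (simp add: sum_lessThan_telescope u0)
    also have "norm \<dots> \<le> (\<Sum>k<N. exp (\<xi>\<^sup>2 * t / 2) * ((\<xi>\<^sup>2 / 2 * (t / real N))\<^sup>2 + L * expectation (oscillation t N k)))"
      using discrete_step[OF \<delta> t, of _ N \<xi> \<phi>] unfolding u_def L_def
      by (intro order_trans[OF norm_sum] sum_mono) simp
    also have "\<dots> = exp (\<xi>\<^sup>2 * t / 2) * (real N * (\<xi>\<^sup>2 / 2 * (t / real N))\<^sup>2 + L * (\<Sum>k<N. expectation (oscillation t N k)))"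
      by (simp add: sum_distrib_left[symmetric] sum.distrib)
    also have "real N * (\<xi>\<^sup>2 / 2 * (t / real N))\<^sup>2 = (\<xi>\<^sup>2 / 2 * t)\<^sup>2 / real N"
      using N by (simp add: power2_eq_square)
    also have "(\<Sum>k<N. expectation (oscillation t N k)) = expectation (\<lambda>\<omega>. \<Sum>k<N. oscillation t N k \<omega>)"
      using intO by (simp add: Bochner_Integration.integral_sum)
    finally show ?thesis by (simp add: g_def)
  qed
  then have "\<forall>\<^sub>F N in sequentially. norm (u N N - cos \<phi>) \<le> g N"
    using eventually_gt_at_top[of 0] by (rule eventually_mono[rotated]) auto
  moreover have "g \<longlonglongrightarrow> exp (\<xi>\<^sup>2 * t / 2) * (0 + L * 0)"
    unfolding g_def by (rule tendsto_mult[OF tendsto_const tendsto_add[OF lim_const_over_n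
            tendsto_mult[OF tendsto_const expected_oscillation_tendsto_0[OF t]]]])
  ultimately have "(\<lambda>N. u N N - cos \<phi>) \<longlonglongrightarrow> 0" by (auto intro: Lim_null_comparison[of _ g])
  then show ?thesis unfolding u_def by (rule LIM_zero_cancel)
qed

end

section \<open>The exponential identity for the area\<close>

lemma (in prob_space) integrable_min_1:
  assumes "d \<in> borel_measurable M" "\<And>\<omega>. 0 \<le> (d \<omega> :: real)"
  shows "integrable M (\<lambda>\<omega>. min 1 (d \<omega>))"
  by (rule integrable_bounded[of _ 1]) (use assms in \<open>auto intro!: borel_measurable_min simp: min_def\<close>)

text \<open>
  Convergence in probability is recast as convergence of the expectations of truncated distances, which is
  additive over the coordinates.
\<close>

lemma (in prob_space) ito_integral_left_sums:
  assumes ito: "ito_integral M H X I" and t: "0 < t"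
    and meas: "\<And>N. (\<lambda>\<omega>. left_sum H X N (equipart 0 t N) \<omega>) \<in> borel_measurable M"
  shows "(\<lambda>N. expectation (\<lambda>\<omega>. min 1 (dist (left_sum H X N (equipart 0 t N) \<omega>) (I t \<omega>)))) \<longlonglongrightarrow> 0"
proof (rule LIMSEQ_I)
  fix e :: real assume e: "0 < e"
  have "\<forall>t\<ge>0. \<forall>\<epsilon>>0. \<exists>\<delta>>0. \<forall>N p. time_partition t N p \<and> (\<forall>k<N. p (Suc k) - p k < \<delta>) \<longrightarrow>
        prob {\<omega> \<in> space M. dist (left_sum H X N p \<omega>) (I t \<omega>) > \<epsilon>} < \<epsilon>"
    and It: "I t \<in> borel_measurable M"
    using ito t by (simp_all add: ito_integral_def)
  from this(1)[rule_format, of t "e / 2"] t e obtain \<delta> where \<delta>: "0 < \<delta>"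
    "\<And>N p. time_partition t N p \<Longrightarrow> (\<And>k. k < N \<Longrightarrow> p (Suc k) - p k < \<delta>) \<Longrightarrow>
        prob {\<omega> \<in> space M. dist (left_sum H X N p \<omega>) (I t \<omega>) > e / 2} < e / 2" by auto
  obtain n0 where n0: "t / \<delta> < real n0" using reals_Archimedean2 by blast
  show "\<exists>no. \<forall>N\<ge>no. norm (expectation (\<lambda>\<omega>. min 1 (dist (left_sum H X N (equipart 0 t N) \<omega>) (I t \<omega>))) - 0) < e"
  proof (intro exI[of _ "Suc n0"] allI impI)
    fix N assume N: "Suc n0 \<le> N"
    then have N0: "0 < N" and "t / \<delta> < real N" using n0 by auto
    then have h: "t / real N < \<delta>" using \<delta>(1) by (simp add: field_simps)
    let ?d = "\<lambda>\<omega>. dist (left_sum H X N (equipart 0 t N) \<omega>) (I t \<omega>)"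
    let ?A = "{\<omega> \<in> space M. ?d \<omega> > e / 2}"
    have dm: "?d \<in> borel_measurable M" by (intro borel_measurable_dist meas It)
    have A: "?A \<in> sets M" using dm by measurable
    have "time_partition t N (equipart 0 t N)"
      using t N0 by (auto simp: time_partition_def intro: equipart_mono)
    then have P: "prob ?A < e / 2" by (rule \<delta>(2)) (use h in \<open>simp add: equipart_step\<close>)
    have intA: "integrable M (indicator ?A :: 'a \<Rightarrow> real)"
      by (rule integrable_real_indicator[OF A]) (simp add: less_top[symmetric])
    have int: "integrable M (\<lambda>\<omega>. min 1 (?d \<omega>))"
      by (rule integrable_min_1[OF dm]) simp
    have "expectation (\<lambda>\<omega>. min 1 (?d \<omega>)) \<le> expectation (\<lambda>\<omega>. e / 2 + indicator ?A \<omega>)"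
    proof (rule integral_mono[OF int])
      show "integrable M (\<lambda>\<omega>. e / 2 + indicator ?A \<omega> :: real)"
        by (rule Bochner_Integration.integrable_add[OF integrable_const intA])
      show "min 1 (?d \<omega>) \<le> e / 2 + indicator ?A \<omega>" if "\<omega> \<in> space M" for \<omega>
        using that e by (auto simp: indicator_def min_def)
    qed
    also have "\<dots> = e / 2 + prob ?A"
      by (subst Bochner_Integration.integral_add[OF integrable_const intA]) (use A in \<open>simp add: prob_space\<close>)
    also have "\<dots> < e" using P by simp
    finally have "expectation (\<lambda>\<omega>. min 1 (?d \<omega>)) < e" .
    moreover have "0 \<le> expectation (\<lambda>\<omega>. min 1 (?d \<omega>))" by (rule integral_nonneg_AE) auto
    ultimately show "norm (expectation (\<lambda>\<omega>. min 1 (?d \<omega>)) - 0) < e" by simp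
  qed
qed

text \<open>
  The two complex Riemann sums combine into the imaginary part of \<open>cnj x y\<close>, which is the real inner product of
  \<open>\<i> x\<close> with \<open>y\<close>; the terms without \<open>y\<close> cancel.
\<close>

lemma area_increment:
  "Re (\<i> / 2 * (x / of_real d * (cnj y - cnj x) - cnj x / of_real d * (y - x))) = (\<i> * x) \<bullet> y / d"
  by (cases "d = 0") (simp_all add: inner_complex_def field_simps)

lemma min_1_add_le: "0 \<le> x \<Longrightarrow> 0 \<le> y \<Longrightarrow> min 1 (x + y) \<le> min 1 x + min 1 y" for x y :: real
  by (auto simp: min_def)

lemma min_1_sum_le:
  assumes "finite A" "\<And>i. i \<in> A \<Longrightarrow> 0 \<le> (d i :: real)"
  shows "min 1 (\<Sum>i\<in>A. d i) \<le> (\<Sum>i\<in>A. min 1 (d i))"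
  using assms
proof (induction A)
  case (insert a A)
  have "0 \<le> (\<Sum>i\<in>A. d i)" "0 \<le> d a" using insert.prems by (auto intro: sum_nonneg)
  then have "min 1 (d a + (\<Sum>i\<in>A. d i)) \<le> min 1 (d a) + min 1 (\<Sum>i\<in>A. d i)" by (rule min_1_add_le[rotated])
  with insert show ?case by auto
qed simp

lemma abs_cos_diff_le_min:
  fixes x y c s :: real
  assumes "\<bar>x - y\<bar> \<le> c * s" "0 \<le> c" "0 \<le> s"
  shows "\<bar>cos x - cos y\<bar> \<le> 2 * (c + 1) * min 1 s"
proof (cases "s \<le> 1")
  case True
  have "\<bar>cos x - cos y\<bar> \<le> c * s" using abs_cos_diff_le[of x y] assms by linarith
  also have "\<dots> \<le> (2 * (c + 1)) * s" using assms by (intro mult_right_mono) auto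
  finally show ?thesis using True by (simp add: min_def)
next
  case False
  have "\<bar>cos x - cos y\<bar> \<le> 2" using abs_cos_le_one[of x] abs_cos_le_one[of y] by linarith
  also have "\<dots> \<le> 2 * (c + 1)" using assms by simp
  finally show ?thesis using False by (simp add: min_def)
qed

context hyperbolic_brownian_motion
begin

text \<open>
  The truncation is not felt on this event, whatever the number of cells.  Only partition points are inspected,
  which makes it a countable intersection.
\<close>

definition stay :: "real \<Rightarrow> real \<Rightarrow> 'a set" where
  "stay t \<delta> = {\<omega> \<in> space M. \<forall>N. \<forall>k\<in>{..N}. \<delta> \<le> 1 - w (equipart 0 t N k) \<omega> \<bullet> w (equipart 0 t N k) \<omega>}"

lemma stay_sets:
  assumes "0 \<le> t" shows "stay t \<delta> \<in> sets M"
proof -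
  have [measurable]: "w (equipart 0 t N k) \<in> borel_measurable M" for N k
    by (intro w_measurable equipart_nonneg assms)
  show ?thesis unfolding stay_def by measurable
qed

lemma prob_not_stay_tendsto_0:
  assumes t: "0 \<le> t"
  shows "(\<lambda>m. prob (space M - stay t (1 / real (Suc m)))) \<longlonglongrightarrow> 0"
proof -
  let ?B = "\<lambda>m. space M - stay t (1 / real (Suc m))"
  have B: "?B m \<in> sets M" for m using stay_sets[OF t] by auto
  have "(\<lambda>m. expectation (indicator (?B m))) \<longlonglongrightarrow> expectation (\<lambda>_. 0 :: real)"
  proof (rule integral_dominated_convergence[where w = "\<lambda>_. 1"])
    show "(indicator (?B m) :: 'a \<Rightarrow> real) \<in> borel_measurable M" for m using B by measurable
    show "AE \<omega> in M. (\<lambda>m. indicator (?B m) \<omega> :: real) \<longlonglongrightarrow> 0"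
    proof (rule AE_I2)
      fix \<omega> assume \<omega>: "\<omega> \<in> space M"
      have "continuous_on {0..t} (\<lambda>r. 1 - w r \<omega> \<bullet> w r \<omega>)"
        by (intro continuous_intros w_continuous \<omega>) auto
      then obtain r where r: "r \<in> {0..t}" "\<And>x. x \<in> {0..t} \<Longrightarrow> 1 - w r \<omega> \<bullet> w r \<omega> \<le> 1 - w x \<omega> \<bullet> w x \<omega>"
        using continuous_attains_inf[of "{0..t}" "\<lambda>r. 1 - w r \<omega> \<bullet> w r \<omega>"] t by auto
      have "0 < 1 - w r \<omega> \<bullet> w r \<omega>" using w_inner_less_1[OF \<omega>, of r] r by simp
      then obtain m0 where m0: "1 / real (Suc m0) < 1 - w r \<omega> \<bullet> w r \<omega>"
        using nat_approx_posE by (metis inverse_eq_divide)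
      have "indicator (?B m) \<omega> = (0 :: real)" if m: "m0 \<le> m" for m
      proof -
        have "1 / real (Suc m) \<le> 1 / real (Suc m0)" using m by (simp add: divide_simps)
        then have le: "1 / real (Suc m) \<le> 1 - w x \<omega> \<bullet> w x \<omega>" if "x \<in> {0..t}" for x
          using m0 r(2)[OF that] by linarith
        have "equipart 0 t N k \<in> {0..t}" if "k \<le> N" for N k
          using equipart_in[OF t, of N k] that t by (cases "N = 0") auto
        with le have "\<omega> \<in> stay t (1 / real (Suc m))" using \<omega> by (auto simp: stay_def)
        then show ?thesis by simp
      qed
      then have "\<forall>\<^sub>F m in sequentially. 0 = (indicator (?B m) \<omega> :: real)"
        unfolding eventually_sequentially by metis
      then show "(\<lambda>m. indicator (?B m) \<omega> :: real) \<longlonglongrightarrow> 0"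
        by (rule Lim_transform_eventually[OF tendsto_const])
    qed
  qed (auto simp: indicator_def)
  then show ?thesis using B by simp
qed

text \<open>
  The random variable \<open>W\<close> is the discrete, truncated version of \<open>V\<close>, and its expectation tends to \<open>cos \<phi>\<close>.  On the event
  \<open>stay t \<delta>\<close> the two differ by the error of the Riemann sum \<open>R\<close> for the exponent and by the error of the Riemann sum
  for the area, which are controlled by \<open>R_lim\<close> and \<open>e_lim\<close>; outside of it, boundedness is used.  So \<open>cos \<phi>\<close> and the
  expectation of \<open>V\<close> differ by at most a multiple of the probability that the path comes within \<open>\<delta>\<close> of the
  boundary, and \<open>\<delta>\<close> is arbitrary.
\<close>

lemma exponential_identity:
  assumes area: "stochastic_area M w \<theta>" and t: "0 < t"
  shows "expectation (\<lambda>\<omega>. exp (\<xi>\<^sup>2 / 2 * integral {0..t} (\<lambda>r. w r \<omega> \<bullet> w r \<omega>)) * cos (\<phi> + \<xi> * \<theta> t \<omega>)) = cos \<phi>"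
proof -
  define HI where "HI j = (\<lambda>t \<omega>. w t \<omega> $ j / of_real (1 - (norm (w t \<omega>))\<^sup>2))" for j
  define HJ where "HJ j = (\<lambda>t \<omega>. cnj (w t \<omega> $ j) / of_real (1 - (norm (w t \<omega>))\<^sup>2))" for j
  define XI where "XI j = (\<lambda>t \<omega>. cnj (w t \<omega> $ j))" for j
  define XJ where "XJ j = (\<lambda>t \<omega>. w t \<omega> $ j)" for j
  obtain I J where I: "\<And>j. ito_integral M (HI j) (XI j) (I j)"
    and J: "\<And>j. ito_integral M (HJ j) (XJ j) (J j)"
    and \<theta>: "AE \<omega> in M. \<forall>t\<ge>0. complex_of_real (\<theta> t \<omega>) = \<i> / 2 * (\<Sum>j\<in>UNIV. I j t \<omega> - J j t \<omega>)"
    using area unfolding stochastic_area_def HI_def HJ_def XI_def XJ_def by blast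
  have \<theta>M: "\<theta> t \<in> borel_measurable M" using area t by (simp add: stochastic_area_def)
  have t0: "0 \<le> t" using t by simp
  let ?p = "equipart 0 t"
  have wM[measurable]: "w (?p N k) \<in> borel_measurable M" for N k
    by (intro w_measurable equipart_nonneg t0)
  have nthM: "(\<lambda>\<omega>. w (?p N k) \<omega> $ j) \<in> borel_measurable M" for N k j
    by (rule measurable_compose[OF wM borel_measurable_continuous_onI]) (intro continuous_intros)
  have cnjM: "(\<lambda>\<omega>. cnj (w (?p N k) \<omega> $ j)) \<in> borel_measurable M" for N k j
    by (rule measurable_compose[OF wM borel_measurable_continuous_onI]) (intro continuous_intros)
  have denM: "(\<lambda>\<omega>. complex_of_real (1 - (norm (w (?p N k) \<omega>))\<^sup>2)) \<in> borel_measurable M" for N k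
    by (rule measurable_compose[OF wM borel_measurable_continuous_onI]) (intro continuous_intros)
  define LI where "LI N j \<omega> = left_sum (HI j) (XI j) N (?p N) \<omega>" for N j \<omega>
  define LJ where "LJ N j \<omega> = left_sum (HJ j) (XJ j) N (?p N) \<omega>" for N j \<omega>
  have LIM: "LI N j \<in> borel_measurable M" for N j
    unfolding LI_def left_sum_def HI_def XI_def
    by (intro borel_measurable_sum borel_measurable_times borel_measurable_diff borel_measurable_divide nthM cnjM denM)
  have LJM: "LJ N j \<in> borel_measurable M" for N j
    unfolding LJ_def left_sum_def HJ_def XJ_def
    by (intro borel_measurable_sum borel_measurable_times borel_measurable_diff borel_measurable_divide nthM cnjM denM)
  have IM: "I j t \<in> borel_measurable M" and JM: "J j t \<in> borel_measurable M" for j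
    using I[of j] J[of j] t0 by (auto simp: ito_integral_def)
  define dI where "dI N j \<omega> = dist (LI N j \<omega>) (I j t \<omega>)" for N j \<omega>
  define dJ where "dJ N j \<omega> = dist (LJ N j \<omega>) (J j t \<omega>)" for N j \<omega>
  have dIM: "dI N j \<in> borel_measurable M" and dJM: "dJ N j \<in> borel_measurable M" for N j
    unfolding dI_def dJ_def by (intro borel_measurable_dist LIM LJM IM JM)+
  define e where "e N \<omega> = (\<Sum>j\<in>UNIV. min 1 (dI N j \<omega>) + min 1 (dJ N j \<omega>))" for N \<omega>
  have mint: "integrable M (\<lambda>\<omega>. min 1 (dI N j \<omega>))" "integrable M (\<lambda>\<omega>. min 1 (dJ N j \<omega>))" for N j
    by (rule integrable_min_1[OF dIM] integrable_min_1[OF dJM]; simp add: dI_def dJ_def)+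
  have eint: "integrable M (e N)" for N
    unfolding e_def by (intro Bochner_Integration.integrable_sum Bochner_Integration.integrable_add mint)
  have e_lim: "(\<lambda>N. expectation (e N)) \<longlonglongrightarrow> 0"
  proof -
    have "(\<lambda>N. \<Sum>j\<in>UNIV. expectation (\<lambda>\<omega>. min 1 (dI N j \<omega>)) + expectation (\<lambda>\<omega>. min 1 (dJ N j \<omega>)))
        \<longlonglongrightarrow> (\<Sum>j\<in>(UNIV :: 'n set). 0 + 0)"
      unfolding dI_def dJ_def LI_def LJ_def
      by (intro tendsto_sum tendsto_add ito_integral_left_sums[OF I t] ito_integral_left_sums[OF J t]
          LIM[unfolded LI_def] LJM[unfolded LJ_def])
    moreover have "expectation (e N) = (\<Sum>j\<in>UNIV. expectation (\<lambda>\<omega>. min 1 (dI N j \<omega>))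
        + expectation (\<lambda>\<omega>. min 1 (dJ N j \<omega>)))" for N
      by (simp add: e_def[abs_def] mint)
    ultimately show ?thesis by simp
  qed
  define area_N where "area_N N \<omega> = Re (\<i> / 2 * (\<Sum>j\<in>UNIV. LI N j \<omega> - LJ N j \<omega>))" for N \<omega>
  have area_eq: "area_N N \<omega> = (\<Sum>k<N. (imult (w (?p N k) \<omega>) \<bullet> w (?p N (Suc k)) \<omega>) / (1 - w (?p N k) \<omega> \<bullet> w (?p N k) \<omega>))"
    for N \<omega>
  proof -
    define x where "x k j = w (?p N k) \<omega> $ j" for k j
    define d where "d k = 1 - w (?p N k) \<omega> \<bullet> w (?p N k) \<omega>" for k
    have "LI N j \<omega> - LJ N j \<omega> = (\<Sum>k<N. x k j / of_real (d k) * (cnj (x (Suc k) j) - cnj (x k j))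
        - cnj (x k j) / of_real (d k) * (x (Suc k) j - x k j))" for j
      by (simp add: LI_def LJ_def left_sum_def HI_def HJ_def XI_def XJ_def x_def d_def sum_subtractf
          power2_norm_eq_inner)
    then have "area_N N \<omega> = (\<Sum>j\<in>UNIV. \<Sum>k<N. Re (\<i> / 2 * (x k j / of_real (d k) * (cnj (x (Suc k) j) - cnj (x k j))
        - cnj (x k j) / of_real (d k) * (x (Suc k) j - x k j))))"
      by (simp only: area_N_def sum_distrib_left Re_sum)
    also have "\<dots> = (\<Sum>k<N. (\<Sum>j\<in>UNIV. (\<i> * x k j) \<bullet> x (Suc k) j) / d k)"
      unfolding area_increment sum_divide_distrib by (rule sum.swap)
    finally show ?thesis by (simp add: x_def d_def inner_vec_def)
  qed
  have area_close: "AE \<omega> in M. \<bar>area_N N \<omega> - \<theta> t \<omega>\<bar> \<le> (\<Sum>j\<in>UNIV. dI N j \<omega> + dJ N j \<omega>)" for N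
    using \<theta>
  proof eventually_elim
    fix \<omega> assume "\<forall>t\<ge>0. complex_of_real (\<theta> t \<omega>) = \<i> / 2 * (\<Sum>j\<in>UNIV. I j t \<omega> - J j t \<omega>)"
    then have "complex_of_real (\<theta> t \<omega>) = \<i> / 2 * (\<Sum>j\<in>UNIV. I j t \<omega> - J j t \<omega>)" using t0 by blast
    then have th: "\<theta> t \<omega> = Re (\<i> / 2 * (\<Sum>j\<in>UNIV. I j t \<omega> - J j t \<omega>))"
      by (metis Re_complex_of_real)
    have "area_N N \<omega> - \<theta> t \<omega> = Re (\<i> / 2 * (\<Sum>j\<in>UNIV. (LI N j \<omega> - I j t \<omega>) - (LJ N j \<omega> - J j t \<omega>)))"
      unfolding area_N_def th minus_complex.simps(1)[symmetric] right_diff_distrib[symmetric]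
      by (simp add: sum_subtractf sum.distrib algebra_simps)
    also have "\<bar>\<dots>\<bar> \<le> cmod (\<i> / 2 * (\<Sum>j\<in>UNIV. (LI N j \<omega> - I j t \<omega>) - (LJ N j \<omega> - J j t \<omega>)))"
      by (rule abs_Re_le_cmod)
    also have "\<dots> \<le> 1 * (\<Sum>j\<in>UNIV. dI N j \<omega> + dJ N j \<omega>)"
      unfolding norm_mult dI_def dJ_def dist_norm
      by (intro mult_mono order_trans[OF norm_sum] sum_mono norm_triangle_ineq4) auto
    finally show "\<bar>area_N N \<omega> - \<theta> t \<omega>\<bar> \<le> (\<Sum>j\<in>UNIV. dI N j \<omega> + dJ N j \<omega>)" by simp
  qed
  define E where "E = exp (\<xi>\<^sup>2 * t / 2)"
  define A where "A \<omega> = \<xi>\<^sup>2 / 2 * integral {0..t} (\<lambda>r. w r \<omega> \<bullet> w r \<omega>)" for \<omega>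
  define R where "R N \<omega> = (\<Sum>k<N. \<xi>\<^sup>2 / 2 * (w (?p N k) \<omega> \<bullet> w (?p N k) \<omega>) * (t / real N))" for N \<omega>
  define V where "V \<omega> = exp (A \<omega>) * cos (\<phi> + \<xi> * \<theta> t \<omega>)" for \<omega>
  define W where "W \<delta> N \<omega> = exp (clock \<delta> \<xi> t N N \<omega>) * cos (phase \<delta> \<xi> \<phi> t N N \<omega>)" for \<delta> N \<omega>
  have E0: "0 < E" by (simp add: E_def)
  have contsq: "continuous_on UNIV (\<lambda>b::complex ^ 'n. b \<bullet> b)" by (intro continuous_intros)
  have ci: "continuous_on {0..t} (\<lambda>r. w r \<omega> \<bullet> w r \<omega>)" if "\<omega> \<in> space M" for \<omega>
    by (intro continuous_intros w_continuous that) auto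
  have AM: "A \<in> borel_measurable M"
    unfolding A_def by (intro borel_measurable_times borel_measurable_const path_integral_measurable[OF contsq]) (use t0 in auto)
  have RM: "R N \<in> borel_measurable M" for N
    unfolding R_def by measurable
  have le1: "w r \<omega> \<bullet> w r \<omega> \<le> 1" if "\<omega> \<in> space M" "0 \<le> r" for \<omega> r
    using w_inner_less_1[OF that] by simp
  have Ab: "0 \<le> A \<omega>" "exp (A \<omega>) \<le> E" if \<omega>: "\<omega> \<in> space M" for \<omega>
  proof -
    have "0 \<le> integral {0..t} (\<lambda>r. w r \<omega> \<bullet> w r \<omega>)"
      by (rule integral_nonneg[OF integrable_continuous_real[OF ci[OF \<omega>]]]) simp
    then show "0 \<le> A \<omega>" by (simp add: A_def)
    have "integral {0..t} (\<lambda>r. w r \<omega> \<bullet> w r \<omega>) \<le> integral {0..t} (\<lambda>r. 1)"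
      by (rule integral_le[OF integrable_continuous_real[OF ci[OF \<omega>]] integrable_const_ivl]) (use le1[OF \<omega>] in auto)
    then have "\<xi>\<^sup>2 / 2 * integral {0..t} (\<lambda>r. w r \<omega> \<bullet> w r \<omega>) \<le> \<xi>\<^sup>2 / 2 * t"
      using t0 by (intro mult_left_mono) auto
    then show "exp (A \<omega>) \<le> E" by (simp add: A_def E_def)
  qed
  have Rb: "exp (R N \<omega>) \<le> E" if \<omega>: "\<omega> \<in> space M" for N \<omega>
  proof -
    have "R N \<omega> \<le> (\<Sum>k<N. \<xi>\<^sup>2 / 2 * 1 * (t / real N))"
      unfolding R_def using t0
      by (intro sum_mono mult_right_mono mult_left_mono le1 \<omega> equipart_nonneg) auto
    also have "\<dots> \<le> \<xi>\<^sup>2 * t / 2" using t0 by (cases "N = 0") auto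
    finally show ?thesis by (simp add: E_def)
  qed
  have RA: "\<bar>exp (R N \<omega>) - exp (A \<omega>)\<bar> \<le> E" if \<omega>: "\<omega> \<in> space M" for N \<omega>
  proof -
    have "exp (R N \<omega>) - exp (A \<omega>) \<le> E - 0" by (intro diff_mono Rb \<omega>) simp
    moreover have "exp (A \<omega>) - exp (R N \<omega>) \<le> E - 0" by (intro diff_mono Ab \<omega>) simp
    ultimately show ?thesis by (simp add: abs_le_iff)
  qed
  have R_lim: "(\<lambda>N. expectation (\<lambda>\<omega>. \<bar>exp (R N \<omega>) - exp (A \<omega>)\<bar>)) \<longlonglongrightarrow> 0"
  proof -
    have "(\<lambda>N. expectation (\<lambda>\<omega>. \<bar>exp (R N \<omega>) - exp (A \<omega>)\<bar>)) \<longlonglongrightarrow> expectation (\<lambda>\<omega>. 0)"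
    proof (rule integral_dominated_convergence[where w = "\<lambda>_. E"])
      show "(\<lambda>\<omega>. \<bar>exp (R N \<omega>) - exp (A \<omega>)\<bar>) \<in> borel_measurable M" for N
        using RM AM by measurable
      show "AE \<omega> in M. norm \<bar>exp (R N \<omega>) - exp (A \<omega>)\<bar> \<le> E" for N
        by (rule AE_I2) (simp add: RA)
      show "AE \<omega> in M. (\<lambda>N. \<bar>exp (R N \<omega>) - exp (A \<omega>)\<bar>) \<longlonglongrightarrow> 0"
      proof (rule AE_I2)
        fix \<omega> assume \<omega>: "\<omega> \<in> space M"
        have "(\<lambda>N. R N \<omega>) \<longlonglongrightarrow> A \<omega>"
          using tendsto_mult_left[OF riemann_sum_tendsto_integral[OF t0 ci[OF \<omega>]], of "\<xi>\<^sup>2 / 2"]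
          by (simp add: R_def A_def sum_distrib_left mult.assoc)
        then have "(\<lambda>N. \<bar>exp (R N \<omega>) - exp (A \<omega>)\<bar>) \<longlonglongrightarrow> \<bar>exp (A \<omega>) - exp (A \<omega>)\<bar>"
          by (intro tendsto_intros)
        then show "(\<lambda>N. \<bar>exp (R N \<omega>) - exp (A \<omega>)\<bar>) \<longlonglongrightarrow> 0" by simp
      qed
    qed auto
    then show ?thesis by simp
  qed
  have intR: "integrable M (\<lambda>\<omega>. \<bar>exp (R N \<omega>) - exp (A \<omega>)\<bar>)" for N
  proof (rule integrable_bounded)
    show "(\<lambda>\<omega>. \<bar>exp (R N \<omega>) - exp (A \<omega>)\<bar>) \<in> borel_measurable M" using RM AM by measurable
    show "\<bar>\<bar>exp (R N \<omega>) - exp (A \<omega>)\<bar>\<bar> \<le> E" if "\<omega> \<in> space M" for \<omega>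
      using RA[OF that] by simp
  qed
  have VM: "V \<in> borel_measurable M" unfolding V_def using AM \<theta>M by measurable
  have Vb: "\<bar>V \<omega>\<bar> \<le> E" if "\<omega> \<in> space M" for \<omega>
    using mult_mono[OF Ab(2)[OF that] abs_cos_le_one[of "\<phi> + \<xi> * \<theta> t \<omega>"]] E0 by (simp add: V_def abs_mult)
  have Vint: "integrable M V" by (rule integrable_bounded[OF VM Vb])
  have WM: "W \<delta> N \<in> borel_measurable M" for \<delta> N
    unfolding W_def using clock_measurable[OF t0, of \<delta> \<xi> N N] phase_measurable[OF t0, of \<delta> \<xi> \<phi> N N] by measurable
  have Wb: "\<bar>W \<delta> N \<omega>\<bar> \<le> E" if "\<omega> \<in> space M" for \<omega> \<delta> N
    using mult_mono[OF _ abs_cos_le_one[of "phase \<delta> \<xi> \<phi> t N N \<omega>"], of "exp (clock \<delta> \<xi> t N N \<omega>)" E]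
      clock_bounds(2)[OF that t0 order_refl, of \<delta> \<xi> N] E0
    by (simp add: W_def abs_mult E_def)
  have Wint: "integrable M (W \<delta> N)" for \<delta> N by (rule integrable_bounded[OF WM Wb])
  have bound: "\<bar>cos \<phi> - expectation V\<bar> \<le> 2 * E * prob (space M - stay t \<delta>)" if \<delta>: "0 < \<delta>" for \<delta>
  proof -
    let ?B = "space M - stay t \<delta>"
    have B: "?B \<in> sets M" using stay_sets[OF t0] by auto
    define g where "g N \<omega> = \<bar>exp (R N \<omega>) - exp (A \<omega>)\<bar> + E * (2 * (\<bar>\<xi>\<bar> + 1)) * e N \<omega> + 2 * E * indicator ?B \<omega>" for N \<omega>
    have pointwise: "AE \<omega> in M. \<bar>W \<delta> N \<omega> - V \<omega>\<bar> \<le> g N \<omega>" for N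
      using area_close[of N] AE_space
    proof eventually_elim
      fix \<omega> assume close: "\<bar>area_N N \<omega> - \<theta> t \<omega>\<bar> \<le> (\<Sum>j\<in>UNIV. dI N j \<omega> + dJ N j \<omega>)" and \<omega>: "\<omega> \<in> space M"
      have e0: "0 \<le> e N \<omega>" unfolding e_def by (intro sum_nonneg) (auto simp: dI_def dJ_def)
      show "\<bar>W \<delta> N \<omega> - V \<omega>\<bar> \<le> g N \<omega>"
      proof (cases "\<omega> \<in> stay t \<delta>")
        case False
        have "\<bar>W \<delta> N \<omega> - V \<omega>\<bar> \<le> 2 * E" using Wb[OF \<omega>, of \<delta> N] Vb[OF \<omega>] by linarith
        also have "\<dots> \<le> g N \<omega>" using False \<omega> e0 E0 by (simp add: g_def)
        finally show ?thesis .
      next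
        case True
        then have st: "\<delta> \<le> 1 - w (?p N k) \<omega> \<bullet> w (?p N k) \<omega>" if "k < N" for k
          using that by (simp add: stay_def)
        have cl: "clock \<delta> \<xi> t N N \<omega> = R N \<omega>"
          unfolding clock_def R_def by (intro sum.cong refl) (simp add: rate_def st)
        have ph: "phase \<delta> \<xi> \<phi> t N N \<omega> = \<phi> + \<xi> * area_N N \<omega>"
          unfolding phase_def area_eq sum_distrib_left by (intro arg_cong2[where f = "(+)"] sum.cong refl) (simp add: turn_def st)
        have "min 1 (\<Sum>j\<in>UNIV. dI N j \<omega> + dJ N j \<omega>) \<le> (\<Sum>j\<in>UNIV. min 1 (dI N j \<omega> + dJ N j \<omega>))"
          by (rule min_1_sum_le) (auto simp: dI_def dJ_def)
        also have "\<dots> \<le> e N \<omega>"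
          unfolding e_def by (intro sum_mono min_1_add_le) (auto simp: dI_def dJ_def)
        finally have m: "min 1 (\<Sum>j\<in>UNIV. dI N j \<omega> + dJ N j \<omega>) \<le> e N \<omega>" .
        have "\<bar>(\<phi> + \<xi> * area_N N \<omega>) - (\<phi> + \<xi> * \<theta> t \<omega>)\<bar> = \<bar>\<xi>\<bar> * \<bar>area_N N \<omega> - \<theta> t \<omega>\<bar>"
          by (simp add: abs_mult right_diff_distrib[symmetric])
        also have "\<dots> \<le> \<bar>\<xi>\<bar> * (\<Sum>j\<in>UNIV. dI N j \<omega> + dJ N j \<omega>)"
          by (intro mult_left_mono close) auto
        finally have "\<bar>cos (\<phi> + \<xi> * area_N N \<omega>) - cos (\<phi> + \<xi> * \<theta> t \<omega>)\<bar>
            \<le> 2 * (\<bar>\<xi>\<bar> + 1) * min 1 (\<Sum>j\<in>UNIV. dI N j \<omega> + dJ N j \<omega>)"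
          by (rule abs_cos_diff_le_min) (auto intro!: sum_nonneg simp: dI_def dJ_def)
        also have "\<dots> \<le> 2 * (\<bar>\<xi>\<bar> + 1) * e N \<omega>" by (intro mult_left_mono m) auto
        finally have cosd: "\<bar>cos (\<phi> + \<xi> * area_N N \<omega>) - cos (\<phi> + \<xi> * \<theta> t \<omega>)\<bar> \<le> 2 * (\<bar>\<xi>\<bar> + 1) * e N \<omega>" .
        have "W \<delta> N \<omega> - V \<omega> = (exp (R N \<omega>) - exp (A \<omega>)) * cos (\<phi> + \<xi> * area_N N \<omega>)
            + exp (A \<omega>) * (cos (\<phi> + \<xi> * area_N N \<omega>) - cos (\<phi> + \<xi> * \<theta> t \<omega>))"
          by (simp add: W_def V_def cl ph algebra_simps)
        also have "\<bar>\<dots>\<bar> \<le> \<bar>exp (R N \<omega>) - exp (A \<omega>)\<bar> * 1 + E * (2 * (\<bar>\<xi>\<bar> + 1) * e N \<omega>)"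
          by (intro order_trans[OF abs_triangle_ineq] add_mono; unfold abs_mult; intro mult_mono cosd)
            (use Ab[OF \<omega>] E0 in auto)
        also have "\<dots> = g N \<omega>" using True by (simp add: g_def mult.assoc)
        finally show ?thesis .
      qed
    qed
    have intB: "integrable M (indicator ?B :: 'a \<Rightarrow> real)"
      by (rule integrable_real_indicator[OF B]) (simp add: less_top[symmetric])
    have gint: "integrable M (g N)" for N
      unfolding g_def by (intro Bochner_Integration.integrable_add integrable_mult_right intR eint intB)
    have Eg: "expectation (g N) = expectation (\<lambda>\<omega>. \<bar>exp (R N \<omega>) - exp (A \<omega>)\<bar>)
        + E * (2 * (\<bar>\<xi>\<bar> + 1)) * expectation (e N) + 2 * E * prob ?B" for N
      unfolding g_def
      using B by (simp add: intR eint intB)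
    have "\<bar>expectation (W \<delta> N) - expectation V\<bar> \<le> expectation (g N)" for N
    proof -
      have "expectation (W \<delta> N) - expectation V = expectation (\<lambda>\<omega>. W \<delta> N \<omega> - V \<omega>)"
        using Wint Vint by simp
      also have "\<bar>\<dots>\<bar> \<le> expectation (\<lambda>\<omega>. \<bar>W \<delta> N \<omega> - V \<omega>\<bar>)" by (rule integral_abs_bound)
      also have "\<dots> \<le> expectation (g N)"
        using Wint Vint by (intro integral_mono_AE gint pointwise) auto
      finally show ?thesis .
    qed
    moreover have "(\<lambda>N. \<bar>expectation (W \<delta> N) - expectation V\<bar>) \<longlonglongrightarrow> \<bar>cos \<phi> - expectation V\<bar>"
      unfolding W_def by (intro tendsto_intros discrete_exponential_tendsto \<delta> t0)
    moreover have "(\<lambda>N. expectation (g N)) \<longlonglongrightarrow> 0 + E * (2 * (\<bar>\<xi>\<bar> + 1)) * 0 + 2 * E * prob ?B"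
      unfolding Eg by (intro tendsto_add tendsto_mult tendsto_const R_lim e_lim)
    ultimately have "\<bar>cos \<phi> - expectation V\<bar> \<le> 0 + E * (2 * (\<bar>\<xi>\<bar> + 1)) * 0 + 2 * E * prob ?B"
      by (intro LIMSEQ_le) auto
    then show ?thesis by simp
  qed
  have "(\<lambda>m. 2 * E * prob (space M - stay t (1 / real (Suc m)))) \<longlonglongrightarrow> 2 * E * 0"
    by (intro tendsto_mult tendsto_const prob_not_stay_tendsto_0 t0)
  then have "\<bar>cos \<phi> - expectation V\<bar> \<le> 2 * E * 0"
    by (rule LIMSEQ_le_const) (use bound in auto)
  then show ?thesis by (simp add: V_def[abs_def] A_def)
qed

section \<open>Convergence of the characteristic functions\<close>

text \<open>
  For \<open>\<xi> = x / sqrt t\<close> the exponent in \<open>exponential_identity\<close> is \<open>x\<^sup>2/2\<close> minus \<open>x\<^sup>2/(2 t) \<integral>\<^sub>0\<^sup>t u\<close>, and the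
  subtracted term is small by \<open>expected_mean_defect\<close>.
\<close>

lemma cos_area_bound:
  assumes area: "stochastic_area M w \<theta>" and t: "0 < t"
  shows "\<bar>exp (x\<^sup>2 / 2) * expectation (\<lambda>\<omega>. cos (\<phi> + x * (\<theta> t \<omega> / sqrt t))) - cos \<phi>\<bar>
     \<le> exp (x\<^sup>2 / 2) * (x\<^sup>2 / 2) / sqrt t"
proof -
  define \<xi> where "\<xi> = x / sqrt t"
  define u where "u \<omega> = integral {0..t} (\<lambda>r. 1 - w r \<omega> \<bullet> w r \<omega>)" for \<omega>
  define c where "c \<omega> = cos (\<phi> + \<xi> * \<theta> t \<omega>)" for \<omega>
  have \<xi>2: "\<xi>\<^sup>2 = x\<^sup>2 / t" using t by (simp add: \<xi>_def power_divide)
  have t0: "0 \<le> t" using t by simp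
  have \<theta>M: "\<theta> t \<in> borel_measurable M" using area t by (simp add: stochastic_area_def)
  have cM: "c \<in> borel_measurable M" unfolding c_def using \<theta>M by measurable
  have contu: "continuous_on UNIV (\<lambda>b::complex ^ 'n. 1 - b \<bullet> b)" by (intro continuous_intros)
  have uM: "u \<in> borel_measurable M" unfolding u_def by (rule path_integral_measurable[OF contu]) (use t0 in auto)
  have ci: "(\<lambda>r. w r \<omega> \<bullet> w r \<omega>) integrable_on {0..t}" if "\<omega> \<in> space M" for \<omega>
    by (intro integrable_continuous_real continuous_intros w_continuous that) auto
  have u_eq: "u \<omega> = t - integral {0..t} (\<lambda>r. w r \<omega> \<bullet> w r \<omega>)" if "\<omega> \<in> space M" for \<omega>
    unfolding u_def using Henstock_Kurzweil_Integration.integral_diff[OF integrable_const_ivl ci[OF that], of 1] t0 by simp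
  have u_bd: "0 \<le> u \<omega>" "u \<omega> \<le> t" if \<omega>: "\<omega> \<in> space M" for \<omega>
  proof -
    have "(\<lambda>r. 1 - w r \<omega> \<bullet> w r \<omega>) integrable_on {0..t}" by (rule integrable_diff[OF integrable_const_ivl ci[OF \<omega>]])
    then show "0 \<le> u \<omega>"
      unfolding u_def by (rule integral_nonneg) (use w_inner_less_1[OF \<omega>] in \<open>auto intro: less_imp_le\<close>)
    have "0 \<le> integral {0..t} (\<lambda>r. w r \<omega> \<bullet> w r \<omega>)" by (rule integral_nonneg[OF ci[OF \<omega>]]) simp
    then show "u \<omega> \<le> t" using u_eq[OF \<omega>] by simp
  qed
  have uint: "integrable M u" by (rule integrable_bounded[OF uM, of t]) (use u_bd in auto)
  have cint: "integrable M c" by (rule integrable_bounded[OF cM, of 1]) (simp add: c_def)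
  have A: "\<xi>\<^sup>2 / 2 * integral {0..t} (\<lambda>r. w r \<omega> \<bullet> w r \<omega>) = x\<^sup>2 / 2 - x\<^sup>2 / (2 * t) * u \<omega>" if "\<omega> \<in> space M" for \<omega>
  proof -
    have "integral {0..t} (\<lambda>r. w r \<omega> \<bullet> w r \<omega>) = t - u \<omega>" using u_eq[OF that] by simp
    then show ?thesis using t by (simp only: \<xi>2) (simp add: field_simps)
  qed
  have "expectation (\<lambda>\<omega>. exp (x\<^sup>2 / 2 - x\<^sup>2 / (2 * t) * u \<omega>) * c \<omega>) = cos \<phi>"
    unfolding exponential_identity[OF area t, of \<xi> \<phi>, symmetric] c_def
    by (intro Bochner_Integration.integral_cong refl) (simp only: A)
  moreover have dint: "integrable M (\<lambda>\<omega>. exp (x\<^sup>2 / 2 - x\<^sup>2 / (2 * t) * u \<omega>) * c \<omega>)"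
  proof (rule integrable_bounded)
    show "(\<lambda>\<omega>. exp (x\<^sup>2 / 2 - x\<^sup>2 / (2 * t) * u \<omega>) * c \<omega>) \<in> borel_measurable M" using uM cM by measurable
    show "\<bar>exp (x\<^sup>2 / 2 - x\<^sup>2 / (2 * t) * u \<omega>) * c \<omega>\<bar> \<le> exp (x\<^sup>2 / 2) * 1" if "\<omega> \<in> space M" for \<omega>
      unfolding abs_mult using u_bd[OF that] t by (intro mult_mono) (auto simp: c_def)
  qed
  ultimately have diff: "exp (x\<^sup>2 / 2) * expectation c - cos \<phi>
      = expectation (\<lambda>\<omega>. exp (x\<^sup>2 / 2) * c \<omega> - exp (x\<^sup>2 / 2 - x\<^sup>2 / (2 * t) * u \<omega>) * c \<omega>)"
    using cint by simp
  have "\<bar>exp (x\<^sup>2 / 2) * expectation c - cos \<phi>\<bar> \<le> expectation (\<lambda>\<omega>. exp (x\<^sup>2 / 2) * (x\<^sup>2 / (2 * t)) * u \<omega>)"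
    unfolding diff
  proof (rule order_trans[OF integral_abs_bound integral_mono])
    show "integrable M (\<lambda>\<omega>. \<bar>exp (x\<^sup>2 / 2) * c \<omega> - exp (x\<^sup>2 / 2 - x\<^sup>2 / (2 * t) * u \<omega>) * c \<omega>\<bar>)"
      using cint dint by simp
    show "integrable M (\<lambda>\<omega>. exp (x\<^sup>2 / 2) * (x\<^sup>2 / (2 * t)) * u \<omega>)" using uint by simp
    fix \<omega> assume \<omega>: "\<omega> \<in> space M"
    define y where "y = x\<^sup>2 / (2 * t) * u \<omega>"
    have y: "0 \<le> y" using u_bd[OF \<omega>] t by (simp add: y_def)
    have ey: "exp (x\<^sup>2 / 2 - y) = exp (x\<^sup>2 / 2) * exp (- y)" by (simp add: exp_add[symmetric])
    have "exp (x\<^sup>2 / 2) * c \<omega> - exp (x\<^sup>2 / 2 - y) * c \<omega> = exp (x\<^sup>2 / 2) * ((1 - exp (- y)) * c \<omega>)"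
      unfolding ey by (simp only: left_diff_distrib right_diff_distrib mult_1_left mult.assoc)
    also have "\<bar>\<dots>\<bar> \<le> exp (x\<^sup>2 / 2) * (y * 1)"
      unfolding abs_mult using y exp_ge_add_one_self[of "- y"] by (intro mult_mono) (auto simp: c_def)
    finally show "\<bar>exp (x\<^sup>2 / 2) * c \<omega> - exp (x\<^sup>2 / 2 - x\<^sup>2 / (2 * t) * u \<omega>) * c \<omega>\<bar>
        \<le> exp (x\<^sup>2 / 2) * (x\<^sup>2 / (2 * t)) * u \<omega>" by (simp add: y_def mult.assoc)
  qed
  also have "\<dots> = exp (x\<^sup>2 / 2) * (x\<^sup>2 / (2 * t)) * expectation u" by simp
  also have "\<dots> \<le> exp (x\<^sup>2 / 2) * (x\<^sup>2 / (2 * t)) * sqrt t"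
    unfolding u_def using t by (intro mult_left_mono expected_mean_defect) auto
  also have "\<dots> = exp (x\<^sup>2 / 2) * (x\<^sup>2 / 2) / sqrt t"
    using t real_sqrt_mult_self[of t] by (simp add: field_simps)
  finally show ?thesis by (simp add: c_def[abs_def] \<xi>_def)
qed

lemma cos_area_tendsto:
  assumes area: "stochastic_area M w \<theta>" and \<tau>: "filterlim \<tau> at_top sequentially" "\<And>k. 0 < \<tau> k"
  shows "(\<lambda>k. expectation (\<lambda>\<omega>. cos (\<phi> + x * (\<theta> (\<tau> k) \<omega> / sqrt (\<tau> k))))) \<longlonglongrightarrow> exp (- x\<^sup>2 / 2) * cos \<phi>"
proof -
  let ?m = "\<lambda>k. expectation (\<lambda>\<omega>. cos (\<phi> + x * (\<theta> (\<tau> k) \<omega> / sqrt (\<tau> k))))"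
  have "(\<lambda>k. exp (x\<^sup>2 / 2) * (x\<^sup>2 / 2) / sqrt (\<tau> k)) \<longlonglongrightarrow> 0"
    by (rule real_tendsto_divide_at_top[OF tendsto_const filterlim_compose[OF sqrt_at_top \<tau>(1)]])
  then have "(\<lambda>k. exp (x\<^sup>2 / 2) * ?m k - cos \<phi>) \<longlonglongrightarrow> 0"
    by (rule Lim_null_comparison[rotated]) (use cos_area_bound[OF area \<tau>(2)] in simp)
  then have "(\<lambda>k. exp (x\<^sup>2 / 2) * ?m k) \<longlonglongrightarrow> cos \<phi>" by (rule LIM_zero_cancel)
  then have "(\<lambda>k. exp (- x\<^sup>2 / 2) * (exp (x\<^sup>2 / 2) * ?m k)) \<longlonglongrightarrow> exp (- x\<^sup>2 / 2) * cos \<phi>"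
    by (intro tendsto_intros)
  then show ?thesis by (simp add: mult.assoc[symmetric] exp_add[symmetric])
qed

lemma area_weak_convergence:
  assumes area: "stochastic_area M w \<theta>" and \<tau>: "filterlim \<tau> at_top sequentially" "\<And>k. 0 < \<tau> k"
  shows "weak_conv_m (\<lambda>k. distr M borel (\<lambda>\<omega>. \<theta> (\<tau> k) \<omega> / sqrt (\<tau> k))) std_normal_distribution"
proof (rule levy_continuity)
  let ?Y = "\<lambda>k \<omega>. \<theta> (\<tau> k) \<omega> / sqrt (\<tau> k)"
  have Y: "?Y k \<in> borel_measurable M" for k
  proof -
    have "\<theta> (\<tau> k) \<in> borel_measurable M"
      using area \<tau>(2)[of k] by (simp add: stochastic_area_def)
    then show ?thesis by measurable
  qed
  show "real_distribution (distr M borel (?Y k))" for k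
    by (rule real_distribution_distr[OF Y])
  show "real_distribution std_normal_distribution" by (rule real_dist_normal_dist)
  fix x :: real
  \<comment> \<open>the phase \<open>-\<pi>/2\<close> turns the cosine into the sine\<close>
  have char: "char (distr M borel (?Y k)) x
      = Complex (expectation (\<lambda>\<omega>. cos (0 + x * ?Y k \<omega>))) (expectation (\<lambda>\<omega>. cos (- pi / 2 + x * ?Y k \<omega>)))" for k
  proof -
    have "(\<lambda>\<omega>. iexp (x * ?Y k \<omega>)) \<in> borel_measurable M" using Y[of k] by measurable
    then have int: "integrable M (\<lambda>\<omega>. iexp (x * ?Y k \<omega>))"
      by (intro integrable_const_bound[of _ 1]) auto
    have "char (distr M borel (?Y k)) x = (CLINT \<omega>|M. iexp (x * ?Y k \<omega>))"
      unfolding char_def by (rule integral_distr[OF Y]) measurable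
    moreover have "Re (CLINT \<omega>|M. iexp (x * ?Y k \<omega>)) = expectation (\<lambda>\<omega>. cos (0 + x * ?Y k \<omega>))"
      by (subst integral_Re[OF int, symmetric]) (simp add: Re_exp)
    moreover have "Im (CLINT \<omega>|M. iexp (x * ?Y k \<omega>)) = expectation (\<lambda>\<omega>. cos (- pi / 2 + x * ?Y k \<omega>))"
      by (subst integral_Im[OF int, symmetric]) (simp add: Im_exp cos_diff)
    ultimately show ?thesis by (simp add: complex_eq_iff)
  qed
  have "(\<lambda>k. char (distr M borel (?Y k)) x) \<longlonglongrightarrow> Complex (exp (- x\<^sup>2 / 2) * cos 0) (exp (- x\<^sup>2 / 2) * cos (- pi / 2))"
    unfolding char by (intro tendsto_Complex cos_area_tendsto area \<tau>)
  also have "Complex (exp (- x\<^sup>2 / 2) * cos 0) (exp (- x\<^sup>2 / 2) * cos (- pi / 2)) = char std_normal_distribution x"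
    by (simp add: char_std_normal_distribution complex_eq_iff Re_exp Im_exp)
  finally show "(\<lambda>k. char (distr M borel (?Y k)) x) \<longlonglongrightarrow> char std_normal_distribution x" .
qed

end

section \<open>Asymptotic normality\<close>

theorem theorem3p7:
  fixes M :: "'a measure"
    and w :: "real \<Rightarrow> 'a \<Rightarrow> complex ^ 'n"
    and \<theta> :: "real \<Rightarrow> 'a \<Rightarrow> real"
  assumes "prob_space M"
    and "CH_brownian_motion M w"
    and "stochastic_area M w \<theta>"
  shows "\<forall>\<tau> :: nat \<Rightarrow> real. filterlim \<tau> at_top sequentially \<longrightarrow>
           weak_conv_m (\<lambda>k. distr M borel (\<lambda>\<omega>. \<theta> (\<tau> k) \<omega> / sqrt (\<tau> k))) std_normal_distribution"
proof (intro allI impI)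
  fix \<tau> :: "nat \<Rightarrow> real" assume \<tau>: "filterlim \<tau> at_top sequentially"
  interpret hyperbolic_brownian_motion M w
    using assms(1,2) by (intro hyperbolic_brownian_motion.intro hyperbolic_brownian_motion_axioms.intro)
  \<comment> \<open>finitely many of the times may be nonpositive, where \<open>\<theta>\<close> is not known to be measurable and the scaling degenerates\<close>
  define \<sigma> where "\<sigma> k = (if 0 < \<tau> k then \<tau> k else 1)" for k
  have ev: "\<forall>\<^sub>F k in sequentially. \<sigma> k = \<tau> k"
    using filterlim_at_top_dense[THEN iffD1, OF \<tau>, rule_format, of 0] by eventually_elim (simp add: \<sigma>_def)
  have "filterlim \<sigma> at_top sequentially"
    using \<tau> by (rule filterlim_cong[THEN iffD1, OF refl refl, rotated]) (use ev in eventually_elim, simp)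
  then have "weak_conv_m (\<lambda>k. distr M borel (\<lambda>\<omega>. \<theta> (\<sigma> k) \<omega> / sqrt (\<sigma> k))) std_normal_distribution"
    by (rule area_weak_convergence[OF assms(3)]) (simp add: \<sigma>_def)
  then show "weak_conv_m (\<lambda>k. distr M borel (\<lambda>\<omega>. \<theta> (\<tau> k) \<omega> / sqrt (\<tau> k))) std_normal_distribution"
    unfolding weak_conv_m_def weak_conv_def
  proof (elim all_forward imp_forward)
    fix x
    assume "(\<lambda>k. cdf (distr M borel (\<lambda>\<omega>. \<theta> (\<sigma> k) \<omega> / sqrt (\<sigma> k))) x) \<longlonglongrightarrow> cdf std_normal_distribution x"
    then show "(\<lambda>k. cdf (distr M borel (\<lambda>\<omega>. \<theta> (\<tau> k) \<omega> / sqrt (\<tau> k))) x) \<longlonglongrightarrow> cdf std_normal_distribution x"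
      by (rule Lim_transform_eventually) (use ev in eventually_elim, simp)
  qed
qed

end
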